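(* Let $D\subset\mathbb{R}^3$ be a bounded domain, $D':=\mathbb{R}^3\setminus D$, and let $k>0$. Let $K^2:\mathbb{R}^3\to\mathbb{C}$ satisfy $K^2\in C^2(\mathbb{R}^3)$, $K^2(x)\neq 0$ for all $x\in\mathbb{R}^3$, and $K^2(x)=k^2$ for $x\in D'$. Put $p(x):=K^2(x)-k^2$ and $q(x):=\frac{\nabla K^2(x)}{K^2(x)}$, where $q=0$ in $D'$ (in particular on $\partial D$). For vector fields $E:D\to\mathbb{C}^3$ define $$TE(x):=\int_D g(x,y)p(y)E(y)\,dy+\nabla_x\int_D g(x,y)\,q(y)\cdot E(y)\,dy,\qquad g(x,y):=\frac{e^{ik|x-y|}}{4\pi|x-y|}.$$ Then $T$ is a compact operator in $H^1(D)$, so that the equation $$E(x)=E_0(x)+\int_D g(x,y)\Big(p(y)E(y)+\nabla_y\big(q(y)\cdot E(y)\big)\Big)dy$$ is of Fredholm type in $H^1(D)$ (that is, it is a Fredholm equation of the second kind $E=E_0+TE$ with $T$ compact in $H^1(D)$).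
   Context: $H^1(D)$ denotes the usual Sobolev space of $\mathbb{C}^3$-valued vector fields on $D$ with components in the scalar complex Sobolev space $H^1(D)$. $K^2$ is the name of a complex-valued function (it is not required to be given as a square). For complex vectors, $q\cdot E=\sum_{j=1}^3 q_jE_j$ (bilinear, no conjugation). $E_0$ is the incident plane wave $E_0(x)=\mathcal{E}e^{ik\alpha\cdot x}$, where $\alpha\in S^2$ (the unit sphere in $\mathbb{R}^3$) and $\mathcal{E}$ is a constant vector with $\mathcal{E}\cdot\alpha=0$. *)

theory Defs
  imports "HOL-Analysis.Analysis"
begin

section \<open>Classical derivatives and test functions\<close>

definition pd :: "3 \<Rightarrow> (real^3 \<Rightarrow> complex) \<Rightarrow> real^3 \<Rightarrow> complex" where
  "pd i f x = frechet_derivative f (at x) (axis i 1)"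

definition grad :: "(real^3 \<Rightarrow> complex) \<Rightarrow> real^3 \<Rightarrow> complex^3" where
  "grad f x = (\<chi> i. pd i f x)"

primrec Ck :: "nat \<Rightarrow> (real^3 \<Rightarrow> complex) \<Rightarrow> bool" where
  "Ck 0 f = continuous_on UNIV f"
| "Ck (Suc n) f = ((\<forall>x. f differentiable (at x)) \<and> (\<forall>i. Ck n (pd i f)))"

definition test_function :: "(real^3) set \<Rightarrow> (real^3 \<Rightarrow> complex) \<Rightarrow> bool" where
  "test_function D \<phi> \<longleftrightarrow> (\<forall>n. Ck n \<phi>) \<and>
     compact (closure {x. \<phi> x \<noteq> 0}) \<and> closure {x. \<phi> x \<noteq> 0} \<subseteq> D"

section \<open>The Sobolev space of an open set\<close>

text \<open>
  A function on \<open>D\<close> is represented by a total function whose values outside \<open>D\<close> are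
  irrelevant. Elements of Lebesgue and Sobolev spaces are represented by functions, not by
  classes of functions modulo equality almost everywhere; hence the norms below are seminorms
  on the representatives, and equality in the space is equality almost everywhere in \<open>D\<close>.
\<close>

definition L2 :: "(real^3) set \<Rightarrow> (real^3 \<Rightarrow> complex) set" where
  "L2 D = {u. u \<in> borel_measurable (lebesgue_on D) \<and>
              integrable (lebesgue_on D) (\<lambda>x. (norm (u x))\<^sup>2)}"

text \<open>Only used for \<open>u\<close> and \<open>v\<close> in \<open>L2 D\<close>, so that both integrals exist.\<close>

definition is_weak_pd :: "(real^3) set \<Rightarrow> 3 \<Rightarrow> (real^3 \<Rightarrow> complex) \<Rightarrow> (real^3 \<Rightarrow> complex) \<Rightarrow> bool" where
  "is_weak_pd D i u v \<longleftrightarrow> (\<forall>\<phi>. test_function D \<phi> \<longrightarrow>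
     (\<integral>x. u x * pd i \<phi> x \<partial>lebesgue_on D) = - (\<integral>x. v x * \<phi> x \<partial>lebesgue_on D))"

definition H1 :: "(real^3) set \<Rightarrow> (real^3 \<Rightarrow> complex) set" where
  "H1 D = {u \<in> L2 D. \<forall>i. \<exists>v\<in>L2 D. is_weak_pd D i u v}"

text \<open>For \<open>u\<close> in \<open>H1 D\<close> the chosen function is determined up to a null set.\<close>

definition weak_pd :: "(real^3) set \<Rightarrow> 3 \<Rightarrow> (real^3 \<Rightarrow> complex) \<Rightarrow> real^3 \<Rightarrow> complex" where
  "weak_pd D i u = (SOME v. v \<in> L2 D \<and> is_weak_pd D i u v)"

definition weak_grad :: "(real^3) set \<Rightarrow> (real^3 \<Rightarrow> complex) \<Rightarrow> real^3 \<Rightarrow> complex^3" where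
  "weak_grad D u x = (\<chi> i. weak_pd D i u x)"

definition H1_vec :: "(real^3) set \<Rightarrow> (real^3 \<Rightarrow> complex^3) set" where
  "H1_vec D = {E. \<forall>j. (\<lambda>x. E x $ j) \<in> H1 D}"

definition H1_vec_norm :: "(real^3) set \<Rightarrow> (real^3 \<Rightarrow> complex^3) \<Rightarrow> real" where
  "H1_vec_norm D E = sqrt (\<Sum>j\<in>UNIV.
     (\<integral>x. (norm (E x $ j))\<^sup>2 \<partial>lebesgue_on D) +
     (\<Sum>i\<in>UNIV. \<integral>x. (norm (weak_pd D i (\<lambda>y. E y $ j) x))\<^sup>2 \<partial>lebesgue_on D))"

text \<open>
  A linear operator mapping bounded sequences to sequences with a convergent subsequence.
  Compatibility with equality almost everywhere is not required separately: it follows from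
  linearity and compactness, a representative of zero having all its multiples of norm zero.
\<close>

definition compact_operator_H1 ::
    "(real^3) set \<Rightarrow> ((real^3 \<Rightarrow> complex^3) \<Rightarrow> real^3 \<Rightarrow> complex^3) \<Rightarrow> bool" where
  "compact_operator_H1 D A \<longleftrightarrow>
     (\<forall>E\<in>H1_vec D. A E \<in> H1_vec D) \<and>
     (\<forall>E\<in>H1_vec D. \<forall>F\<in>H1_vec D. \<forall>c.
        AE x in lebesgue_on D. A (\<lambda>y. c *s E y + F y) x = c *s A E x + A F x) \<and>
     (\<forall>E :: nat \<Rightarrow> real^3 \<Rightarrow> complex^3.
        (\<forall>n. E n \<in> H1_vec D) \<and> (\<exists>B. \<forall>n. H1_vec_norm D (E n) \<le> B) \<longrightarrow>
        (\<exists>r :: nat \<Rightarrow> nat. \<exists>F\<in>H1_vec D. strict_mono r \<and>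
           (\<lambda>n. H1_vec_norm D (\<lambda>x. A (E (r n)) x - F x)) \<longlonglongrightarrow> 0))"

text \<open>
  The equation \<open>E = \<Phi> E\<close> in \<open>H1_vec D\<close> is the Fredholm equation of the second kind
  \<open>E = b + A E\<close>, with \<open>A\<close> compact.
\<close>

definition fredholm_second_kind_H1 ::
    "(real^3) set \<Rightarrow> ((real^3 \<Rightarrow> complex^3) \<Rightarrow> real^3 \<Rightarrow> complex^3) \<Rightarrow>
     (real^3 \<Rightarrow> complex^3) \<Rightarrow> ((real^3 \<Rightarrow> complex^3) \<Rightarrow> real^3 \<Rightarrow> complex^3) \<Rightarrow> bool" where
  "fredholm_second_kind_H1 D \<Phi> b A \<longleftrightarrow>
     b \<in> H1_vec D \<and> compact_operator_H1 D A \<and>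
     (\<forall>E\<in>H1_vec D. AE x in lebesgue_on D. \<Phi> E x = b x + A E x)"

section \<open>The integral equation of electromagnetic scattering\<close>

text \<open>Bilinear, without conjugation.\<close>

definition cdot :: "complex^3 \<Rightarrow> complex^3 \<Rightarrow> complex" where
  "cdot a b = (\<Sum>j\<in>UNIV. a $ j * b $ j)"

text \<open>At \<open>x = y\<close> the value is 0, by the convention for division; this is a null set in \<open>y\<close>.\<close>

definition green :: "real \<Rightarrow> real^3 \<Rightarrow> real^3 \<Rightarrow> complex" where
  "green k x y = exp (\<i> * of_real (k * norm (x - y))) / of_real (4 * pi * norm (x - y))"

definition scalar_potential ::
    "real \<Rightarrow> (real^3) set \<Rightarrow> (real^3 \<Rightarrow> complex) \<Rightarrow> real^3 \<Rightarrow> complex" where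
  "scalar_potential k D f x = (\<integral>y. green k x y * f y \<partial>lebesgue_on D)"

definition vector_potential ::
    "real \<Rightarrow> (real^3) set \<Rightarrow> (real^3 \<Rightarrow> complex^3) \<Rightarrow> real^3 \<Rightarrow> complex^3" where
  "vector_potential k D F x = (\<integral>y. green k x y *s F y \<partial>lebesgue_on D)"

text \<open>In the following, \<open>K2\<close> is the function written \<open>K\<^sup>2\<close> in the mathematics.\<close>

definition p_coeff :: "real \<Rightarrow> (real^3 \<Rightarrow> complex) \<Rightarrow> real^3 \<Rightarrow> complex" where
  "p_coeff k K2 x = K2 x - of_real (k\<^sup>2)"

definition q_coeff :: "(real^3 \<Rightarrow> complex) \<Rightarrow> real^3 \<Rightarrow> complex^3" where
  "q_coeff K2 x = (1 / K2 x) *s grad K2 x"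

definition T_op ::
    "real \<Rightarrow> (real^3 \<Rightarrow> complex) \<Rightarrow> (real^3) set \<Rightarrow> (real^3 \<Rightarrow> complex^3) \<Rightarrow> real^3 \<Rightarrow> complex^3" where
  "T_op k K2 D E x =
     vector_potential k D (\<lambda>y. p_coeff k K2 y *s E y) x +
     grad (scalar_potential k D (\<lambda>y. cdot (q_coeff K2 y) (E y))) x"

definition plane_wave :: "real \<Rightarrow> real^3 \<Rightarrow> complex^3 \<Rightarrow> real^3 \<Rightarrow> complex^3" where
  "plane_wave k \<alpha> \<E> x = exp (\<i> * of_real (k * (\<alpha> \<bullet> x))) *s \<E>"

text \<open>The density \<open>p E + \<nabla> (q \<cdot> E)\<close>; for \<open>E\<close> in \<open>H1_vec D\<close> the gradient is a weak one.\<close>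

definition source_density ::
    "real \<Rightarrow> (real^3 \<Rightarrow> complex) \<Rightarrow> (real^3) set \<Rightarrow> (real^3 \<Rightarrow> complex^3) \<Rightarrow> real^3 \<Rightarrow> complex^3" where
  "source_density k K2 D E y =
     p_coeff k K2 y *s E y + weak_grad D (\<lambda>z. cdot (q_coeff K2 z) (E z)) y"

definition scattering_rhs ::
    "real \<Rightarrow> (real^3 \<Rightarrow> complex) \<Rightarrow> (real^3) set \<Rightarrow> (real^3 \<Rightarrow> complex^3) \<Rightarrow>
     (real^3 \<Rightarrow> complex^3) \<Rightarrow> real^3 \<Rightarrow> complex^3" where
  "scattering_rhs k K2 D E0 E x = E0 x + vector_potential k D (source_density k K2 D E) x"

text \<open>
  For \<open>E\<close> in \<open>H1_vec D\<close> all the integrals and derivatives in \<open>T_op\<close> and \<open>scattering_rhs\<close>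
  exist, so that none of the total functions above takes a default value there.
\<close>

definition operators_well_defined ::
    "real \<Rightarrow> (real^3 \<Rightarrow> complex) \<Rightarrow> (real^3) set \<Rightarrow> (real^3 \<Rightarrow> complex^3) \<Rightarrow> bool" where
  "operators_well_defined k K2 D E \<longleftrightarrow>
     (\<lambda>y. cdot (q_coeff K2 y) (E y)) \<in> H1 D \<and>
     (\<forall>x\<in>D.
        integrable (lebesgue_on D) (\<lambda>y. green k x y *s (p_coeff k K2 y *s E y)) \<and>
        integrable (lebesgue_on D) (\<lambda>y. green k x y * cdot (q_coeff K2 y) (E y)) \<and>
        scalar_potential k D (\<lambda>y. cdot (q_coeff K2 y) (E y)) differentiable (at x) \<and>
        integrable (lebesgue_on D) (\<lambda>y. green k x y *s source_density k K2 D E y))"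

end

theory Submission
  imports Defs "HOL-Complex_Analysis.Great_Picard" "HOL-Library.Diagonal_Subsequence" "HOL-Real_Asymp.Real_Asymp"
begin

text \<open>
  Write \<open>S f\<close> for the convolution of the kernel \<open>g\<close> with \<open>f\<close> over \<open>D\<close>. The theorem rests on two
  facts: \<open>T E = S f\<close> for a density \<open>f\<close> whose norm in \<open>L2 D\<close> is bounded by the \<open>H1\<close> norm of \<open>E\<close>, and \<open>S\<close> is
  compact from \<open>L2 D\<close> to \<open>H1 D\<close>.

  For the first fact consider \<open>w = q \<cdot> E\<close>. As \<open>q\<close> is continuously differentiable and vanishes outside \<open>D\<close>,
  truncating \<open>q\<close> near its zeros turns an arbitrary continuously differentiable function into an admissible test
  function, and no boundary term is left when the truncation is removed: \<open>w\<close>, extended by zero, has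
  weak derivatives in \<open>L2\<close> of the whole space (\<open>ext_pd_product\<close>). Hence a derivative of \<open>S w\<close> can be moved from the
  kernel to \<open>w\<close>, and \<open>S w\<close> is classically differentiable with \<open>\<partial>\<^sub>i (S w) = S (\<partial>\<^sub>i w)\<close> at every point of \<open>D\<close>
  (\<open>S_has_gradient\<close>). So the components of \<open>T E\<close> are \<open>S (p E\<^sub>i + \<partial>\<^sub>i (q \<cdot> E))\<close> (\<open>T_op_nth\<close>), which is also
  the integral in the equation to be solved (\<open>scattering_rhs_eq\<close>).

  For the second fact replace \<open>\<bar>z\<bar>\<close> in the kernel by \<open>sqrt (\<epsilon>\<^sup>2 + \<bar>z\<bar>\<^sup>2)\<close>. Convolution with a continuous
  kernel maps bounded subsets of \<open>L2 D\<close> to bounded equicontinuous families, so the Arzela-Ascoli theorem and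
  a diagonal argument give one subsequence along which all regularised potentials and their gradients converge
  uniformly. The regularisation error is at most the norm of \<open>f\<close> times a norm of the error of the kernel: the \<open>L2\<close> norm
  for the potential, by the Cauchy-Schwarz inequality, and the \<open>L1\<close> norm for its gradient, by Young's inequality
  (\<open>conv_L1_kernel\<close>). Both tend to 0 because \<open>1 / \<bar>z\<bar>\<^sup>2\<close> is locally integrable in three dimensions. The
  limits exist in \<open>H1 D\<close> by completeness of \<open>L2 D\<close> and closedness of the weak derivative (\<open>S_compact\<close>,
  \<open>L2_complete\<close>, \<open>is_weak_pd_closed\<close>).

  Weak derivatives are unique up to null sets (\<open>fundamental_lemma\<close>), so the norm of \<open>H1\<close> can be computed from any
  of them, not just from the one that is chosen by \<open>weak_pd\<close>.
\<close>

section \<open>Calculus of partial derivatives\<close>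

lemma has_derivative_pd:
  assumes "f differentiable (at x)"
  shows "(f has_derivative (\<lambda>h. \<Sum>i\<in>UNIV. of_real (h $ i) * pd i f x)) (at x)"
proof -
  let ?f' = "frechet_derivative f (at x)"
  have d: "(f has_derivative ?f') (at x)"
    using assms frechet_derivative_works by blast
  have lin: "linear ?f'" using d has_derivative_linear by blast
  have "?f' h = (\<Sum>i\<in>UNIV. of_real (h $ i) * pd i f x)" for h
  proof -
    have "h = (\<Sum>i\<in>UNIV. h $ i *\<^sub>R axis i 1)"
      by (metis (no_types, lifting) basis_expansion scalar_mult_eq_scaleR sum.cong)
    then have "?f' h = ?f' (\<Sum>i\<in>UNIV. h $ i *\<^sub>R axis i 1)" by simp
    also have "\<dots> = (\<Sum>i\<in>UNIV. h $ i *\<^sub>R ?f' (axis i 1))"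
      by (simp add: linear_sum[OF lin] linear_cmul[OF lin])
    finally show ?thesis by (simp add: pd_def scaleR_conv_of_real)
  qed
  then have "?f' = (\<lambda>h. \<Sum>i\<in>UNIV. of_real (h $ i) * pd i f x)" by blast
  with d show ?thesis by simp
qed

lemma pd_eqI: "(f has_derivative f') (at x) \<Longrightarrow> pd i f x = f' (axis i 1)"
  by (metis frechet_derivative_at pd_def)

lemma Ck_Suc_imp: "Ck (Suc n) f \<Longrightarrow> Ck n f"
proof (induction n arbitrary: f)
  case 0
  then show ?case
    by (simp add: continuous_on_eq_continuous_at differentiable_imp_continuous_within)
qed simp

lemma Ck_imp_continuous: "Ck n f \<Longrightarrow> continuous_on UNIV f"
proof (induction n)
  case (Suc n)
  then show ?case using Ck_Suc_imp by blast
qed simp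

lemma Ck_1_pd_continuous: "Ck 1 f \<Longrightarrow> continuous_on UNIV (pd i f)"
  by simp

lemma pd_const [simp]: "pd i (\<lambda>x. c) = (\<lambda>x. 0)"
proof
  fix x :: "real^3"
  have "((\<lambda>x. c) has_derivative (\<lambda>h. 0)) (at x)" by simp
  from pd_eqI[OF this] show "pd i (\<lambda>x. c) x = 0" .
qed

lemma Ck_const [simp]: "Ck n (\<lambda>x. c)"
  by (induction n arbitrary: c) simp_all

lemma pd_add:
  assumes "f differentiable (at x)" "g differentiable (at x)"
  shows "pd i (\<lambda>x. f x + g x) x = pd i f x + pd i g x"
  unfolding pd_def[of i f] pd_def[of i g]
  by (rule pd_eqI[OF has_derivative_add]) (use assms frechet_derivative_works in blast)+

lemma pd_mult:
  assumes "f differentiable (at x)" "g differentiable (at x)"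
  shows "pd i (\<lambda>x. f x * g x) x = f x * pd i g x + pd i f x * g x"
  unfolding pd_def[of i f] pd_def[of i g]
  by (rule pd_eqI[OF has_derivative_mult]) (use assms frechet_derivative_works in blast)+

lemma pd_inverse:
  assumes "f differentiable (at x)" "f x \<noteq> 0"
  shows "pd i (\<lambda>x. 1 / f x) x = - pd i f x / (f x)\<^sup>2"
proof -
  have "((\<lambda>x. 1 / f x) has_derivative (\<lambda>h. - frechet_derivative f (at x) h / (f x)\<^sup>2)) (at x)"
    using assms by (auto intro!: derivative_eq_intros simp: frechet_derivative_works power2_eq_square field_simps)
  from pd_eqI[OF this] show ?thesis by (simp add: pd_def)
qed

lemma Ck_add: "Ck n f \<Longrightarrow> Ck n g \<Longrightarrow> Ck n (\<lambda>x. f x + g x)"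
proof (induction n arbitrary: f g)
  case (Suc n)
  have "pd i (\<lambda>x. f x + g x) = (\<lambda>x. pd i f x + pd i g x)" for i
    using Suc.prems by (intro ext pd_add) auto
  then show ?case using Suc by auto
qed (auto intro: continuous_intros)

lemma Ck_mult: "Ck n f \<Longrightarrow> Ck n g \<Longrightarrow> Ck n (\<lambda>x. f x * g x)"
proof (induction n arbitrary: f g)
  case (Suc n)
  have "pd i (\<lambda>x. f x * g x) = (\<lambda>x. f x * pd i g x + pd i f x * g x)" for i
    using Suc.prems by (intro ext pd_mult) auto
  moreover have "Ck n f" "Ck n g"
    using Suc.prems Ck_Suc_imp by auto
  ultimately show ?case using Suc by (auto intro!: Ck_add)
qed (auto intro: continuous_intros)

lemma Ck_1_inverse:
  assumes "Ck 1 f" "\<And>x. f x \<noteq> 0"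
  shows "Ck 1 (\<lambda>x. 1 / f x)"
proof -
  have d: "\<And>x. f differentiable (at x)" and c: "\<And>i. continuous_on UNIV (pd i f)"
    using assms by auto
  have "pd i (\<lambda>x. 1 / f x) = (\<lambda>x. - pd i f x / (f x)\<^sup>2)" for i
    using d assms by (intro ext pd_inverse) auto
  moreover have "continuous_on UNIV f"
    using assms Ck_imp_continuous by blast
  ultimately show ?thesis using d c assms(2)
    by (auto intro!: continuous_intros differentiable_divide)
qed

lemma has_derivative_reflect:
  assumes "f differentiable (at (a - y))"
  shows "((\<lambda>y. f (a - y)) has_derivative (\<lambda>h. - frechet_derivative f (at (a - y)) h)) (at y)"
proof -
  let ?f' = "frechet_derivative f (at (a - y))"
  have d: "(f has_derivative ?f') (at (a - y))"
    using assms frechet_derivative_works by blast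
  have "((\<lambda>y. a - y) has_derivative (\<lambda>h. - h)) (at y)"
    by (auto intro!: derivative_eq_intros)
  from has_derivative_compose[OF this d] show ?thesis
    by (simp add: linear_neg[OF has_derivative_linear[OF d]])
qed

lemma pd_reflect:
  assumes "f differentiable (at (a - y))"
  shows "pd i (\<lambda>y. f (a - y)) y = - pd i f (a - y)"
  using pd_eqI[OF has_derivative_reflect[OF assms]] by (simp add: pd_def)

lemma Ck_reflect: "Ck n f \<Longrightarrow> Ck n (\<lambda>y. f (a - y))"
proof (induction n arbitrary: f)
  case 0
  then have "continuous_on UNIV f" by simp
  from continuous_on_compose2[OF this, of UNIV "\<lambda>y. a - y"] show ?case
    by (simp add: continuous_intros)
next
  case (Suc n)
  have "pd i (\<lambda>y. f (a - y)) = (\<lambda>y. (- 1) * pd i f (a - y))" for i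
    using Suc.prems by (intro ext) (simp add: pd_reflect)
  moreover have "(\<lambda>y. f (a - y)) differentiable (at y)" for y
    using has_derivative_reflect[of f a y] Suc.prems by (auto simp: differentiable_def)
  moreover have "Ck n (\<lambda>y. (- 1) * pd i f (a - y))" for i
    using Suc by (intro Ck_mult Ck_const) auto
  ultimately show ?case by auto
qed

lemma pd_eq_0_outside_support:
  assumes "x \<notin> closure {x. f x \<noteq> 0}"
  shows "pd i f x = 0"
proof -
  have "((\<lambda>x. 0) has_derivative (\<lambda>h. 0)) (at x)" by simp
  then have "(f has_derivative (\<lambda>h. 0)) (at x)"
  proof (rule has_derivative_transform_within_open)
    show "open (- closure {x. f x \<noteq> 0})" by (intro open_Compl closed_closure)
    show "0 = f y" if "y \<in> - closure {x. f x \<noteq> 0}" for y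
      using that closure_subset[of "{x. f x \<noteq> 0}"] by fastforce
  qed (use assms in simp)
  from pd_eqI[OF this] show ?thesis .
qed

section \<open>Smooth bump functions\<close>

text \<open>The linear span of the family is closed under differentiation, which gives smoothness of all its members at once.\<close>

definition flat_exp :: "nat \<Rightarrow> real \<Rightarrow> real" where
  "flat_exp m t = (if t > 0 then exp (- 1 / t) / t ^ m else 0)"

lemma DERIV_flat_exp:
  "(flat_exp m has_real_derivative flat_exp (m + 2) t - real m * flat_exp (m + 1) t) (at t)"
proof -
  consider "t > 0" | "t < 0" | "t = 0" by linarith
  then show ?thesis
  proof cases
    case 1
    have "((\<lambda>t. exp (- 1 / t) / t ^ m) has_real_derivative
        flat_exp (m + 2) t - real m * flat_exp (m + 1) t) (at t)"
    proof (cases m)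
      case 0
      then show ?thesis using 1
        by (auto intro!: derivative_eq_intros simp: flat_exp_def field_simps power2_eq_square)
    next
      case (Suc l)
      have p: "((\<lambda>t. t ^ m) has_real_derivative real m * t ^ l) (at t)"
        using DERIV_pow[of m t] Suc by simp
      have e: "((\<lambda>t. exp (- 1 / t)) has_real_derivative exp (- 1 / t) / t\<^sup>2) (at t)"
        using 1 by (auto intro!: derivative_eq_intros simp: field_simps power2_eq_square)
      show ?thesis using 1 Suc
        by (intro DERIV_cong[OF DERIV_divide[OF e p]])
          (auto simp: flat_exp_def field_simps power2_eq_square)
    qed
    then show ?thesis
      by (rule has_field_derivative_transform_within_open[of _ _ _ "{0<..}"])
        (use 1 in \<open>auto simp: flat_exp_def\<close>)
  next
    case 2
    have "((\<lambda>t. 0) has_real_derivative 0) (at t)" by simp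
    then have "(flat_exp m has_real_derivative 0) (at t)"
      by (rule has_field_derivative_transform_within_open[of _ _ _ "{..<0}"])
        (use 2 in \<open>auto simp: flat_exp_def\<close>)
    then show ?thesis using 2 by (simp add: flat_exp_def)
  next
    case 3
    have "((\<lambda>h. flat_exp m h / h) \<longlongrightarrow> 0) (at 0)"
      unfolding filterlim_at_split
    proof
      have "((\<lambda>h. 0 :: real) \<longlongrightarrow> 0) (at_left 0)" by simp
      then show "((\<lambda>h. flat_exp m h / h) \<longlongrightarrow> 0) (at_left 0)"
        by (rule Lim_transform_eventually)
          (auto simp: flat_exp_def eventually_at_filter)
      have "((\<lambda>h::real. exp (- 1 / h) / h ^ m / h) \<longlongrightarrow> 0) (at_right 0)"
        by real_asymp
      then show "((\<lambda>h. flat_exp m h / h) \<longlongrightarrow> 0) (at_right 0)"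
        by (rule Lim_transform_eventually)
          (auto simp: flat_exp_def eventually_at_filter)
    qed
    then show ?thesis using 3 by (simp add: DERIV_def flat_exp_def)
  qed
qed

lemma radial:
  fixes F :: "real \<Rightarrow> complex"
  assumes "(F has_vector_derivative F') (at (c + s * (x \<bullet> x)))"
  shows differentiable_radial: "(\<lambda>x::real^3. F (c + s * (x \<bullet> x))) differentiable (at x)"
    and pd_radial: "pd i (\<lambda>x. F (c + s * (x \<bullet> x))) x = of_real (2 * s * x $ i) * F'"
proof -
  have "((\<lambda>x::real^3. c + s * (x \<bullet> x)) has_derivative (\<lambda>h. s * (2 * (x \<bullet> h)))) (at x)"
    by (auto intro!: derivative_eq_intros simp: inner_commute)
  from has_derivative_compose[OF this assms[unfolded has_vector_derivative_def]]
  have d: "((\<lambda>x::real^3. F (c + s * (x \<bullet> x))) has_derivative (\<lambda>h. (s * (2 * (x \<bullet> h))) *\<^sub>R F')) (at x)" .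
  show "(\<lambda>x::real^3. F (c + s * (x \<bullet> x))) differentiable (at x)"
    unfolding differentiable_def by (rule exI) (rule d)
  show "pd i (\<lambda>x. F (c + s * (x \<bullet> x))) x = of_real (2 * s * x $ i) * F'"
    using pd_eqI[OF d, of i] by (simp add: inner_axis scaleR_conv_of_real)
qed

lemma Ck_coord: "Ck n (\<lambda>x. of_real (x $ i))"
proof (cases n)
  case 0
  then show ?thesis by (auto intro!: continuous_intros)
next
  case (Suc m)
  have d: "((\<lambda>x. of_real (x $ i) :: complex) has_derivative (\<lambda>h. of_real (h $ i))) (at x)" for x :: "real^3"
    by (intro has_derivative_of_real bounded_linear_imp_has_derivative bounded_linear_vec_nth)
  have "pd j (\<lambda>x. of_real (x $ i)) = (\<lambda>x. of_real (axis j 1 $ i))" for j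
    using pd_eqI[OF d] by blast
  then show ?thesis using Suc d by (auto simp: differentiable_def)
qed

text \<open>Differentiating raises the index \<open>m\<close> and multiplies by a coordinate, so the induction runs over all \<open>m\<close>
  simultaneously.\<close>

lemma Ck_bump: "Ck n (\<lambda>x. of_real (flat_exp m (c + s * (x \<bullet> x))))"
proof (induction n arbitrary: m)
  case 0
  have "continuous_on UNIV (flat_exp m)"
    using DERIV_flat_exp DERIV_isCont continuous_at_imp_continuous_on by blast
  from continuous_on_compose2[OF this, of UNIV "\<lambda>x::real^3. c + s * (x \<bullet> x)"]
  have "continuous_on UNIV (\<lambda>x::real^3. flat_exp m (c + s * (x \<bullet> x)))"
    by (simp add: continuous_intros)
  then show ?case by (simp add: continuous_intros)
next
  case (Suc n)
  have "pd i (\<lambda>x. of_real (flat_exp m (c + s * (x \<bullet> x)))) =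
    (\<lambda>x. (of_real (flat_exp (m + 2) (c + s * (x \<bullet> x))) +
      of_real (- real m) * of_real (flat_exp (m + 1) (c + s * (x \<bullet> x)))) * (of_real (2 * s) * of_real (x $ i)))" for i
    by (intro ext, subst pd_radial[OF has_vector_derivative_of_real[OF DERIV_flat_exp]]) simp
  moreover have "(\<lambda>x. of_real (flat_exp m (c + s * (x \<bullet> x))) :: complex) differentiable (at x)" for x :: "real^3"
    by (rule differentiable_radial[OF has_vector_derivative_of_real[OF DERIV_flat_exp]])
  ultimately show ?case
    using Suc by (auto intro!: Ck_mult Ck_add Ck_coord simp del: of_real_mult of_real_add of_real_minus)
qed

section \<open>Convolution over a bounded open set\<close>

definition conv :: "(real^3) set \<Rightarrow> (real^3 \<Rightarrow> complex) \<Rightarrow> (real^3 \<Rightarrow> complex) \<Rightarrow> real^3 \<Rightarrow> complex" where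
  "conv D \<kappa> f x = (\<integral>y. \<kappa> (x - y) * f y \<partial>lebesgue_on D)"

locale bounded_open =
  fixes D :: "(real^3) set"
  assumes open_D: "open D" and bounded_D: "bounded D"
begin

abbreviation M :: "(real^3) measure" where "M \<equiv> lebesgue_on D"

text \<open>Any radius of a ball about the origin that contains \<open>D\<close> would do.\<close>

definition rad :: real where "rad = (SOME R. R > 0 \<and> D \<subseteq> ball 0 R)"

lemma rad: "rad > 0" "D \<subseteq> ball 0 rad"
proof -
  obtain R where "R > 0" "D \<subseteq> ball 0 R"
    using bounded_subset_ballD[OF bounded_D, of 0] by metis
  then have "rad > 0 \<and> D \<subseteq> ball 0 rad"
    unfolding rad_def by (rule someI[of "\<lambda>R. R > 0 \<and> D \<subseteq> ball 0 R" R, OF conjI])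
  then show "rad > 0" "D \<subseteq> ball 0 rad" by simp_all
qed

lemma norm_less_rad: "y \<in> D \<Longrightarrow> norm y < rad"
  using rad by auto

lemma lmeasurable_D: "D \<in> lmeasurable"
  using open_D bounded_D by (simp add: lmeasurable_open)

lemma sets_D: "D \<in> sets lebesgue" "D \<in> sets borel"
  using lmeasurable_D open_D by auto

sublocale finite_measure M
  by (rule finite_measure_lebesgue_on[OF lmeasurable_D])

lemma borel_measurable_M: "f \<in> borel_measurable borel \<Longrightarrow> f \<in> borel_measurable M"
  by (simp add: measurable_restrict_space1 measurable_completion)

lemma continuous_measurable_M:
  "continuous_on UNIV (f :: real^3 \<Rightarrow> 'b::topological_space) \<Longrightarrow> f \<in> borel_measurable M"
  by (simp add: borel_measurable_M borel_measurable_continuous_onI)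

lemma continuous_bounded_cball:
  fixes g :: "real^3 \<Rightarrow> complex"
  assumes "continuous_on UNIV g"
  obtains B where "B > 0" "\<And>z. norm z \<le> R \<Longrightarrow> norm (g z) \<le> B"
proof -
  have "compact (g ` cball 0 R)"
    using assms by (intro compact_continuous_image continuous_on_subset[OF assms]) auto
  then have "bounded (g ` cball 0 R)" by (rule compact_imp_bounded)
  then obtain B where "B > 0" "\<forall>y\<in>g ` cball 0 R. norm y \<le> B"
    unfolding bounded_pos by metis
  then show ?thesis by (intro that[of B]) auto
qed

lemma integrable_continuous_mult:
  fixes f g :: "real^3 \<Rightarrow> complex"
  assumes "continuous_on UNIV g" "integrable M f"
  shows "integrable M (\<lambda>y. g y * f y)"
proof -
  obtain B where B: "B > 0" "\<And>z. norm z \<le> rad \<Longrightarrow> norm (g z) \<le> B"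
    using continuous_bounded_cball[OF assms(1)] by blast
  have "integrable M (\<lambda>y. B * norm (f y))" using assms by simp
  then show ?thesis
  proof (rule Bochner_Integration.integrable_bound)
    show "(\<lambda>y. g y * f y) \<in> borel_measurable M"
      using assms continuous_measurable_M[OF assms(1)] by measurable
    show "AE y in M. norm (g y * f y) \<le> norm (B * norm (f y))"
      using B norm_less_rad
      by (intro AE_I2) (auto simp: norm_mult mult_right_mono less_imp_le)
  qed
qed

lemma integrable_continuous_M:
  "continuous_on UNIV (g :: real^3 \<Rightarrow> complex) \<Longrightarrow> integrable M g"
  using integrable_continuous_mult[of g "\<lambda>_. 1"] by simp

lemma continuous_reflect:
  "continuous_on UNIV (\<kappa> :: real^3 \<Rightarrow> complex) \<Longrightarrow> continuous_on UNIV (\<lambda>y. \<kappa> (x - y))"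
  using Ck_reflect[of 0 \<kappa> x] by simp

lemma integrable_conv:
  fixes \<kappa> f :: "real^3 \<Rightarrow> complex"
  shows "continuous_on UNIV \<kappa> \<Longrightarrow> integrable M f \<Longrightarrow> integrable M (\<lambda>y. \<kappa> (x - y) * f y)"
  by (intro integrable_continuous_mult continuous_reflect)

lemma continuous_kernel_modulus:
  fixes \<kappa> :: "real^3 \<Rightarrow> complex"
  assumes "continuous_on UNIV \<kappa>" "e > 0"
  obtains d where "d > 0"
    "\<And>x x' y. norm x \<le> R \<Longrightarrow> norm x' \<le> R \<Longrightarrow> y \<in> D \<Longrightarrow> norm (x - x') < d \<Longrightarrow>
      norm (\<kappa> (x - y) - \<kappa> (x' - y)) \<le> e"
proof -
  have "uniformly_continuous_on (cball 0 (R + rad)) \<kappa>"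
    by (intro compact_uniformly_continuous continuous_on_subset[OF assms(1)]) auto
  with assms(2) obtain d where d: "d > 0"
    "\<And>z z'. z \<in> cball 0 (R + rad) \<Longrightarrow> z' \<in> cball 0 (R + rad) \<Longrightarrow> dist z z' < d \<Longrightarrow> dist (\<kappa> z) (\<kappa> z') < e"
    unfolding uniformly_continuous_on_def by (metis dist_commute)
  have "norm (\<kappa> (x - y) - \<kappa> (x' - y)) \<le> e"
    if "norm x \<le> R" "norm x' \<le> R" "y \<in> D" "norm (x - x') < d" for x x' y
  proof -
    have "norm (x - y) \<le> R + rad" "norm (x' - y) \<le> R + rad"
      using norm_triangle_ineq4[of x y] norm_triangle_ineq4[of x' y] norm_less_rad[OF that(3)] that by linarith+
    then have "x - y \<in> cball 0 (R + rad)" "x' - y \<in> cball 0 (R + rad)" by auto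
    moreover have "dist (x - y) (x' - y) < d" using that by (simp add: dist_norm)
    ultimately have "dist (\<kappa> (x - y)) (\<kappa> (x' - y)) < e" using d(2) by blast
    then show ?thesis by (simp add: dist_norm)
  qed
  with d(1) that show ?thesis by blast
qed

lemma norm_integral_le_mult:
  fixes f g :: "real^3 \<Rightarrow> complex"
  assumes "integrable M f" "integrable M g" "\<And>y. y \<in> D \<Longrightarrow> norm (g y) \<le> e * norm (f y)"
  shows "norm (\<integral>y. g y \<partial>M) \<le> e * (\<integral>y. norm (f y) \<partial>M)"
proof -
  have "norm (\<integral>y. g y \<partial>M) \<le> (\<integral>y. e * norm (f y) \<partial>M)"
    using assms by (intro Bochner_Integration.integral_norm_bound_integral) auto
  then show ?thesis by simp
qed

lemma conv_modulus:
  assumes "continuous_on UNIV \<kappa>" "integrable M f"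
    "\<And>y. y \<in> D \<Longrightarrow> norm (\<kappa> (x - y) - \<kappa> (x' - y)) \<le> e"
  shows "norm (conv D \<kappa> f x - conv D \<kappa> f x') \<le> e * (\<integral>y. norm (f y) \<partial>M)"
proof -
  have i: "integrable M (\<lambda>y. \<kappa> (x - y) * f y)" for x
    using assms integrable_conv by blast
  have "conv D \<kappa> f x - conv D \<kappa> f x' = (\<integral>y. \<kappa> (x - y) * f y - \<kappa> (x' - y) * f y \<partial>M)"
    unfolding conv_def using i by simp
  also have "norm \<dots> \<le> e * (\<integral>y. norm (f y) \<partial>M)"
  proof (rule norm_integral_le_mult[OF assms(2)])
    show "norm (\<kappa> (x - y) * f y - \<kappa> (x' - y) * f y) \<le> e * norm (f y)" if "y \<in> D" for y
      using assms(3)[OF that] by (simp add: left_diff_distrib[symmetric] norm_mult mult_right_mono)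
  qed (use i in simp)
  finally show ?thesis .
qed

lemma continuous_conv:
  assumes "continuous_on UNIV \<kappa>" "integrable M f"
  shows "continuous_on UNIV (conv D \<kappa> f)"
  unfolding continuous_on_iff
proof (intro ballI allI impI)
  fix x :: "real^3" and e :: real assume "e > 0"
  define I where "I = (\<integral>y. norm (f y) \<partial>M)"
  have I: "I \<ge> 0" unfolding I_def by simp
  obtain d where d: "d > 0"
    "\<And>x1 x' y. norm x1 \<le> norm x + 1 \<Longrightarrow> norm x' \<le> norm x + 1 \<Longrightarrow> y \<in> D \<Longrightarrow> norm (x1 - x') < d \<Longrightarrow>
      norm (\<kappa> (x1 - y) - \<kappa> (x' - y)) \<le> e / (I + 1)"
    using continuous_kernel_modulus[OF assms(1), of "e / (I + 1)" "norm x + 1"] \<open>e > 0\<close> I by auto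
  show "\<exists>d>0. \<forall>x'\<in>UNIV. dist x' x < d \<longrightarrow> dist (conv D \<kappa> f x') (conv D \<kappa> f x) < e"
  proof (intro exI[of _ "min d 1"] conjI ballI impI)
    fix x' assume "dist x' x < min d 1"
    then have x': "norm (x' - x) < d" "norm (x' - x) < 1" by (auto simp: dist_norm)
    have "norm x' \<le> norm x + 1" using x'(2) norm_triangle_ineq2[of x' x] by linarith
    then have "norm (conv D \<kappa> f x' - conv D \<kappa> f x) \<le> e / (I + 1) * I"
      unfolding I_def[symmetric] using d(2) x'
      by (intro conv_modulus[OF assms, where e = "e / (I + 1)", unfolded I_def[symmetric]]) auto
    also have "\<dots> < e" using \<open>e > 0\<close> I by (simp add: field_simps)
    finally show "dist (conv D \<kappa> f x') (conv D \<kappa> f x) < e" by (simp add: dist_norm)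
  qed (use d in auto)
qed

text \<open>A continuously differentiable kernel may be differentiated under the integral: its first
  order Taylor remainder is small relative to the increment, uniformly in the integration variable.\<close>

lemma conv_has_derivative:
  assumes "Ck 1 \<kappa>" "integrable M f"
  shows "(conv D \<kappa> f has_derivative (\<lambda>h. \<Sum>i\<in>UNIV. of_real (h $ i) * conv D (pd i \<kappa>) f x)) (at x)"
  unfolding has_derivative_at_alt
proof (intro conjI allI impI)
  let ?L = "\<lambda>h. \<Sum>i\<in>UNIV. of_real (h $ i) * conv D (pd i \<kappa>) f x"
  have bl: "bounded_linear (\<lambda>h::real^3. of_real (h $ i) * c :: complex)" for i and c :: complex
    by (intro bounded_linear_intros bounded_linear_compose[OF bounded_linear_of_real bounded_linear_vec_nth]
        bounded_linear_compose[OF bounded_linear_mult_left])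
  show "bounded_linear ?L"
    by (intro bounded_linear_sum bl)
  fix e :: real assume "e > 0"
  define I where "I = (\<integral>y. norm (f y) \<partial>M)"
  have I: "I \<ge> 0" unfolding I_def by simp
  \<comment> \<open>The factor 3 pays for the three partial derivatives, \<open>I + 1\<close> for the integral of the density.\<close>
  define e' where "e' = e / (3 * (I + 1))"
  have e': "e' > 0" using \<open>e > 0\<close> I by (simp add: e'_def)
  have c: "continuous_on UNIV \<kappa>" "\<And>i. continuous_on UNIV (pd i \<kappa>)" and df: "\<And>z. \<kappa> differentiable (at z)"
    using assms(1) Ck_imp_continuous[OF assms(1)] by auto
  have "\<exists>d. d > 0 \<and> (\<forall>x1 x2 y. norm x1 \<le> norm x + 1 \<longrightarrow> norm x2 \<le> norm x + 1 \<longrightarrow> y \<in> D \<longrightarrow>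
     norm (x1 - x2) < d \<longrightarrow> norm (pd i \<kappa> (x1 - y) - pd i \<kappa> (x2 - y)) \<le> e')" for i
    using continuous_kernel_modulus[OF c(2)[of i] e', of "norm x + 1"] by metis
  then obtain d where d: "\<And>i. d i > 0" "\<And>i x1 x2 y. norm x1 \<le> norm x + 1 \<Longrightarrow> norm x2 \<le> norm x + 1 \<Longrightarrow> y \<in> D \<Longrightarrow>
     norm (x1 - x2) < d i \<Longrightarrow> norm (pd i \<kappa> (x1 - y) - pd i \<kappa> (x2 - y)) \<le> e'"
    by metis
  define d0 where "d0 = min 1 (Min (range d))"
  have d0: "d0 > 0" "d0 \<le> 1" "\<And>i. d0 \<le> d i"
    using d(1) by (auto simp: d0_def min_le_iff_disj)
  show "\<exists>d>0. \<forall>y. norm (y - x) < d \<longrightarrow>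
          norm (conv D \<kappa> f y - conv D \<kappa> f x - ?L (y - x)) \<le> e * norm (y - x)"
  proof (intro exI[of _ d0] conjI allI impI)
    fix x' assume x': "norm (x' - x) < d0"
    define h where "h = x' - x"
    have rem: "norm (\<kappa> (x' - y) - \<kappa> (x - y) - (\<Sum>i\<in>UNIV. of_real (h $ i) * pd i \<kappa> (x - y))) \<le> norm h * (3 * e')"
      if y: "y \<in> D" for y
    proof -
      have S: "\<kappa> differentiable (at z)" for z by (rule df)
      have "norm (\<kappa> (x' - y) - \<kappa> (x - y) - (\<Sum>i\<in>UNIV. of_real (((x' - y) - (x - y)) $ i) * pd i \<kappa> (x - y)))
        \<le> norm ((x' - y) - (x - y)) * (3 * e')"
      proof (rule differentiable_bound_linearization[where S = "ball (x - y) d0"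
            and f' = "\<lambda>z h. \<Sum>i\<in>UNIV. of_real (h $ i) * pd i \<kappa> z"])
        fix t :: real assume t: "t \<in> {0..1}"
        have "norm (t *\<^sub>R ((x' - y) - (x - y))) \<le> norm (x' - x)"
          using t by (simp add: mult_left_le_one_le)
        then show "x - y + t *\<^sub>R ((x' - y) - (x - y)) \<in> ball (x - y) d0"
          using x' by (simp add: dist_norm)
      next
        fix z assume "z \<in> ball (x - y) d0"
        show "(\<kappa> has_derivative (\<lambda>h. \<Sum>i\<in>UNIV. of_real (h $ i) * pd i \<kappa> z)) (at z within ball (x - y) d0)"
          by (rule has_derivative_at_withinI[OF has_derivative_pd[OF df]])
      next
        fix z assume z: "z \<in> ball (x - y) d0"
        have close: "norm (pd i \<kappa> z - pd i \<kappa> (x - y)) \<le> e'" for i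
        proof -
          have zn: "norm ((z + y) - x) < d0" using z by (simp add: dist_norm norm_minus_commute algebra_simps)
          have "norm (z + y) \<le> norm x + norm ((z + y) - x)"
            using norm_triangle_sub by blast
          then have "norm (z + y) \<le> norm x + 1" using zn d0 by linarith
          moreover have "norm ((z + y) - x) < d i" using zn d0(3)[of i] by linarith
          ultimately have "norm (pd i \<kappa> ((z + y) - y) - pd i \<kappa> (x - y)) \<le> e'"
            by (intro d(2)) (use y in auto)
          then show ?thesis by simp
        qed
        show "onorm ((\<lambda>h. \<Sum>i\<in>UNIV. of_real (h $ i) * pd i \<kappa> z) -
          (\<lambda>h. \<Sum>i\<in>UNIV. of_real (h $ i) * pd i \<kappa> (x - y))) \<le> 3 * e'"
        proof (rule onorm_le)
          fix v :: "real^3"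
          have "norm (((\<lambda>h. \<Sum>i\<in>UNIV. of_real (h $ i) * pd i \<kappa> z) -
            (\<lambda>h. \<Sum>i\<in>UNIV. of_real (h $ i) * pd i \<kappa> (x - y))) v)
            = norm (\<Sum>i\<in>UNIV. of_real (v $ i) * (pd i \<kappa> z - pd i \<kappa> (x - y)))"
            by (simp add: sum_subtractf right_diff_distrib)
          also have "\<dots> \<le> (\<Sum>i\<in>(UNIV::3 set). norm v * e')"
            using component_le_norm_cart[of v] close e'
            by (intro order_trans[OF norm_sum] sum_mono) (auto simp: norm_mult intro!: mult_mono)
          finally show "norm (((\<lambda>h. \<Sum>i\<in>UNIV. of_real (h $ i) * pd i \<kappa> z) -
            (\<lambda>h. \<Sum>i\<in>UNIV. of_real (h $ i) * pd i \<kappa> (x - y))) v) \<le> 3 * e' * norm v"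
            by (simp add: mult.commute mult.left_commute)
        qed
      qed (use d0 in simp)
      then show ?thesis by (simp add: h_def)
    qed
    have i: "integrable M (\<lambda>y. \<kappa> (z - y) * f y)" "integrable M (\<lambda>y. pd i \<kappa> (z - y) * f y)" for z i
      using integrable_conv c assms by auto
    have "conv D \<kappa> f x' - conv D \<kappa> f x - ?L h =
      (\<integral>y. \<kappa> (x' - y) * f y - \<kappa> (x - y) * f y - (\<Sum>i\<in>UNIV. of_real (h $ i) * (pd i \<kappa> (x - y) * f y)) \<partial>M)"
      unfolding conv_def using i by simp
    also have "\<dots> = (\<integral>y. (\<kappa> (x' - y) - \<kappa> (x - y) - (\<Sum>i\<in>UNIV. of_real (h $ i) * pd i \<kappa> (x - y))) * f y \<partial>M)"
      by (simp add: left_diff_distrib sum_distrib_right mult.assoc)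
    also have "norm \<dots> \<le> (norm h * (3 * e')) * I"
      unfolding I_def
    proof (rule norm_integral_le_mult[OF assms(2)])
      show "integrable M (\<lambda>y. (\<kappa> (x' - y) - \<kappa> (x - y) - (\<Sum>i\<in>UNIV. of_real (h $ i) * pd i \<kappa> (x - y))) * f y)"
        using assms(2) c by (intro integrable_continuous_mult continuous_intros continuous_reflect) auto
    qed (use rem in \<open>auto simp: norm_mult intro!: mult_right_mono\<close>)
    also have "\<dots> = norm h * e * (I / (I + 1))"
      using I by (simp add: e'_def field_simps)
    also have "\<dots> \<le> norm h * e * 1"
      using I \<open>e > 0\<close> by (intro mult_left_mono) auto
    finally show "norm (conv D \<kappa> f x' - conv D \<kappa> f x - ?L (x' - x)) \<le> e * norm (x' - x)"
      by (simp add: h_def mult.commute)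
  qed (use d0 in simp)
qed

lemma pd_conv:
  assumes "Ck 1 \<kappa>" "integrable M f"
  shows "pd i (conv D \<kappa> f) = conv D (pd i \<kappa>) f"
proof
  fix x
  have "pd i (conv D \<kappa> f) x = (\<Sum>j\<in>UNIV. of_real (axis i 1 $ j) * conv D (pd j \<kappa>) f x)"
    by (rule pd_eqI[OF conv_has_derivative[OF assms]])
  also have "\<dots> = (\<Sum>j\<in>UNIV. if j = i then conv D (pd i \<kappa>) f x else 0)"
    by (rule sum.cong) (auto simp: axis_def)
  finally show "pd i (conv D \<kappa> f) x = conv D (pd i \<kappa>) f x" by simp
qed

lemma Ck_conv: "Ck n \<kappa> \<Longrightarrow> integrable M f \<Longrightarrow> Ck n (conv D \<kappa> f)"
proof (induction n arbitrary: \<kappa>)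
  case 0
  then show ?case using continuous_conv by simp
next
  case (Suc n)
  have 1: "Ck 1 \<kappa>"
    using Suc.prems Ck_imp_continuous[of n "pd _ \<kappa>"] by auto
  have "conv D \<kappa> f differentiable (at x)" for x
    unfolding differentiable_def by (rule exI) (rule conv_has_derivative[OF 1 Suc.prems(2)])
  then show ?case
    using Suc pd_conv[OF 1 Suc.prems(2)] by auto
qed

end

section \<open>Integration by parts and mollification\<close>

lemma Ck_1_lipschitz:
  assumes "Ck 1 f" "\<And>i x. norm (pd i f x) \<le> B"
  shows "norm (f x - f y) \<le> 3 * B * norm (x - y)"
proof (rule differentiable_bound[of UNIV])
  fix x :: "real^3"
  have "f differentiable (at x)" using assms(1) by simp
  from has_derivative_pd[OF this]
  show "(f has_derivative (\<lambda>h. \<Sum>i\<in>UNIV. of_real (h $ i) * pd i f x)) (at x within UNIV)" by simp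
  show "onorm (\<lambda>h. \<Sum>i\<in>UNIV. of_real (h $ i) * pd i f x) \<le> 3 * B"
  proof (rule onorm_le)
    fix v :: "real^3"
    have "norm (\<Sum>i\<in>UNIV. of_real (v $ i) * pd i f x) \<le> (\<Sum>i\<in>(UNIV::3 set). norm v * B)"
      using component_le_norm_cart[of v] assms(2)
      by (intro order_trans[OF norm_sum] sum_mono) (auto simp: norm_mult intro!: mult_mono)
    then show "norm (\<Sum>i\<in>UNIV. of_real (v $ i) * pd i f x) \<le> 3 * B * norm v"
      by (simp add: mult.commute mult.left_commute)
  qed
qed auto

lemma difference_quotient_tendsto_pd:
  assumes "f differentiable (at x)"
  shows "(\<lambda>n. of_nat (Suc n) * (f (x + (1 / real (Suc n)) *\<^sub>R axis i 1) - f x)) \<longlonglongrightarrow> pd i f x"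
proof -
  let ?f' = "frechet_derivative f (at x)"
  let ?h = "\<lambda>n. (1 / real (Suc n)) *\<^sub>R axis i 1 :: real^3"
  have d: "(f has_derivative ?f') (at x)"
    using assms frechet_derivative_works by blast
  have "(\<lambda>n. 1 / real (Suc n)) \<longlonglongrightarrow> 0" by real_asymp
  from tendsto_scaleR[OF this tendsto_const[of "axis i 1 :: real^3"]]
  have "filterlim ?h (at 0) sequentially"
    by (simp add: filterlim_at axis_eq_0_iff)
  moreover have "((\<lambda>h. norm (f (x + h) - f x - ?f' h) / norm h) \<longlongrightarrow> 0) (at 0)"
    using d unfolding has_derivative_at by blast
  ultimately have "(\<lambda>n. norm (f (x + ?h n) - f x - ?f' (?h n)) / norm (?h n)) \<longlonglongrightarrow> 0"
    by (rule filterlim_compose[rotated])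
  moreover have "norm (f (x + ?h n) - f x - ?f' (?h n)) / norm (?h n) =
      norm (of_nat (Suc n) * (f (x + ?h n) - f x) - pd i f x)" for n
  proof -
    have "?f' (?h n) = (1 / real (Suc n)) *\<^sub>R pd i f x"
      using linear_cmul[OF has_derivative_linear[OF d]] unfolding pd_def by blast
    then have "of_nat (Suc n) * (f (x + ?h n) - f x) - pd i f x =
      real (Suc n) *\<^sub>R (f (x + ?h n) - f x - ?f' (?h n))"
      by (simp add: scaleR_diff_right scaleR_conv_of_real algebra_simps del: of_nat_Suc)
    then show ?thesis by (simp add: divide_inverse mult.commute del: of_nat_Suc)
  qed
  ultimately have "(\<lambda>n. norm (of_nat (Suc n) * (f (x + ?h n) - f x) - pd i f x)) \<longlonglongrightarrow> 0"
    by simp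
  then show ?thesis by (simp only: tendsto_norm_zero_iff LIM_zero_iff)
qed

lemma lborel_integral_translate:
  fixes f :: "'a::euclidean_space \<Rightarrow> 'b::{banach, second_countable_topology}"
  assumes "f \<in> borel_measurable borel"
  shows "(\<integral>x. f (x + c) \<partial>lborel) = (\<integral>x. f x \<partial>lborel)"
proof -
  have "(\<integral>x. f x \<partial>lborel) = (\<integral>x. f x \<partial>distr lborel borel ((+) c))"
    by (simp add: lborel_distr_plus)
  also have "\<dots> = (\<integral>x. f (c + x) \<partial>lborel)"
    using assms by (subst integral_distr) auto
  finally show ?thesis by (simp add: add.commute)
qed

lemma lborel_distr_reflect: "distr lborel borel (\<lambda>y. x - y) = (lborel :: 'a::euclidean_space measure)"
  using lborel_affine[of "-1" x] by (simp add: density_1)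

lemma lborel_integral_reflect:
  fixes f :: "'a::euclidean_space \<Rightarrow> 'b::{banach, second_countable_topology}"
  assumes "f \<in> borel_measurable borel"
  shows "(\<integral>y. f (x - y) \<partial>lborel) = (\<integral>x. f x \<partial>lborel)"
proof -
  have "(\<integral>x. f x \<partial>lborel) = (\<integral>x. f x \<partial>distr lborel borel (\<lambda>y. x - y))"
    by (simp add: lborel_distr_reflect)
  also have "\<dots> = (\<integral>y. f (x - y) \<partial>lborel)"
    using assms by (subst integral_distr) auto
  finally show ?thesis by simp
qed

lemma integrable_lborel_compact_support:
  fixes f :: "real^3 \<Rightarrow> complex"
  assumes "continuous_on UNIV f" "\<And>x. x \<notin> cball 0 R \<Longrightarrow> f x = 0"
  shows "integrable lborel f"
proof -
  have "integrable lborel (\<lambda>x. indicator (cball 0 R) x *\<^sub>R f x)"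
    by (intro borel_integrable_compact continuous_on_subset[OF assms(1)]) auto
  moreover have "(\<lambda>x. indicator (cball 0 R) x *\<^sub>R f x) = f"
    using assms(2) by (auto simp: fun_eq_iff indicator_def)
  ultimately show ?thesis by simp
qed

text \<open>The integral of a partial derivative is the limit of the integrals of difference quotients,
  which vanish because Lebesgue measure is translation invariant.\<close>

lemma integral_pd_eq_0:
  assumes "Ck 1 f" and supp: "closure {x. f x \<noteq> 0} \<subseteq> cball 0 R"
  shows "(\<integral>x. pd i f x \<partial>lborel) = 0"
proof -
  have c: "continuous_on UNIV f" "\<And>i. continuous_on UNIV (pd i f)"
    using assms(1) Ck_imp_continuous[OF assms(1)] by auto
  have f0: "f x = 0" if "x \<notin> cball 0 R" for x
    using supp closure_subset[of "{x. f x \<noteq> 0}"] that by blast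
  have pd0: "pd i f x = 0" if "x \<notin> cball 0 R" for x i
    using supp that by (intro pd_eq_0_outside_support) blast
  have "\<exists>B. B > 0 \<and> (\<forall>x\<in>cball 0 R. norm (pd i f x) \<le> B)" for i
  proof -
    have "compact (pd i f ` cball 0 R)"
      by (intro compact_continuous_image continuous_on_subset[OF c(2)]) auto
    from compact_imp_bounded[OF this] show ?thesis by (auto simp: bounded_pos)
  qed
  then obtain B0 where B0: "\<And>i. B0 i > 0" "\<And>i x. x \<in> cball 0 R \<Longrightarrow> norm (pd i f x) \<le> B0 i" by metis
  define B where "B = Max (range B0)"
  have B: "norm (pd i f x) \<le> B" for i x
  proof -
    have "norm (pd i f x) \<le> B0 i" using B0 pd0 by (cases "x \<in> cball 0 R") (auto simp: less_imp_le)
    also have "\<dots> \<le> B" by (simp add: B_def)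
    finally show ?thesis .
  qed
  have "B \<ge> 0" using order_trans[OF norm_ge_zero B] .
  let ?h = "\<lambda>n. (1 / real (Suc n)) *\<^sub>R axis i 1 :: real^3"
  let ?q = "\<lambda>n x. of_nat (Suc n) * (f (x + ?h n) - f x)"
  have mf: "f \<in> borel_measurable borel"
    using c(1) by (rule borel_measurable_continuous_onI)
  have fi: "integrable lborel f"
    using integrable_lborel_compact_support[OF c(1) f0] .
  have hn: "norm (?h n) \<le> 1" for n by (simp add: divide_simps)
  have fi': "integrable lborel (\<lambda>x. f (x + ?h n))" for n
  proof (rule integrable_lborel_compact_support)
    show "continuous_on UNIV (\<lambda>x. f (x + ?h n))"
      by (rule continuous_on_compose2[OF c(1)]) (auto intro!: continuous_intros)
    fix x :: "real^3" assume "x \<notin> cball 0 (R + 1)"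
    then have "norm (x + ?h n) > R"
      using hn[of n] norm_diff_ineq[of x "?h n"] by (auto simp del: norm_scaleR)
    then show "f (x + ?h n) = 0" by (intro f0) auto
  qed
  have z: "(\<integral>x. ?q n x \<partial>lborel) = 0" for n
    using fi fi' lborel_integral_translate[OF mf, of "?h n"] by simp
  have "(\<lambda>n. \<integral>x. ?q n x \<partial>lborel) \<longlonglongrightarrow> (\<integral>x. pd i f x \<partial>lborel)"
  proof (rule integral_dominated_convergence[where w = "\<lambda>x. indicator (cball 0 (R + 1)) x *\<^sub>R (3 * B)"])
    show "pd i f \<in> borel_measurable lborel"
      using c(2) by (simp add: borel_measurable_continuous_onI)
    show "?q n \<in> borel_measurable lborel" for n
      using fi fi' by measurable
    show "integrable lborel (\<lambda>x. indicator (cball 0 (R + 1)) x *\<^sub>R (3 * B))"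
      by (intro borel_integrable_compact) auto
    show "AE x in lborel. (\<lambda>n. ?q n x) \<longlonglongrightarrow> pd i f x"
      using assms(1) by (intro AE_I2 difference_quotient_tendsto_pd) simp
    show "AE x in lborel. norm (?q n x) \<le> indicator (cball 0 (R + 1)) x *\<^sub>R (3 * B)" for n
    proof (rule AE_I2)
      fix x :: "real^3"
      show "norm (?q n x) \<le> indicator (cball 0 (R + 1)) x *\<^sub>R (3 * B)"
      proof (cases "x \<in> cball 0 (R + 1)")
        case True
        have "norm (f (x + ?h n) - f x) \<le> 3 * B * norm ((x + ?h n) - x)"
          by (rule Ck_1_lipschitz[OF assms(1) B])
        also have "\<dots> = 3 * B / real (Suc n)" by simp
        finally have "real (Suc n) * norm (f (x + ?h n) - f x) \<le> 3 * B"
          by (simp add: field_simps)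
        then show ?thesis using True by (simp add: norm_mult del: of_nat_Suc)
      next
        case False
        then have "norm (x + ?h n) > R" "norm x > R"
          using hn[of n] norm_diff_ineq[of x "?h n"] by (auto simp del: norm_scaleR)
        then have "f (x + ?h n) = 0" "f x = 0" by (auto intro: f0)
        then show ?thesis using False by simp
      qed
    qed
  qed
  then show ?thesis unfolding z using LIMSEQ_unique tendsto_const by blast
qed

context bounded_open
begin

text \<open>Compactness of the support is automatic, because the closure of the bounded set \<open>D\<close> is compact.\<close>

definition csupp :: "(real^3 \<Rightarrow> complex) \<Rightarrow> bool" where
  "csupp \<phi> \<longleftrightarrow> closure {x. \<phi> x \<noteq> 0} \<subseteq> D"

lemma csupp_compact: "csupp \<phi> \<Longrightarrow> compact (closure {x. \<phi> x \<noteq> 0})"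
  unfolding csupp_def using bounded_D bounded_subset compact_eq_bounded_closed closed_closure by blast

lemma csupp_cball: "csupp \<phi> \<Longrightarrow> closure {x. \<phi> x \<noteq> 0} \<subseteq> cball 0 rad"
  unfolding csupp_def using rad(2) ball_subset_cball by blast

lemma csupp_zero: "csupp \<phi> \<Longrightarrow> x \<notin> D \<Longrightarrow> \<phi> x = 0"
  unfolding csupp_def using closure_subset[of "{x. \<phi> x \<noteq> 0}"] by blast

lemma csuppI:
  assumes "closed K" "K \<subseteq> D" "\<And>x. x \<notin> K \<Longrightarrow> \<phi> x = 0"
  shows "csupp \<phi>"
proof -
  have "{x. \<phi> x \<noteq> 0} \<subseteq> K" using assms(3) by blast
  then have "closure {x. \<phi> x \<noteq> 0} \<subseteq> K" using assms(1) by (rule closure_minimal)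
  then show ?thesis using assms(2) by (simp add: csupp_def)
qed

lemma csupp_mono:
  assumes "csupp \<phi>" "\<And>x. \<phi> x = 0 \<Longrightarrow> \<psi> x = 0"
  shows "csupp \<psi>"
proof (rule csuppI)
  show "closed (closure {x. \<phi> x \<noteq> 0})" by (rule closed_closure)
  show "closure {x. \<phi> x \<noteq> 0} \<subseteq> D" using assms(1) by (simp add: csupp_def)
  show "\<psi> x = 0" if "x \<notin> closure {x. \<phi> x \<noteq> 0}" for x
    using that closure_subset[of "{x. \<phi> x \<noteq> 0}"] assms(2) by blast
qed

lemma csupp_pd: "csupp \<phi> \<Longrightarrow> csupp (pd i \<phi>)"
  by (rule csuppI[of "closure {x. \<phi> x \<noteq> 0}"]) (auto simp: csupp_def pd_eq_0_outside_support)

lemma test_function_iff: "test_function D \<phi> \<longleftrightarrow> (\<forall>n. Ck n \<phi>) \<and> csupp \<phi>"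
  using csupp_compact by (auto simp: test_function_def csupp_def)

lemma integral_M_eq_lborel:
  fixes f :: "real^3 \<Rightarrow> complex"
  assumes "f \<in> borel_measurable borel" "\<And>x. x \<notin> D \<Longrightarrow> f x = 0"
  shows "(\<integral>x. f x \<partial>M) = (\<integral>x. f x \<partial>lborel)"
proof -
  have "(\<integral>x. f x \<partial>M) = (\<integral>x. indicator D x *\<^sub>R f x \<partial>lebesgue)"
    using sets_D by (intro integral_restrict_space) auto
  also have "(\<lambda>x. indicator D x *\<^sub>R f x) = f"
    using assms(2) by (auto simp: fun_eq_iff indicator_def)
  also have "(\<integral>x. f x \<partial>lebesgue) = (\<integral>x. f x \<partial>lborel)"
    using assms(1) by (intro integral_completion) auto
  finally show ?thesis .
qed

lemma integral_pd_M_eq_0: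
  assumes "Ck 1 f" "csupp f"
  shows "(\<integral>x. pd i f x \<partial>M) = 0"
proof -
  have "(\<integral>x. pd i f x \<partial>M) = (\<integral>x. pd i f x \<partial>lborel)"
    using assms csupp_zero[OF csupp_pd[OF assms(2)]]
    by (intro integral_M_eq_lborel borel_measurable_continuous_onI) auto
  then show ?thesis
    using integral_pd_eq_0[OF assms(1) csupp_cball[OF assms(2)]] by simp
qed

lemma integration_by_parts:
  assumes "Ck 1 u" "Ck 1 \<phi>" "csupp \<phi>"
  shows "(\<integral>x. u x * pd i \<phi> x \<partial>M) = - (\<integral>x. pd i u x * \<phi> x \<partial>M)"
proof -
  have c: "continuous_on UNIV u" "continuous_on UNIV \<phi>" "continuous_on UNIV (pd i u)" "continuous_on UNIV (pd i \<phi>)"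
    using assms Ck_imp_continuous[OF assms(1)] Ck_imp_continuous[OF assms(2)] by auto
  have "csupp (\<lambda>x. u x * \<phi> x)"
    using assms(3) by (rule csupp_mono) simp
  then have "(\<integral>x. pd i (\<lambda>x. u x * \<phi> x) x \<partial>M) = 0"
    using assms by (intro integral_pd_M_eq_0 Ck_mult) auto
  moreover have "pd i (\<lambda>x. u x * \<phi> x) x = u x * pd i \<phi> x + pd i u x * \<phi> x" for x
    using assms by (intro pd_mult) auto
  moreover have "integrable M (\<lambda>x. u x * pd i \<phi> x)" "integrable M (\<lambda>x. pd i u x * \<phi> x)"
    using c by (auto intro!: integrable_continuous_M continuous_intros)
  ultimately show ?thesis by (simp add: eq_neg_iff_add_eq_0)
qed

definition bump :: "real \<Rightarrow> real^3 \<Rightarrow> complex" where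
  "bump d z = of_real (flat_exp 0 (d\<^sup>2 + (- 1) * (z \<bullet> z)))"

lemma Ck_bump_d: "Ck n (bump d)"
  unfolding bump_def[abs_def] by (rule Ck_bump)

lemma bump_zero: "0 < d \<Longrightarrow> d \<le> norm z \<Longrightarrow> bump d z = 0"
  using power_mono[OF _ less_imp_le, of d "norm z" 2]
  by (simp add: bump_def flat_exp_def dot_square_norm not_less)

lemma norm_bump: "bump d z = of_real (norm (bump d z))"
  by (simp add: bump_def flat_exp_def)

definition bump_mass :: "real \<Rightarrow> real" where
  "bump_mass d = (\<integral>z. norm (bump d z) \<partial>lborel)"

lemma integrable_bump: "0 < d \<Longrightarrow> integrable lborel (bump d)"
  by (rule integrable_lborel_compact_support[of _ d])
    (auto intro: Ck_imp_continuous[OF Ck_bump_d] bump_zero)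

lemma bump_mass_pos:
  assumes "0 < d"
  shows "bump_mass d > 0"
proof -
  have "bump_mass d \<noteq> 0"
  proof
    assume "bump_mass d = 0"
    then have "AE z in lborel. norm (bump d z) = 0"
      unfolding bump_mass_def
      using integral_nonneg_eq_0_iff_AE[of lborel "\<lambda>z. norm (bump d z)"] integrable_bump[OF assms] by simp
    moreover have "bump d z \<noteq> 0" if "z \<in> ball 0 d" for z
      using that power_strict_mono[of "norm z" d 2] by (simp add: bump_def flat_exp_def dot_square_norm)
    ultimately have "AE z in lborel. z \<notin> ball (0::real^3) d"
      by (auto elim!: eventually_mono)
    then have "ball (0::real^3) d \<in> null_sets lborel"
      by (subst (asm) AE_iff_null_sets[symmetric]) auto
    then have "negligible (ball (0::real^3) d)"
      using negligible_iff_null_sets null_sets_completionI by blast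
    then show False
      using open_not_negligible[of "ball (0::real^3) d"] assms by simp
  qed
  moreover have "bump_mass d \<ge> 0" by (simp add: bump_mass_def)
  ultimately show ?thesis by simp
qed

lemma integral_bump: "(\<integral>y. bump d (x - y) \<partial>lborel) = of_real (bump_mass d)"
proof -
  have "(\<integral>y. bump d (x - y) \<partial>lborel) = (\<integral>y. bump d y \<partial>lborel)"
    by (intro lborel_integral_reflect borel_measurable_continuous_onI Ck_imp_continuous[OF Ck_bump_d])
  also have "\<dots> = (\<integral>y. of_real (norm (bump d y)) \<partial>lborel)"
    by (subst norm_bump) simp
  finally show ?thesis by (simp add: bump_mass_def)
qed

definition moll :: "real \<Rightarrow> (real^3 \<Rightarrow> complex) \<Rightarrow> real^3 \<Rightarrow> complex" where
  "moll d \<phi> x = of_real (1 / bump_mass d) * conv D (bump d) \<phi> x"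

lemma Ck_moll: "integrable M \<phi> \<Longrightarrow> Ck n (moll d \<phi>)"
  unfolding moll_def[abs_def] by (intro Ck_mult Ck_const Ck_conv Ck_bump_d)

text \<open>Integration by parts moves the derivative from the bump function to \<open>\<phi>\<close>, so that mollification approximates
  the derivatives of \<open>\<phi>\<close> as well.\<close>

lemma pd_moll:
  assumes "Ck 1 \<phi>" "csupp \<phi>"
  shows "pd i (moll d \<phi>) = moll d (pd i \<phi>)"
proof
  fix x
  have i: "integrable M \<phi>"
    using Ck_imp_continuous[OF assms(1)] by (rule integrable_continuous_M)
  have "(conv D (bump d) \<phi>) differentiable (at x)"
    using Ck_conv[OF Ck_bump_d[of 1] i] by simp
  then have "pd i (moll d \<phi>) x = of_real (1 / bump_mass d) * pd i (conv D (bump d) \<phi>) x"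
    unfolding moll_def[abs_def] by (subst pd_mult) auto
  also have "pd i (conv D (bump d) \<phi>) x = (\<integral>y. pd i (bump d) (x - y) * \<phi> y \<partial>M)"
    by (simp only: pd_conv[OF Ck_bump_d i] conv_def)
  also have "\<dots> = - (\<integral>y. pd i (\<lambda>y. bump d (x - y)) y * \<phi> y \<partial>M)"
    using Ck_bump_d[of 1 d] by (simp add: pd_reflect)
  also have "\<dots> = (\<integral>y. bump d (x - y) * pd i \<phi> y \<partial>M)"
    by (subst integration_by_parts[OF _ assms]) (auto intro: Ck_reflect Ck_bump_d simp del: One_nat_def)
  finally have "pd i (moll d \<phi>) x = of_real (1 / bump_mass d) * conv D (bump d) (pd i \<phi>) x"
    by (simp only: conv_def)
  then show "pd i (moll d \<phi>) x = moll d (pd i \<phi>) x"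
    by (simp only: moll_def[of d "pd i \<phi>"])
qed

lemma moll_close:
  assumes "continuous_on UNIV \<phi>" "csupp \<phi>" "e > 0"
  obtains d0 where "d0 > 0" "\<And>d x. 0 < d \<Longrightarrow> d < d0 \<Longrightarrow> x \<in> D \<Longrightarrow> norm (moll d \<phi> x - \<phi> x) \<le> e"
proof -
  have "uniformly_continuous_on (cball 0 (rad + 1)) \<phi>"
    by (intro compact_uniformly_continuous continuous_on_subset[OF assms(1)]) auto
  with \<open>e > 0\<close> obtain d1 where d1: "d1 > 0"
    "\<And>x x'. x \<in> cball 0 (rad + 1) \<Longrightarrow> x' \<in> cball 0 (rad + 1) \<Longrightarrow> dist x' x < d1 \<Longrightarrow> dist (\<phi> x') (\<phi> x) < e"
    unfolding uniformly_continuous_on_def by metis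
  have "norm (moll d \<phi> x - \<phi> x) \<le> e" if d: "0 < d" "d < min 1 d1" and x: "x \<in> D" for d x
  proof -
    let ?b = "\<lambda>y. bump d (x - y)"
    have cb: "continuous_on UNIV ?b"
      by (intro continuous_reflect Ck_imp_continuous[OF Ck_bump_d])
    have b0: "?b y = 0" if "y \<notin> cball x d" for y
      using that d by (intro bump_zero) (auto simp: dist_norm)
    have b0': "?b y = 0" if "y \<notin> cball 0 (norm x + d)" for y
    proof (rule b0, rule notI)
      assume "y \<in> cball x d"
      then show False using that norm_triangle_ineq2[of y x] by (auto simp: dist_norm norm_minus_commute)
    qed
    have ib: "integrable lborel ?b"
      using integrable_lborel_compact_support[OF cb b0'] .
    have "conv D (bump d) \<phi> x = (\<integral>y. ?b y * \<phi> y \<partial>lborel)"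
      unfolding conv_def using cb assms(1) csupp_zero[OF assms(2)]
      by (intro integral_M_eq_lborel borel_measurable_continuous_onI continuous_intros) auto
    moreover have "of_real (bump_mass d) * \<phi> x = (\<integral>y. ?b y * \<phi> x \<partial>lborel)"
      using integral_bump[of d x] by simp
    moreover have ip: "integrable lborel (\<lambda>y. ?b y * \<phi> y)"
      by (rule integrable_lborel_compact_support[of _ "norm x + d"])
        (use cb assms(1) b0' in \<open>auto intro!: continuous_intros\<close>)
    ultimately have "conv D (bump d) \<phi> x - of_real (bump_mass d) * \<phi> x = (\<integral>y. ?b y * (\<phi> y - \<phi> x) \<partial>lborel)"
      using ib by (simp add: right_diff_distrib)
    also have "norm \<dots> \<le> (\<integral>y. e * norm (?b y) \<partial>lborel)"
    proof (rule Bochner_Integration.integral_norm_bound_integral)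
      show "integrable lborel (\<lambda>y. ?b y * (\<phi> y - \<phi> x))"
        using ip ib by (simp add: right_diff_distrib)
      show "integrable lborel (\<lambda>y. e * norm (?b y))" using ib by simp
      fix y
      show "norm (?b y * (\<phi> y - \<phi> x)) \<le> e * norm (?b y)"
      proof (cases "y \<in> cball x d")
        case True
        have "norm y \<le> rad + 1" "norm x \<le> rad + 1"
          using True d norm_less_rad[OF x] norm_triangle_ineq2[of y x] by (auto simp: dist_norm norm_minus_commute)
        then have "dist (\<phi> y) (\<phi> x) < e"
          using True d by (intro d1(2)) (auto simp: dist_commute)
        then show ?thesis by (simp add: norm_mult dist_norm mult.commute mult_right_mono)
      qed (simp add: b0)
    qed
    also have "\<dots> = e * bump_mass d"
    proof -
      have "(\<integral>y. norm (?b y) \<partial>lborel) = (\<integral>y. norm (bump d y) \<partial>lborel)"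
        by (rule lborel_integral_reflect)
          (intro borel_measurable_continuous_onI continuous_intros Ck_imp_continuous[OF Ck_bump_d])
      then show ?thesis by (simp add: bump_mass_def)
    qed
    finally have le: "norm (conv D (bump d) \<phi> x - of_real (bump_mass d) * \<phi> x) \<le> e * bump_mass d" .
    have pos: "bump_mass d > 0" using bump_mass_pos d by simp
    have "moll d \<phi> x - \<phi> x = of_real (1 / bump_mass d) * (conv D (bump d) \<phi> x - of_real (bump_mass d) * \<phi> x)"
      using pos by (simp add: moll_def field_simps)
    then have "norm (moll d \<phi> x - \<phi> x) = norm (conv D (bump d) \<phi> x - of_real (bump_mass d) * \<phi> x) / bump_mass d"
      using pos by (simp add: norm_mult norm_divide)
    also have "\<dots> \<le> e * bump_mass d / bump_mass d"
      using le pos by (intro divide_right_mono) auto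
    finally show ?thesis using pos by simp
  qed
  then show ?thesis using d1(1) by (intro that[of "min 1 d1"]) auto
qed

lemma csupp_moll:
  assumes "csupp \<phi>"
  obtains d0 where "d0 > 0" "\<And>d. 0 < d \<Longrightarrow> d < d0 \<Longrightarrow> csupp (moll d \<phi>)"
proof -
  let ?K = "closure {x. \<phi> x \<noteq> 0}"
  have K: "compact ?K" "?K \<subseteq> D" using assms csupp_compact by (auto simp: csupp_def)
  obtain d0 where d0: "d0 > 0" "(\<Union>x\<in>?K. cball x d0) \<subseteq> D"
    using compact_subset_open_imp_cball_epsilon_subset[OF K(1) open_D K(2)] by blast
  have "csupp (moll d \<phi>)" if d: "0 < d" "d < d0" for d
  proof (rule csuppI)
    show "closed {x + y | x y. x \<in> ?K \<and> y \<in> cball 0 d}"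
      by (intro compact_imp_closed compact_sums K compact_cball)
    show "{x + y | x y. x \<in> ?K \<and> y \<in> cball 0 d} \<subseteq> D"
    proof
      fix z assume "z \<in> {x + y | x y. x \<in> ?K \<and> y \<in> cball 0 d}"
      then obtain x y where "z = x + y" "x \<in> ?K" "norm y \<le> d" by auto
      then have "z \<in> cball x d0" using d by (simp add: dist_norm)
      then show "z \<in> D" using d0 \<open>x \<in> ?K\<close> by blast
    qed
    fix z assume z: "z \<notin> {x + y | x y. x \<in> ?K \<and> y \<in> cball 0 d}"
    have "bump d (z - y) * \<phi> y = 0" for y
    proof (cases "\<phi> y = 0")
      case False
      then have y: "y \<in> ?K" using closure_subset[of "{x. \<phi> x \<noteq> 0}"] by (simp add: subset_iff)
      have "z - y \<notin> cball 0 d"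
      proof
        assume zy: "z - y \<in> cball 0 d"
        have "z = y + (z - y)" by simp
        with y zy have "z \<in> {x + y | x y. x \<in> ?K \<and> y \<in> cball 0 d}"
          by (intro CollectI exI conjI)
        with z show False by contradiction
      qed
      then show ?thesis using d by (simp add: bump_zero)
    qed simp
    then have "(\<lambda>y. bump d (z - y) * \<phi> y) = (\<lambda>y. 0)" by (rule ext)
    then show "moll d \<phi> z = 0" by (simp add: moll_def conv_def)
  qed
  with d0(1) that show ?thesis by blast
qed

lemma test_function_approx:
  assumes "continuous_on UNIV \<phi>" "csupp \<phi>" "e > 0"
  shows "\<exists>\<psi>. test_function D \<psi> \<and> (\<forall>x\<in>D. norm (\<psi> x - \<phi> x) \<le> e)"
proof -
  obtain d0 where d0: "d0 > 0" "\<And>d x. 0 < d \<Longrightarrow> d < d0 \<Longrightarrow> x \<in> D \<Longrightarrow> norm (moll d \<phi> x - \<phi> x) \<le> e"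
    using moll_close[OF assms] by metis
  obtain d1 where d1: "d1 > 0" "\<And>d. 0 < d \<Longrightarrow> d < d1 \<Longrightarrow> csupp (moll d \<phi>)"
    using csupp_moll[OF assms(2)] by metis
  define d where "d = min d0 d1 / 2"
  have "0 < d" "d < d0" "d < d1" using d0 d1 by (auto simp: d_def min_def)
  then have "test_function D (moll d \<phi>) \<and> (\<forall>x\<in>D. norm (moll d \<phi> x - \<phi> x) \<le> e)"
    using d0 d1 assms by (auto simp: test_function_iff intro!: Ck_moll integrable_continuous_M)
  then show ?thesis by blast
qed

lemma test_function_approx_C1:
  assumes "Ck 1 \<phi>" "csupp \<phi>" "e > 0"
  shows "\<exists>\<psi>. test_function D \<psi> \<and> (\<forall>x\<in>D. norm (\<psi> x - \<phi> x) \<le> e \<and> norm (pd i \<psi> x - pd i \<phi> x) \<le> e)"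
proof -
  have c: "continuous_on UNIV \<phi>" "continuous_on UNIV (pd i \<phi>)"
    using assms(1) Ck_imp_continuous[OF assms(1)] by auto
  obtain d0 where d0: "d0 > 0" "\<And>d x. 0 < d \<Longrightarrow> d < d0 \<Longrightarrow> x \<in> D \<Longrightarrow> norm (moll d \<phi> x - \<phi> x) \<le> e"
    using moll_close[OF c(1) assms(2,3)] by metis
  obtain d1 where d1: "d1 > 0" "\<And>d. 0 < d \<Longrightarrow> d < d1 \<Longrightarrow> csupp (moll d \<phi>)"
    using csupp_moll[OF assms(2)] by metis
  obtain d2 where d2: "d2 > 0" "\<And>d x. 0 < d \<Longrightarrow> d < d2 \<Longrightarrow> x \<in> D \<Longrightarrow> norm (moll d (pd i \<phi>) x - pd i \<phi> x) \<le> e"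
    using moll_close[OF c(2) csupp_pd[OF assms(2)] assms(3)] by metis
  define d where "d = min d0 (min d1 d2) / 2"
  have d: "0 < d" "d < d0" "d < d1" "d < d2" using d0 d1 d2 by (auto simp: d_def min_def)
  have "test_function D (moll d \<phi>)"
    using d1(2)[OF d(1,3)] c(1) by (simp add: test_function_iff Ck_moll integrable_continuous_M)
  moreover have "\<forall>x\<in>D. norm (moll d \<phi> x - \<phi> x) \<le> e \<and> norm (pd i (moll d \<phi>) x - pd i \<phi> x) \<le> e"
    using d0(2)[OF d(1,2)] d2(2)[OF d(1,4)] by (simp add: pd_moll[OF assms(1,2)])
  ultimately show ?thesis by blast
qed

end

section \<open>Square integrable functions\<close>

lemma integrable_mult_of_squares:
  fixes f g :: "'a \<Rightarrow> 'b::{banach, second_countable_topology, real_normed_algebra}"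
  assumes [measurable]: "f \<in> borel_measurable N" "g \<in> borel_measurable N"
    and "integrable N (\<lambda>x. (norm (f x))\<^sup>2)" "integrable N (\<lambda>x. (norm (g x))\<^sup>2)"
  shows "integrable N (\<lambda>x. f x * g x)" "integrable N (\<lambda>x. norm (f x) * norm (g x))"
proof -
  have i: "integrable N (\<lambda>x. (norm (f x))\<^sup>2 + (norm (g x))\<^sup>2)"
    using assms by simp
  have le: "norm (f x) * norm (g x) \<le> (norm (f x))\<^sup>2 + (norm (g x))\<^sup>2" for x
    using sum_squares_bound[of "norm (f x)" "norm (g x)"]
      mult_nonneg_nonneg[OF norm_ge_zero norm_ge_zero, of "f x" "g x"] by linarith
  show "integrable N (\<lambda>x. f x * g x)"
    by (rule Bochner_Integration.integrable_bound[OF i]) (auto intro!: order_trans[OF norm_mult_ineq] order_trans[OF le])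
  show "integrable N (\<lambda>x. norm (f x) * norm (g x))"
    by (rule Bochner_Integration.integrable_bound[OF i]) (auto intro!: order_trans[OF le])
qed

lemma Cauchy_Schwarz_integral:
  fixes f g :: "'a \<Rightarrow> 'b::{banach, second_countable_topology, real_normed_algebra}"
  assumes [measurable]: "f \<in> borel_measurable N" "g \<in> borel_measurable N"
    and sq: "integrable N (\<lambda>x. (norm (f x))\<^sup>2)" "integrable N (\<lambda>x. (norm (g x))\<^sup>2)"
  shows "(\<integral>x. norm (f x) * norm (g x) \<partial>N)\<^sup>2 \<le> (\<integral>x. (norm (f x))\<^sup>2 \<partial>N) * (\<integral>x. (norm (g x))\<^sup>2 \<partial>N)"
proof -
  have "(\<integral>\<^sup>+x. ennreal (norm (f x)) * ennreal (norm (g x)) \<partial>N)\<^sup>2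
      \<le> (\<integral>\<^sup>+x. (ennreal (norm (f x)))\<^sup>2 \<partial>N) * (\<integral>\<^sup>+x. (ennreal (norm (g x)))\<^sup>2 \<partial>N)"
    by (rule Cauchy_Schwarz_nn_integral) auto
  then have "(\<integral>\<^sup>+x. ennreal (norm (f x) * norm (g x)) \<partial>N)\<^sup>2
      \<le> (\<integral>\<^sup>+x. ennreal ((norm (f x))\<^sup>2) \<partial>N) * (\<integral>\<^sup>+x. ennreal ((norm (g x))\<^sup>2) \<partial>N)"
    by (simp add: ennreal_mult ennreal_power)
  then have "ennreal ((\<integral>x. norm (f x) * norm (g x) \<partial>N)\<^sup>2) \<le>
      ennreal ((\<integral>x. (norm (f x))\<^sup>2 \<partial>N) * (\<integral>x. (norm (g x))\<^sup>2 \<partial>N))"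
    using integrable_mult_of_squares(2)[OF assms] sq
    by (subst (asm) (1 2 3) nn_integral_eq_integral) (auto simp: ennreal_power ennreal_mult)
  then show ?thesis
    by (subst (asm) ennreal_le_iff) (auto intro!: mult_nonneg_nonneg)
qed

context bounded_open
begin

lemma L2_measurable: "u \<in> L2 D \<Longrightarrow> u \<in> borel_measurable M"
  by (simp add: L2_def)

lemma L2_mult_integrable: "u \<in> L2 D \<Longrightarrow> v \<in> L2 D \<Longrightarrow> integrable M (\<lambda>x. u x * v x)"
  by (rule integrable_mult_of_squares(1)) (auto simp: L2_def)

lemma bounded_L2:
  assumes "u \<in> borel_measurable M" "\<And>x. x \<in> D \<Longrightarrow> norm (u x) \<le> B"
  shows "u \<in> L2 D"
proof -
  have "integrable M (\<lambda>x. (norm (u x))\<^sup>2)"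
    using assms by (intro integrable_const_bound[where B = "B\<^sup>2"] AE_I2) (auto intro!: power_mono)
  with assms show ?thesis by (simp add: L2_def)
qed

lemma L2_integrable: "u \<in> L2 D \<Longrightarrow> integrable M u"
  using L2_mult_integrable[of u "\<lambda>_. 1"] bounded_L2[of "\<lambda>_. 1" 1] by simp

lemma continuous_L2:
  assumes "continuous_on UNIV u"
  shows "u \<in> L2 D"
proof -
  obtain B where "\<And>z. norm z \<le> rad \<Longrightarrow> norm (u z) \<le> B"
    using continuous_bounded_cball[OF assms] by metis
  then show ?thesis
    using norm_less_rad less_imp_le by (intro bounded_L2[of u B] continuous_measurable_M[OF assms]) blast
qed

lemma L2_add:
  assumes "u \<in> L2 D" "v \<in> L2 D"
  shows "(\<lambda>x. u x + v x) \<in> L2 D"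
proof -
  have [measurable]: "u \<in> borel_measurable M" "v \<in> borel_measurable M"
    using assms by (auto simp: L2_def)
  have "integrable M (\<lambda>x. 2 * (norm (u x))\<^sup>2 + 2 * (norm (v x))\<^sup>2)"
    using assms by (simp add: L2_def)
  then have "integrable M (\<lambda>x. (norm (u x + v x))\<^sup>2)"
  proof (rule Bochner_Integration.integrable_bound)
    show "AE x in M. norm ((norm (u x + v x))\<^sup>2) \<le> norm (2 * (norm (u x))\<^sup>2 + 2 * (norm (v x))\<^sup>2)"
    proof (rule AE_I2)
      fix x
      have "(norm (u x + v x))\<^sup>2 \<le> (norm (u x) + norm (v x))\<^sup>2"
        by (intro power_mono norm_triangle_ineq) simp
      also have "\<dots> \<le> 2 * (norm (u x))\<^sup>2 + 2 * (norm (v x))\<^sup>2"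
        using sum_squares_bound[of "norm (u x)" "norm (v x)"] by (simp add: power2_sum)
      finally show "norm ((norm (u x + v x))\<^sup>2) \<le> norm (2 * (norm (u x))\<^sup>2 + 2 * (norm (v x))\<^sup>2)" by simp
    qed
  qed measurable
  then show ?thesis by (simp add: L2_def)
qed

lemma L2_bounded_mult:
  assumes "g \<in> borel_measurable M" "\<And>x. x \<in> D \<Longrightarrow> norm (g x) \<le> B" "u \<in> L2 D"
  shows "(\<lambda>x. g x * u x) \<in> L2 D"
proof -
  have [measurable]: "u \<in> borel_measurable M" "g \<in> borel_measurable M"
    using assms by (auto simp: L2_def)
  have "integrable M (\<lambda>x. B\<^sup>2 * (norm (u x))\<^sup>2)"
    using assms by (simp add: L2_def)
  then have "integrable M (\<lambda>x. (norm (g x * u x))\<^sup>2)"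
  proof (rule Bochner_Integration.integrable_bound)
    show "AE x in M. norm ((norm (g x * u x))\<^sup>2) \<le> norm (B\<^sup>2 * (norm (u x))\<^sup>2)"
      using assms(2) by (intro AE_I2) (auto simp: norm_mult power_mult_distrib intro!: mult_right_mono power_mono)
  qed measurable
  then show ?thesis by (simp add: L2_def)
qed

lemma L2_continuous_mult:
  assumes "continuous_on UNIV g" "u \<in> L2 D"
  shows "(\<lambda>x. g x * u x) \<in> L2 D"
proof -
  obtain B where "\<And>z. norm z \<le> rad \<Longrightarrow> norm (g z) \<le> B"
    using continuous_bounded_cball[OF assms(1)] by metis
  then show ?thesis
    using norm_less_rad less_imp_le assms
    by (intro L2_bounded_mult[of g B] continuous_measurable_M[OF assms(1)]) blast
qed

lemma L2_cmult: "u \<in> L2 D \<Longrightarrow> (\<lambda>x. c * u x) \<in> L2 D"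
  by (rule L2_continuous_mult) auto

lemma L2_diff: "u \<in> L2 D \<Longrightarrow> v \<in> L2 D \<Longrightarrow> (\<lambda>x. u x - v x) \<in> L2 D"
  using L2_add[of u "\<lambda>x. (- 1) * v x"] L2_cmult[of v "- 1"] by simp

lemma L2_zero: "(\<lambda>x. 0) \<in> L2 D"
  by (rule continuous_L2) simp

lemma L2_sum: "finite A \<Longrightarrow> (\<And>j. j \<in> A \<Longrightarrow> u j \<in> L2 D) \<Longrightarrow> (\<lambda>x. \<Sum>j\<in>A. u j x) \<in> L2 D"
  by (induction A rule: finite_induct) (auto intro: L2_add L2_zero)

text \<open>The norm of \<open>L2 D\<close>.\<close>

definition n2 :: "(real^3 \<Rightarrow> complex) \<Rightarrow> real" where
  "n2 u = sqrt (\<integral>x. (norm (u x))\<^sup>2 \<partial>M)"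

lemma n2_nonneg: "0 \<le> n2 u"
  by (simp add: n2_def)

lemma n2_square: "(n2 u)\<^sup>2 = (\<integral>x. (norm (u x))\<^sup>2 \<partial>M)"
  by (simp add: n2_def)

lemma n2_cong: "(AE x in M. u x = v x) \<Longrightarrow> u \<in> borel_measurable M \<Longrightarrow> v \<in> borel_measurable M \<Longrightarrow> n2 u = n2 v"
  unfolding n2_def by (intro arg_cong[where f = sqrt] integral_cong_AE) (auto elim: eventually_mono)

lemma n2_minus_commute: "n2 (\<lambda>x. u x - v x) = n2 (\<lambda>x. v x - u x)"
  by (simp add: n2_def norm_minus_commute)

lemma Cauchy_Schwarz_n2:
  assumes "u \<in> L2 D" "v \<in> L2 D"
  shows "(\<integral>x. norm (u x) * norm (v x) \<partial>M) \<le> n2 u * n2 v"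
    and "norm (\<integral>x. u x * v x \<partial>M) \<le> n2 u * n2 v"
proof -
  have "(\<integral>x. norm (u x) * norm (v x) \<partial>M)\<^sup>2 \<le> (n2 u * n2 v)\<^sup>2"
    using assms unfolding power_mult_distrib n2_square
    by (intro Cauchy_Schwarz_integral) (auto simp: L2_def)
  then show le: "(\<integral>x. norm (u x) * norm (v x) \<partial>M) \<le> n2 u * n2 v"
    by (rule power2_le_imp_le) (simp add: n2_nonneg)
  have "norm (\<integral>x. u x * v x \<partial>M) \<le> (\<integral>x. norm (u x) * norm (v x) \<partial>M)"
    using integral_norm_bound[of M "\<lambda>x. u x * v x"] by (simp add: norm_mult)
  with le show "norm (\<integral>x. u x * v x \<partial>M) \<le> n2 u * n2 v" by simp
qed

lemma n2_triangle:
  assumes "u \<in> L2 D" "v \<in> L2 D"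
  shows "n2 (\<lambda>x. u x + v x) \<le> n2 u + n2 v"
proof -
  have i: "integrable M (\<lambda>x. norm (u x) * norm (v x))"
    using assms by (intro integrable_mult_of_squares(2)) (auto simp: L2_def)
  have "(n2 (\<lambda>x. u x + v x))\<^sup>2 \<le> (\<integral>x. (norm (u x))\<^sup>2 + (norm (v x))\<^sup>2 + 2 * (norm (u x) * norm (v x)) \<partial>M)"
    unfolding n2_square
  proof (rule integral_mono)
    show "integrable M (\<lambda>x. (norm (u x + v x))\<^sup>2)"
      using L2_add[OF assms] by (simp add: L2_def)
    show "integrable M (\<lambda>x. (norm (u x))\<^sup>2 + (norm (v x))\<^sup>2 + 2 * (norm (u x) * norm (v x)))"
      using assms i by (simp add: L2_def)
    fix x
    have "(norm (u x + v x))\<^sup>2 \<le> (norm (u x) + norm (v x))\<^sup>2"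
      by (intro power_mono norm_triangle_ineq) simp
    then show "(norm (u x + v x))\<^sup>2 \<le> (norm (u x))\<^sup>2 + (norm (v x))\<^sup>2 + 2 * (norm (u x) * norm (v x))"
      by (simp add: power2_sum algebra_simps)
  qed
  also have "\<dots> = (n2 u)\<^sup>2 + (n2 v)\<^sup>2 + 2 * (\<integral>x. norm (u x) * norm (v x) \<partial>M)"
    using assms i by (simp add: n2_square L2_def)
  also have "\<dots> \<le> (n2 u + n2 v)\<^sup>2"
    using Cauchy_Schwarz_n2(1)[OF assms] by (simp add: power2_sum algebra_simps)
  finally show ?thesis
    by (rule power2_le_imp_le) (simp add: n2_nonneg)
qed

lemma n2_triangle_diff:
  assumes "u \<in> L2 D" "v \<in> L2 D" "w \<in> L2 D"
  shows "n2 (\<lambda>x. u x - w x) \<le> n2 (\<lambda>x. u x - v x) + n2 (\<lambda>x. v x - w x)"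
  using n2_triangle[OF L2_diff[OF assms(1,2)] L2_diff[OF assms(2,3)]] by simp

lemma n2_triangle_sum:
  assumes "finite A" "\<And>j. j \<in> A \<Longrightarrow> u j \<in> L2 D"
  shows "n2 (\<lambda>x. \<Sum>j\<in>A. u j x) \<le> (\<Sum>j\<in>A. n2 (u j))"
  using assms
proof (induction A rule: finite_induct)
  case (insert j A)
  then have "n2 (\<lambda>x. u j x + (\<Sum>j\<in>A. u j x)) \<le> n2 (u j) + n2 (\<lambda>x. \<Sum>j\<in>A. u j x)"
    by (intro n2_triangle L2_sum) auto
  with insert show ?case by (simp add: insert.hyps)
qed (simp add: n2_def)

lemma n2_bound:
  assumes "g \<in> borel_measurable M" "\<And>x. x \<in> D \<Longrightarrow> norm (g x) \<le> B" "B \<ge> 0" "u \<in> L2 D"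
  shows "n2 (\<lambda>x. g x * u x) \<le> B * n2 u"
proof -
  have "(\<integral>x. (norm (g x * u x))\<^sup>2 \<partial>M) \<le> (\<integral>x. B\<^sup>2 * (norm (u x))\<^sup>2 \<partial>M)"
    using L2_bounded_mult[OF assms(1,2,4)] assms
    by (intro integral_mono) (auto simp: L2_def norm_mult power_mult_distrib intro!: mult_right_mono power_mono)
  then have "n2 (\<lambda>x. g x * u x) \<le> sqrt (B\<^sup>2 * (\<integral>x. (norm (u x))\<^sup>2 \<partial>M))"
    by (simp add: n2_def)
  then show ?thesis using assms by (simp add: n2_def real_sqrt_mult)
qed

lemma n2_sup:
  assumes "u \<in> borel_measurable M" "\<And>x. x \<in> D \<Longrightarrow> norm (u x) \<le> B" "B \<ge> 0"
  shows "n2 u \<le> B * n2 (\<lambda>_. 1)"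
  using n2_bound[OF assms, of "\<lambda>_. 1"] continuous_L2[of "\<lambda>_. 1"] by simp

lemma L1_le_n2: "u \<in> L2 D \<Longrightarrow> (\<integral>x. norm (u x) \<partial>M) \<le> n2 (\<lambda>_. 1) * n2 u"
  using Cauchy_Schwarz_n2(1)[of "\<lambda>_. 1" u] continuous_L2[of "\<lambda>_. 1"] by simp

lemma Fatou_n2:
  assumes u: "\<And>k. u k \<in> L2 D" and [measurable]: "w \<in> borel_measurable M"
    and lim: "AE x in M. (\<lambda>k. u k x) \<longlonglongrightarrow> w x"
    and le: "\<And>k. k \<ge> K \<Longrightarrow> n2 (u k) \<le> e" and "e \<ge> 0"
  shows "w \<in> L2 D" "n2 w \<le> e"
proof -
  have [measurable]: "u k \<in> borel_measurable M" for k using u by (simp add: L2_def)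
  have nn: "(\<integral>\<^sup>+x. ennreal ((norm (u k x))\<^sup>2) \<partial>M) = ennreal ((n2 (u k))\<^sup>2)" for k
    unfolding n2_square using u by (intro nn_integral_eq_integral) (auto simp: L2_def)
  have "AE x in M. liminf (\<lambda>k. ennreal ((norm (u k x))\<^sup>2)) = ennreal ((norm (w x))\<^sup>2)"
    using lim
  proof eventually_elim
    case (elim x)
    then have "(\<lambda>k. ennreal ((norm (u k x))\<^sup>2)) \<longlonglongrightarrow> ennreal ((norm (w x))\<^sup>2)"
      by (intro tendsto_ennrealI tendsto_intros)
    then show ?case by (intro lim_imp_Liminf) auto
  qed
  then have "(\<integral>\<^sup>+x. ennreal ((norm (w x))\<^sup>2) \<partial>M) = (\<integral>\<^sup>+x. liminf (\<lambda>k. ennreal ((norm (u k x))\<^sup>2)) \<partial>M)"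
    by (intro nn_integral_cong_AE) (auto elim: eventually_mono)
  also have "\<dots> \<le> liminf (\<lambda>k. \<integral>\<^sup>+x. ennreal ((norm (u k x))\<^sup>2) \<partial>M)"
    by (rule nn_integral_liminf) auto
  also have "\<dots> \<le> liminf (\<lambda>k. ennreal (e\<^sup>2))"
    unfolding nn
    by (intro Liminf_mono eventually_sequentiallyI[of K] ennreal_leI power_mono le n2_nonneg)
  also have "\<dots> = ennreal (e\<^sup>2)" by (simp add: Liminf_const)
  finally have le2: "(\<integral>\<^sup>+x. ennreal ((norm (w x))\<^sup>2) \<partial>M) \<le> ennreal (e\<^sup>2)" .
  then have fin: "(\<integral>\<^sup>+x. ennreal ((norm (w x))\<^sup>2) \<partial>M) < \<infinity>"
    using le_less_trans ennreal_less_top by (metis infinity_ennreal_def)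
  then have i: "integrable M (\<lambda>x. (norm (w x))\<^sup>2)"
    by (intro integrableI_bounded) auto
  then show "w \<in> L2 D" by (simp add: L2_def)
  have "ennreal ((n2 w)\<^sup>2) \<le> ennreal (e\<^sup>2)"
    using le2 nn_integral_eq_integral[OF i] by (simp add: n2_square)
  then have "(n2 w)\<^sup>2 \<le> e\<^sup>2" by (subst (asm) ennreal_le_iff) auto
  then show "n2 w \<le> e" using \<open>e \<ge> 0\<close> by (rule power2_le_imp_le)
qed

text \<open>A subsequence with summable increments converges almost everywhere, and Fatou's lemma turns
  the Cauchy estimate into convergence to that limit.\<close>

lemma L2_complete:
  assumes u: "\<And>n. u n \<in> L2 D"
    and Cauchy: "\<And>e. e > 0 \<Longrightarrow> \<exists>N. \<forall>m\<ge>N. \<forall>n\<ge>N. n2 (\<lambda>x. u m x - u n x) \<le> e"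
  shows "\<exists>w\<in>L2 D. (\<lambda>n. n2 (\<lambda>x. u n x - w x)) \<longlonglongrightarrow> 0"
proof -
  have [measurable]: "u k \<in> borel_measurable M" for k using u by (simp add: L2_def)
  have "\<exists>N. \<forall>k. \<forall>m\<ge>N k. \<forall>n\<ge>N k. n2 (\<lambda>x. u m x - u n x) \<le> (1/2) ^ k"
    using Cauchy by (intro choice allI) simp
  then obtain N where N: "\<And>k m n. m \<ge> N k \<Longrightarrow> n \<ge> N k \<Longrightarrow> n2 (\<lambda>x. u m x - u n x) \<le> (1/2) ^ k"
    by blast
  \<comment> \<open>The sum makes \<open>r\<close> monotone and at least \<open>N\<close>; the summand \<open>k\<close> makes it unbounded.\<close>
  define r where "r k = k + (\<Sum>j\<le>k. N j)" for k
  have rN: "N k \<le> r k" for k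
    using member_le_sum[of k "{..k}" N] by (simp add: r_def)
  have r_le: "r k \<le> r (Suc k)" for k by (simp add: r_def)
  have r_ge: "k \<le> r k" for k by (simp add: r_def)
  define d where "d k x = u (r (Suc k)) x - u (r k) x" for k x
  have d2: "d k \<in> L2 D" for k
    unfolding d_def[abs_def] by (intro L2_diff u)
  have dle: "n2 (d k) \<le> (1/2) ^ k" for k
    unfolding d_def[abs_def] by (rule N) (use rN r_le order_trans in blast)+
  have [measurable]: "d k \<in> borel_measurable M" for k using d2 by (simp add: L2_def)
  define C where "C = n2 (\<lambda>_. 1)"
  have C: "C \<ge> 0" by (simp add: C_def n2_nonneg)
  have "(\<integral>\<^sup>+x. (\<Sum>k. ennreal (norm (d k x))) \<partial>M) = (\<Sum>k. \<integral>\<^sup>+x. ennreal (norm (d k x)) \<partial>M)"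
    by (rule nn_integral_suminf) auto
  also have "\<dots> \<le> (\<Sum>k. ennreal (C * (1/2) ^ k))"
  proof (intro suminf_le)
    fix k
    have "(\<integral>\<^sup>+x. ennreal (norm (d k x)) \<partial>M) = ennreal (\<integral>x. norm (d k x) \<partial>M)"
      using L2_integrable[OF d2] by (intro nn_integral_eq_integral) auto
    also have "\<dots> \<le> ennreal (C * (1/2) ^ k)"
      using order_trans[OF L1_le_n2[OF d2, of k] mult_left_mono[OF dle C, unfolded C_def]]
      by (intro ennreal_leI) (simp add: C_def)
    finally show "(\<integral>\<^sup>+x. ennreal (norm (d k x)) \<partial>M) \<le> ennreal (C * (1/2) ^ k)" .
  qed auto
  also have "\<dots> = ennreal (\<Sum>k. C * (1/2) ^ k)"
    using C by (intro suminf_ennreal2) (auto intro!: summable_mult summable_geometric)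
  also have "\<dots> < \<infinity>" by simp
  finally have "(\<integral>\<^sup>+x. (\<Sum>k. ennreal (norm (d k x))) \<partial>M) \<noteq> \<infinity>" by simp
  then have "AE x in M. (\<Sum>k. ennreal (norm (d k x))) \<noteq> \<infinity>"
    by (intro nn_integral_PInf_AE) auto
  then have conv: "AE x in M. convergent (\<lambda>k. u (r k) x)"
  proof eventually_elim
    case (elim x)
    then have "summable (\<lambda>k. norm (d k x))"
      by (intro summable_suminf_not_top) auto
    then have "summable (\<lambda>k. d k x)" by (rule summable_norm_cancel)
    then have "convergent (\<lambda>n. \<Sum>k<n. d k x)" by (simp add: summable_iff_convergent)
    moreover have "(\<Sum>k<n. d k x) = u (r n) x - u (r 0) x" for n
      unfolding d_def by (rule sum_lessThan_telescope)
    ultimately have "convergent (\<lambda>n. u (r n) x - u (r 0) x)" by simp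
    from convergent_add[OF this convergent_const[of "u (r 0) x"]] show ?case by simp
  qed
  define w where "w x = lim (\<lambda>k. u (r k) x)" for x
  have [measurable]: "w \<in> borel_measurable M"
    unfolding w_def[abs_def] by (rule borel_measurable_lim_metric) simp
  have lim: "AE x in M. (\<lambda>k. u (r k) x) \<longlonglongrightarrow> w x"
    using conv by eventually_elim (simp add: w_def convergent_LIMSEQ_iff)
  have diff: "(\<lambda>x. u n x - w x) \<in> L2 D \<and> n2 (\<lambda>x. u n x - w x) \<le> e"
    if "e > 0" and n: "\<And>m. m \<ge> K \<Longrightarrow> n2 (\<lambda>x. u n x - u m x) \<le> e" for n e K
  proof -
    have "AE x in M. (\<lambda>k. u n x - u (r k) x) \<longlonglongrightarrow> u n x - w x"
      using lim by eventually_elim (intro tendsto_intros)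
    moreover have "n2 (\<lambda>x. u n x - u (r k) x) \<le> e" if "k \<ge> K" for k
      using n that r_ge order_trans by blast
    ultimately show ?thesis
      using Fatou_n2[of "\<lambda>k x. u n x - u (r k) x" "\<lambda>x. u n x - w x" K e] u \<open>e > 0\<close>
      by (auto intro: L2_diff)
  qed
  obtain K where "\<forall>m\<ge>K. \<forall>n\<ge>K. n2 (\<lambda>x. u m x - u n x) \<le> 1"
    using Cauchy[of 1] by auto
  then have "(\<lambda>x. u K x - w x) \<in> L2 D"
    using diff[of 1 K K] by simp
  from L2_diff[OF u[of K] this] have "w \<in> L2 D" by simp
  moreover have "(\<lambda>n. n2 (\<lambda>x. u n x - w x)) \<longlonglongrightarrow> 0"
  proof (rule LIMSEQ_I)
    fix e :: real assume "e > 0"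
    then obtain K where K: "\<forall>m\<ge>K. \<forall>n\<ge>K. n2 (\<lambda>x. u m x - u n x) \<le> e / 2"
      using Cauchy[of "e / 2"] by auto
    have "n2 (\<lambda>x. u n x - w x) \<le> e / 2" if "n \<ge> K" for n
      using diff[of "e / 2" K n] K that \<open>e > 0\<close> by auto
    then show "\<exists>N. \<forall>n\<ge>N. norm (n2 (\<lambda>x. u n x - w x) - 0) < e"
      using \<open>e > 0\<close> n2_nonneg by (intro exI[of _ K]) (force simp: abs_of_nonneg)
  qed
  ultimately show ?thesis by blast
qed

section \<open>Weak derivatives\<close>

lemma is_weak_pdD: "is_weak_pd D i u v \<Longrightarrow> test_function D \<phi> \<Longrightarrow> (\<integral>x. u x * pd i \<phi> x \<partial>M) = - (\<integral>x. v x * \<phi> x \<partial>M)"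
  by (simp add: is_weak_pd_def)

lemma test_function_continuous:
  assumes "test_function D \<phi>"
  shows "continuous_on UNIV \<phi>" "continuous_on UNIV (pd i \<phi>)"
proof -
  have "Ck 1 \<phi>" using assms by (simp add: test_function_iff)
  from Ck_imp_continuous[OF this] Ck_1_pd_continuous[OF this]
  show "continuous_on UNIV \<phi>" "continuous_on UNIV (pd i \<phi>)" .
qed

lemma integrable_mult_continuous:
  "integrable M u \<Longrightarrow> continuous_on UNIV \<phi> \<Longrightarrow> integrable M (\<lambda>x. u x * \<phi> x :: complex)"
  using integrable_continuous_mult[of \<phi> u] by (simp add: mult.commute)

lemma classical_is_weak_pd:
  assumes "Ck 1 u"
  shows "is_weak_pd D i u (pd i u)"
  unfolding is_weak_pd_def test_function_iff
  by (intro allI impI integration_by_parts[OF assms]) simp_all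

lemma is_weak_pd_linear:
  assumes "u \<in> L2 D" "u' \<in> L2 D" "v \<in> L2 D" "v' \<in> L2 D" "is_weak_pd D i u v" "is_weak_pd D i u' v'"
  shows "is_weak_pd D i (\<lambda>x. c * u x + u' x) (\<lambda>x. c * v x + v' x)"
  unfolding is_weak_pd_def
proof (intro allI impI)
  fix \<phi> assume t: "test_function D \<phi>"
  note i = integrable_mult_continuous[OF L2_integrable]
  have "(\<integral>x. (c * u x + u' x) * pd i \<phi> x \<partial>M) = c * (\<integral>x. u x * pd i \<phi> x \<partial>M) + (\<integral>x. u' x * pd i \<phi> x \<partial>M)"
    using i[OF assms(1) test_function_continuous(2)[OF t]] i[OF assms(2) test_function_continuous(2)[OF t]]
    by (simp add: distrib_right mult.assoc)
  moreover have "(\<integral>x. (c * v x + v' x) * \<phi> x \<partial>M) = c * (\<integral>x. v x * \<phi> x \<partial>M) + (\<integral>x. v' x * \<phi> x \<partial>M)"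
    using i[OF assms(3) test_function_continuous(1)[OF t]] i[OF assms(4) test_function_continuous(1)[OF t]]
    by (simp add: distrib_right mult.assoc)
  ultimately show "(\<integral>x. (c * u x + u' x) * pd i \<phi> x \<partial>M) = - (\<integral>x. (c * v x + v' x) * \<phi> x \<partial>M)"
    using is_weak_pdD[OF assms(5) t] is_weak_pdD[OF assms(6) t] by simp
qed

lemma n2_limit_integral:
  assumes "\<And>n. u n \<in> L2 D" "w \<in> L2 D" "(\<lambda>n. n2 (\<lambda>x. u n x - w x)) \<longlonglongrightarrow> 0" "\<phi> \<in> L2 D"
  shows "(\<lambda>n. \<integral>x. u n x * \<phi> x \<partial>M) \<longlonglongrightarrow> (\<integral>x. w x * \<phi> x \<partial>M)"
proof -
  have A: "norm ((\<integral>x. u n x * \<phi> x \<partial>M) - (\<integral>x. w x * \<phi> x \<partial>M)) \<le> n2 (\<lambda>x. u n x - w x) * n2 \<phi>" for n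
    using Cauchy_Schwarz_n2(2)[OF L2_diff[OF assms(1)[of n] assms(2)] assms(4)]
      L2_mult_integrable[OF assms(1)[of n] assms(4)] L2_mult_integrable[OF assms(2,4)]
    by (simp add: left_diff_distrib)
  have B: "(\<lambda>n. n2 (\<lambda>x. u n x - w x) * n2 \<phi>) \<longlonglongrightarrow> 0"
    using tendsto_mult_right[OF assms(3), of "n2 \<phi>"] by simp
  have "(\<lambda>n. (\<integral>x. u n x * \<phi> x \<partial>M) - (\<integral>x. w x * \<phi> x \<partial>M)) \<longlonglongrightarrow> 0"
    by (rule Lim_null_comparison[OF always_eventually[OF allI] B]) (rule A)
  then show ?thesis by (simp add: LIM_zero_iff)
qed

lemma is_weak_pd_closed:
  assumes "\<And>n. u n \<in> L2 D" "\<And>n. v n \<in> L2 D" "\<And>n. is_weak_pd D i (u n) (v n)"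
    "u' \<in> L2 D" "v' \<in> L2 D"
    "(\<lambda>n. n2 (\<lambda>x. u n x - u' x)) \<longlonglongrightarrow> 0" "(\<lambda>n. n2 (\<lambda>x. v n x - v' x)) \<longlonglongrightarrow> 0"
  shows "is_weak_pd D i u' v'"
  unfolding is_weak_pd_def
proof (intro allI impI)
  fix \<phi> assume t: "test_function D \<phi>"
  note L = continuous_L2[OF test_function_continuous(1)[OF t]] continuous_L2[OF test_function_continuous(2)[OF t]]
  have "(\<lambda>n. \<integral>x. u n x * pd i \<phi> x \<partial>M) \<longlonglongrightarrow> (\<integral>x. u' x * pd i \<phi> x \<partial>M)"
    by (rule n2_limit_integral[OF assms(1,4,6) L(2)])
  moreover have "(\<lambda>n. - (\<integral>x. v n x * \<phi> x \<partial>M)) \<longlonglongrightarrow> - (\<integral>x. v' x * \<phi> x \<partial>M)"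
    by (intro tendsto_minus n2_limit_integral[OF assms(2,5,7) L(1)])
  ultimately show "(\<integral>x. u' x * pd i \<phi> x \<partial>M) = - (\<integral>x. v' x * \<phi> x \<partial>M)"
    using is_weak_pdD[OF assms(3) t] LIMSEQ_unique by simp
qed

lemma norm_integral_mult_diff_le:
  assumes "integrable M u" "continuous_on UNIV f" "continuous_on UNIV g" "\<And>x. x \<in> D \<Longrightarrow> norm (f x - g x) \<le> e"
  shows "norm (\<integral>x. u x * (f x - g x :: complex) \<partial>M) \<le> e * (\<integral>x. norm (u x) \<partial>M)"
proof (rule norm_integral_le_mult[OF assms(1)])
  show "integrable M (\<lambda>x. u x * (f x - g x))"
    using assms by (intro integrable_mult_continuous continuous_intros)
  show "norm (u x * (f x - g x)) \<le> e * norm (u x)" if "x \<in> D" for x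
    using mult_left_mono[OF assms(4)[OF that] norm_ge_zero[of "u x"]] by (simp add: norm_mult mult.commute)
qed

text \<open>Mollification extends the defining identity from smooth to continuously differentiable test
  functions, which are easier to produce.\<close>

lemma is_weak_pd_C1:
  assumes "u \<in> L2 D" "v \<in> L2 D" "is_weak_pd D i u v" "Ck 1 \<phi>" "csupp \<phi>"
  shows "(\<integral>x. u x * pd i \<phi> x \<partial>M) = - (\<integral>x. v x * \<phi> x \<partial>M)"
proof -
  define I where "I = (\<integral>x. norm (u x) \<partial>M) + (\<integral>x. norm (v x) \<partial>M)"
  have "I \<ge> 0" unfolding I_def by (intro add_nonneg_nonneg) auto
  have c: "continuous_on UNIV \<phi>" "continuous_on UNIV (pd i \<phi>)"
    using assms(4) Ck_imp_continuous[OF assms(4)] by auto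
  let ?X = "(\<integral>x. u x * pd i \<phi> x \<partial>M) + (\<integral>x. v x * \<phi> x \<partial>M)"
  have "norm ?X \<le> e * I" if e: "e > 0" for e
  proof -
    obtain \<psi> where t: "test_function D \<psi>"
      and close: "\<And>x. x \<in> D \<Longrightarrow> norm (\<psi> x - \<phi> x) \<le> e \<and> norm (pd i \<psi> x - pd i \<phi> x) \<le> e"
      using test_function_approx_C1[OF assms(4,5) e, of i] by blast
    note i = integrable_mult_continuous[OF L2_integrable[OF assms(1)]] integrable_mult_continuous[OF L2_integrable[OF assms(2)]]
    note ct = test_function_continuous[OF t]
    have "norm (\<integral>x. u x * (pd i \<psi> x - pd i \<phi> x) \<partial>M) \<le> e * (\<integral>x. norm (u x) \<partial>M)"
      by (rule norm_integral_mult_diff_le[OF L2_integrable[OF assms(1)] ct(2) c(2)]) (use close in blast)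
    moreover have "norm (\<integral>x. v x * (\<psi> x - \<phi> x) \<partial>M) \<le> e * (\<integral>x. norm (v x) \<partial>M)"
      by (rule norm_integral_mult_diff_le[OF L2_integrable[OF assms(2)] ct(1) c(1)]) (use close in blast)
    moreover have "?X = - ((\<integral>x. u x * (pd i \<psi> x - pd i \<phi> x) \<partial>M) + (\<integral>x. v x * (\<psi> x - \<phi> x) \<partial>M))"
      using is_weak_pdD[OF assms(3) t] i c ct by (simp add: right_diff_distrib)
    ultimately have "norm ?X \<le> e * (\<integral>x. norm (u x) \<partial>M) + e * (\<integral>x. norm (v x) \<partial>M)"
      by (simp only: norm_minus_cancel) (rule norm_triangle_mono)
    then show ?thesis by (simp add: I_def distrib_left)
  qed
  note le = this
  have "norm ?X \<le> 0"
  proof (rule field_le_epsilon)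
    fix e :: real assume "e > 0"
    have "norm ?X \<le> e / (I + 1) * I"
      using \<open>e > 0\<close> \<open>I \<ge> 0\<close> by (intro le) simp
    also have "\<dots> \<le> e" using \<open>e > 0\<close> \<open>I \<ge> 0\<close> by (simp add: field_simps)
    finally show "norm ?X \<le> 0 + e" by simp
  qed
  then show ?thesis by (simp add: eq_neg_iff_add_eq_0)
qed

lemma integral_test_function_eq_0_continuous:
  assumes "integrable M v" "\<And>\<phi>. test_function D \<phi> \<Longrightarrow> (\<integral>x. v x * \<phi> x \<partial>M) = 0"
    "continuous_on UNIV \<phi>" "csupp \<phi>"
  shows "(\<integral>x. v x * \<phi> x \<partial>M) = 0"
proof -
  define I where "I = (\<integral>x. norm (v x) \<partial>M)"
  have "I \<ge> 0" unfolding I_def by simp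
  have "norm (\<integral>x. v x * \<phi> x \<partial>M) \<le> 0"
  proof (rule field_le_epsilon)
    fix e :: real assume "e > 0"
    then have e: "e / (I + 1) > 0" using \<open>I \<ge> 0\<close> by simp
    obtain \<psi> where t: "test_function D \<psi>" and close: "\<And>x. x \<in> D \<Longrightarrow> norm (\<psi> x - \<phi> x) \<le> e / (I + 1)"
      using test_function_approx[OF assms(3,4) e] by blast
    note i = integrable_mult_continuous[OF assms(1)]
    note ct = test_function_continuous(1)[OF t]
    have "norm (\<integral>x. v x * (\<psi> x - \<phi> x) \<partial>M) \<le> e / (I + 1) * I"
      unfolding I_def
      by (rule norm_integral_mult_diff_le[OF assms(1) ct assms(3) close[unfolded I_def]])
    also have "\<dots> \<le> e" using \<open>e > 0\<close> \<open>I \<ge> 0\<close> by (simp add: field_simps)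
    finally show "norm (\<integral>x. v x * \<phi> x \<partial>M) \<le> 0 + e"
      using assms(2)[OF t] i[OF assms(3)] i[OF ct] by (simp add: right_diff_distrib)
  qed
  then show ?thesis by simp
qed

text \<open>Cut-offs in terms of the distance to the complement of \<open>D\<close>, which is nonempty as \<open>D\<close> is bounded.\<close>

definition cut :: "nat \<Rightarrow> real^3 \<Rightarrow> real" where
  "cut n x = min 1 (max 0 (real (Suc n) * infdist x (- D) - 1))"

lemma compl_D: "closed (- D)" "- D \<noteq> {}"
proof -
  show "closed (- D)" using open_D by (rule closed_Compl)
  have "D \<noteq> UNIV" using bounded_D not_bounded_UNIV by blast
  then show "- D \<noteq> {}" by blast
qed

lemma continuous_cut: "continuous_on UNIV (cut n)"
  unfolding cut_def[abs_def] by (intro continuous_intros)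

lemma cut_bounds: "0 \<le> cut n x" "cut n x \<le> 1"
  by (auto simp: cut_def)

lemma cut_tendsto:
  assumes "x \<in> D"
  shows "(\<lambda>n. cut n x) \<longlonglongrightarrow> 1"
proof -
  define a where "a = infdist x (- D)"
  have "a > 0"
    unfolding a_def using compl_D assms infdist_pos_not_in_closed[of "- D" x] by simp
  then obtain N where N: "2 / a < real N" using reals_Archimedean2 by blast
  have "cut n x = 1" if "n \<ge> N" for n
  proof -
    have "2 / a < real (Suc n)" using N that by simp
    then have "2 < real (Suc n) * a" using \<open>a > 0\<close> by (simp add: field_simps)
    then show ?thesis by (simp add: cut_def a_def[symmetric])
  qed
  then show ?thesis
    by (intro tendsto_eventually eventually_sequentiallyI[of N])
qed

lemma csupp_cut: "csupp (\<lambda>x. g x * of_real (cut n x))"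
proof (rule csuppI)
  show "closed {x. 1 / real (Suc n) \<le> infdist x (- D)}"
    by (intro closed_Collect_le continuous_intros)
  show "{x. 1 / real (Suc n) \<le> infdist x (- D)} \<subseteq> D"
  proof
    fix x assume "x \<in> {x. 1 / real (Suc n) \<le> infdist x (- D)}"
    then have "infdist x (- D) > 0"
      by (smt (verit, best) mem_Collect_eq divide_pos_pos of_nat_0_less_iff zero_less_Suc)
    then show "x \<in> D" by (metis ComplI infdist_zero less_irrefl)
  qed
  fix x assume "x \<notin> {x. 1 / real (Suc n) \<le> infdist x (- D)}"
  then have "real (Suc n) * infdist x (- D) \<le> 1" by (simp add: field_simps)
  then show "g x * of_real (cut n x) = 0" by (simp add: cut_def)
qed

text \<open>The bounded function \<open>cnj v / (1 + \<bar>v\<bar>)\<close> is an almost everywhere limit of continuous functions,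
  which may be truncated to modulus at most 1 and cut off near the boundary; testing with them
  gives \<open>\<integral> \<bar>v\<bar>\<^sup>2 / (1 + \<bar>v\<bar>) = 0\<close>.\<close>

lemma fundamental_lemma:
  assumes "integrable M v" "\<And>\<phi>. test_function D \<phi> \<Longrightarrow> (\<integral>x. v x * \<phi> x \<partial>M) = 0"
  shows "AE x in M. v x = 0"
proof -
  have [measurable]: "v \<in> borel_measurable M" using assms by simp
  define s where "s x = cnj (v x) / of_real (1 + norm (v x))" for x
  have "cnj \<in> borel_measurable borel"
    by (intro borel_measurable_continuous_onI continuous_intros)
  then have sm[measurable]: "s \<in> borel_measurable M" unfolding s_def[abs_def] by measurable
  have ns: "norm (s x) \<le> 1" for x
  proof -
    have "norm (1 + of_real (norm (v x)) :: complex) = 1 + norm (v x)"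
      by (metis norm_of_real abs_of_nonneg add_nonneg_nonneg norm_ge_zero of_real_1 of_real_add zero_le_one)
    then show ?thesis by (simp add: s_def norm_divide divide_simps add_nonneg_nonneg not_less)
  qed
  have "s measurable_on D"
    using sm sets_D by (simp add: measurable_on_iff_borel_measurable)
  then obtain N g where N: "negligible N" and g: "\<And>n. continuous_on UNIV (g n)"
    and lim: "\<And>x. x \<notin> N \<Longrightarrow> (\<lambda>n. g n x) \<longlonglongrightarrow> (if x \<in> D then s x else 0)"
    unfolding measurable_on_def by blast
  define \<rho> where "\<rho> z = z / of_real (max 1 (norm z))" for z :: complex
  have \<rho>c: "continuous_on UNIV \<rho>"
    unfolding \<rho>_def[abs_def] by (intro continuous_intros) (auto simp: max_def)
  have \<rho>1: "norm (\<rho> z) \<le> 1" for z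
    by (simp add: \<rho>_def norm_divide divide_simps max_def)
  have \<rho>s: "\<rho> (s x) = s x" for x
    using ns[of x] by (simp add: \<rho>_def max_def)
  have AEN: "AE x in M. x \<notin> N"
  proof -
    have "AE x in lebesgue. x \<notin> N"
      using N by (simp add: negligible_iff_null_sets AE_not_in)
    then have "AE x in lebesgue. x \<in> D \<longrightarrow> x \<notin> N" by (rule eventually_mono) simp
    then show ?thesis using sets_D by (simp add: AE_restrict_space_iff)
  qed
  have gc: "continuous_on UNIV (\<lambda>x. \<rho> (g n x) * of_real (cut n x))" for n
    by (intro continuous_intros continuous_on_compose2[OF \<rho>c g] continuous_cut) auto
  have z: "(\<integral>x. v x * (\<rho> (g n x) * of_real (cut n x)) \<partial>M) = 0" for n
    by (rule integral_test_function_eq_0_continuous[OF assms gc csupp_cut])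
  have "(\<lambda>n. \<integral>x. v x * (\<rho> (g n x) * of_real (cut n x)) \<partial>M) \<longlonglongrightarrow> (\<integral>x. v x * s x \<partial>M)"
  proof (rule integral_dominated_convergence[where w = "\<lambda>x. norm (v x)"])
    show "(\<lambda>x. v x * s x) \<in> borel_measurable M" by measurable
    show "(\<lambda>x. v x * (\<rho> (g n x) * of_real (cut n x))) \<in> borel_measurable M" for n
      using integrable_mult_continuous[OF assms(1) gc] by simp
    show "integrable M (\<lambda>x. norm (v x))" using assms by simp
    show "AE x in M. (\<lambda>n. v x * (\<rho> (g n x) * of_real (cut n x))) \<longlonglongrightarrow> v x * s x"
      using AEN AE_space
    proof eventually_elim
      case (elim x)
      then have x: "x \<in> D" by simp
      have "(\<lambda>n. \<rho> (g n x)) \<longlonglongrightarrow> \<rho> (s x)"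
        using lim[OF elim(1)] x \<rho>c
        by (intro continuous_on_tendsto_compose[OF \<rho>c]) auto
      then have "(\<lambda>n. v x * (\<rho> (g n x) * of_real (cut n x))) \<longlonglongrightarrow> v x * (\<rho> (s x) * of_real 1)"
        by (intro tendsto_intros cut_tendsto x)
      then show ?case by (simp add: \<rho>s)
    qed
    show "AE x in M. norm (v x * (\<rho> (g n x) * of_real (cut n x))) \<le> norm (v x)" for n
    proof (rule AE_I2)
      fix x
      have "norm (\<rho> (g n x) * of_real (cut n x)) \<le> 1 * 1"
        unfolding norm_mult using \<rho>1 cut_bounds by (intro mult_mono) auto
      then show "norm (v x * (\<rho> (g n x) * of_real (cut n x))) \<le> norm (v x)"
        by (simp only: norm_mult[of "v x"]) (simp add: mult_left_le)
    qed
  qed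
  then have "(\<integral>x. v x * s x \<partial>M) = 0"
    unfolding z using LIMSEQ_unique tendsto_const by blast
  moreover have vs: "v x * s x = of_real ((norm (v x))\<^sup>2 / (1 + norm (v x)))" for x
    unfolding s_def by (simp add: complex_norm_square[symmetric])
  ultimately have "complex_of_real (\<integral>x. (norm (v x))\<^sup>2 / (1 + norm (v x)) \<partial>M) = 0"
    by (simp only: vs integral_complex_of_real)
  then have z0: "(\<integral>x. (norm (v x))\<^sup>2 / (1 + norm (v x)) \<partial>M) = 0"
    by (simp only: of_real_eq_0_iff)
  have "integrable M (\<lambda>x. (norm (v x))\<^sup>2 / (1 + norm (v x)))"
  proof (rule Bochner_Integration.integrable_bound)
    show "integrable M (\<lambda>x. norm (v x))" using assms by simp
    have "t\<^sup>2 / (1 + t) \<le> t" if "t \<ge> 0" for t :: real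
      using that by (simp add: divide_simps power2_eq_square algebra_simps)
    then show "AE x in M. norm ((norm (v x))\<^sup>2 / (1 + norm (v x))) \<le> norm (norm (v x))"
      by (intro AE_I2) (simp add: add_nonneg_nonneg abs_of_nonneg)
  qed measurable
  moreover have "AE x in M. 0 \<le> (norm (v x))\<^sup>2 / (1 + norm (v x))"
    by (intro AE_I2 divide_nonneg_nonneg add_nonneg_nonneg) auto
  ultimately have "AE x in M. (norm (v x))\<^sup>2 / (1 + norm (v x)) = 0"
    using z0 integral_nonneg_eq_0_iff_AE by blast
  then show ?thesis
  proof eventually_elim
    case (elim x)
    moreover have "1 + norm (v x) > 0" by (simp add: add_pos_nonneg)
    ultimately show ?case by simp
  qed
qed

lemma is_weak_pd_unique:
  assumes "v \<in> L2 D" "v' \<in> L2 D" "is_weak_pd D i u v" "is_weak_pd D i u v'"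
  shows "AE x in M. v x = v' x"
proof -
  have "AE x in M. v x - v' x = 0"
  proof (rule fundamental_lemma)
    show "integrable M (\<lambda>x. v x - v' x)"
      using assms by (intro L2_integrable L2_diff)
    fix \<phi> assume t: "test_function D \<phi>"
    note i = integrable_mult_continuous[OF L2_integrable test_function_continuous(1)[OF t]]
    have "(\<integral>x. v x * \<phi> x \<partial>M) = (\<integral>x. v' x * \<phi> x \<partial>M)"
      using is_weak_pdD[OF assms(3) t] is_weak_pdD[OF assms(4) t] by simp
    then show "(\<integral>x. (v x - v' x) * \<phi> x \<partial>M) = 0"
      using i[OF assms(1)] i[OF assms(2)] by (simp add: left_diff_distrib)
  qed
  then show ?thesis by simp
qed

text \<open>Any weak derivative may be used in place of the chosen one.\<close>

lemma weak_pd_witness: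
  assumes "v \<in> L2 D" "is_weak_pd D i u v"
  shows "weak_pd D i u \<in> L2 D" "is_weak_pd D i u (weak_pd D i u)" "AE x in M. weak_pd D i u x = v x"
proof -
  have "weak_pd D i u \<in> L2 D \<and> is_weak_pd D i u (weak_pd D i u)"
    unfolding weak_pd_def by (rule someI[of _ v]) (use assms in blast)
  then show w: "weak_pd D i u \<in> L2 D" "is_weak_pd D i u (weak_pd D i u)" by auto
  show "AE x in M. weak_pd D i u x = v x"
    by (rule is_weak_pd_unique[OF w(1) assms(1) w(2) assms(2)])
qed

lemma n2_weak_pd:
  assumes "v \<in> L2 D" "is_weak_pd D i u v"
  shows "n2 (weak_pd D i u) = n2 v"
  using weak_pd_witness[OF assms] assms by (intro n2_cong L2_measurable)

lemma H1_weak_pd: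
  assumes "u \<in> H1 D"
  shows "u \<in> L2 D" "weak_pd D i u \<in> L2 D" "is_weak_pd D i u (weak_pd D i u)"
proof -
  obtain v where v: "v \<in> L2 D" "is_weak_pd D i u v" using assms unfolding H1_def by blast
  show "u \<in> L2 D" using assms by (simp add: H1_def)
  show "weak_pd D i u \<in> L2 D" "is_weak_pd D i u (weak_pd D i u)"
    using weak_pd_witness[OF v] by auto
qed

lemma H1I: "u \<in> L2 D \<Longrightarrow> (\<And>i. v i \<in> L2 D) \<Longrightarrow> (\<And>i. is_weak_pd D i u (v i)) \<Longrightarrow> u \<in> H1 D"
  by (auto simp: H1_def)

end

section \<open>The regularised kernels\<close>

abbreviation eps :: "nat \<Rightarrow> real" where
  "eps n \<equiv> 1 / real (Suc n)"

text \<open>Replacing the distance by \<open>sqrt (\<epsilon>\<^sup>2 + \<bar>z\<bar>\<^sup>2)\<close> makes the kernel smooth for \<open>\<epsilon> > 0\<close>. As the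
  new distance is at least \<open>\<bar>z\<bar>\<close>, bounds by negative powers of \<open>\<bar>z\<bar>\<close> hold uniformly in \<open>\<epsilon>\<close>. For \<open>\<epsilon> = 0\<close> the
  definitions give the original kernel and its gradient away from the origin, and 0 at the origin.\<close>

definition rr :: "real \<Rightarrow> real^3 \<Rightarrow> real" where
  "rr \<epsilon> z = sqrt (\<epsilon>\<^sup>2 + z \<bullet> z)"

definition gker :: "real \<Rightarrow> real \<Rightarrow> real^3 \<Rightarrow> complex" where
  "gker k \<epsilon> z = exp (\<i> * of_real (k * rr \<epsilon> z)) / of_real (4 * pi * rr \<epsilon> z)"

definition dgker :: "real \<Rightarrow> 3 \<Rightarrow> real \<Rightarrow> real^3 \<Rightarrow> complex" where
  "dgker k i \<epsilon> z = (\<i> * of_real k / of_real (rr \<epsilon> z) - 1 / of_real ((rr \<epsilon> z)\<^sup>2)) *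
     exp (\<i> * of_real (k * rr \<epsilon> z)) / of_real (4 * pi) * of_real (z $ i / rr \<epsilon> z)"

lemma rr_0: "rr 0 z = norm z"
  by (simp add: rr_def norm_eq_sqrt_inner)

lemma norm_le_rr: "norm z \<le> rr \<epsilon> z"
  unfolding rr_def norm_eq_sqrt_inner by (intro real_sqrt_le_mono) simp

lemma rr_pos: "\<epsilon> > 0 \<or> z \<noteq> 0 \<Longrightarrow> rr \<epsilon> z > 0"
  by (auto simp: rr_def add_pos_nonneg add_nonneg_pos)

lemma continuous_rr: "continuous_on UNIV (rr \<epsilon>)"
  unfolding rr_def[abs_def] by (intro continuous_intros)

lemma green_eq_gker: "green k x y = gker k 0 (x - y)"
  by (simp add: green_def gker_def rr_0)

lemma scalar_potential_eq_conv: "scalar_potential k D f = conv D (gker k 0) f"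
  by (simp add: fun_eq_iff scalar_potential_def conv_def green_eq_gker)

lemma gker_profile_derivative:
  assumes "s > 0"
  shows "((\<lambda>s. exp (\<i> * of_real (k * sqrt s)) / of_real (4 * pi * sqrt s)) has_vector_derivative
    (\<i> * of_real k / of_real (sqrt s) - 1 / of_real ((sqrt s)\<^sup>2)) *
     exp (\<i> * of_real (k * sqrt s)) / of_real (4 * pi) * of_real (1 / (2 * sqrt s))) (at s)"
proof -
  have r: "(sqrt has_real_derivative 1 / (2 * sqrt s)) (at s)"
    using DERIV_real_sqrt[OF assms] by (simp add: inverse_eq_divide mult.commute)
  have F: "((\<lambda>w. exp (\<i> * (of_real k * w)) / (of_real (4 * pi) * w)) has_field_derivative
     (\<i> * of_real k / w - 1 / w\<^sup>2) * exp (\<i> * (of_real k * w)) / of_real (4 * pi)) (at w)"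
    if "w \<noteq> 0" for w :: complex
    using that by (auto intro!: derivative_eq_intros simp: field_simps power2_eq_square)
  have "of_real (sqrt s) \<noteq> (0 :: complex)" using assms by simp
  from field_vector_diff_chain_at[OF has_vector_derivative_of_real[OF r] F[OF this]]
  show ?thesis by (simp add: o_def ac_simps)
qed

lemma gker_Ck_1:
  assumes "\<epsilon> > 0"
  shows "Ck 1 (gker k \<epsilon>)" "pd i (gker k \<epsilon>) = dgker k i \<epsilon>"
proof -
  have s: "\<epsilon>\<^sup>2 + z \<bullet> z > 0" for z :: "real^3" using assms by (simp add: add_pos_nonneg)
  note d = radial[where s = 1, unfolded mult_1 mult_1_right, OF gker_profile_derivative[OF s, where k = k]]
  have g: "gker k \<epsilon> = (\<lambda>z. exp (\<i> * of_real (k * sqrt (\<epsilon>\<^sup>2 + z \<bullet> z))) / of_real (4 * pi * sqrt (\<epsilon>\<^sup>2 + z \<bullet> z)))"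
    by (simp add: fun_eq_iff gker_def rr_def)
  have df: "gker k \<epsilon> differentiable (at z)" for z
    unfolding g by (rule d(1))
  have pd: "pd i (gker k \<epsilon>) z = dgker k i \<epsilon> z" for i z
  proof -
    let ?X = "(\<i> * of_real k / of_real (rr \<epsilon> z) - 1 / of_real ((rr \<epsilon> z)\<^sup>2)) *
      exp (\<i> * of_real (k * rr \<epsilon> z)) / of_real (4 * pi)"
    have "pd i (gker k \<epsilon>) z = of_real (2 * z $ i) * (?X * of_real (1 / (2 * rr \<epsilon> z)))"
      unfolding g rr_def by (rule d(2))
    also have "\<dots> = ?X * (of_real (2 * z $ i) * of_real (1 / (2 * rr \<epsilon> z)))"
      by (simp only: mult.left_commute)
    also have "of_real (2 * z $ i) * of_real (1 / (2 * rr \<epsilon> z)) = (of_real (z $ i / rr \<epsilon> z) :: complex)"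
      by simp
    finally show ?thesis by (simp only: dgker_def)
  qed
  then have pd': "pd i (gker k \<epsilon>) = dgker k i \<epsilon>" for i by blast
  then show "pd i (gker k \<epsilon>) = dgker k i \<epsilon>" .
  have "rr \<epsilon> z \<noteq> 0" for z using rr_pos[of \<epsilon> z] assms by simp
  then have "continuous_on UNIV (dgker k i \<epsilon>)" for i
    unfolding dgker_def[abs_def] by (intro continuous_intros continuous_rr) auto
  with df pd' show "Ck 1 (gker k \<epsilon>)" by simp
qed

lemma gker_continuous:
  "\<epsilon> > 0 \<Longrightarrow> continuous_on UNIV (gker k \<epsilon>)" "\<epsilon> > 0 \<Longrightarrow> continuous_on UNIV (dgker k i \<epsilon>)"
  using Ck_imp_continuous[OF gker_Ck_1(1)] Ck_1_pd_continuous[OF gker_Ck_1(1)] gker_Ck_1(2) by metis+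

lemma gker_measurable [measurable]:
  "gker k \<epsilon> \<in> borel_measurable borel" "dgker k i \<epsilon> \<in> borel_measurable borel"
proof -
  have [measurable]: "rr \<epsilon> \<in> borel_measurable borel"
    by (rule borel_measurable_continuous_onI[OF continuous_rr])
  have e: "(\<lambda>t. exp (\<i> * of_real (k * t))) \<in> borel_measurable borel"
    by (intro borel_measurable_continuous_onI continuous_intros)
  have [measurable]: "(\<lambda>z. exp (\<i> * of_real (k * rr \<epsilon> z))) \<in> borel_measurable borel"
    by (rule measurable_compose[OF _ e]) simp
  have [measurable]: "(\<lambda>z::real^3. z $ i) \<in> borel_measurable borel"
    by (intro borel_measurable_continuous_onI continuous_intros)
  show "gker k \<epsilon> \<in> borel_measurable borel" "dgker k i \<epsilon> \<in> borel_measurable borel"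
    unfolding gker_def[abs_def] dgker_def[abs_def] by measurable
qed

lemma norm_exp_i_real: "norm (exp (\<i> * of_real t)) = 1"
  by simp

lemma norm_gker_le: "z \<noteq> 0 \<Longrightarrow> norm (gker k \<epsilon> z) \<le> 1 / norm z"
proof -
  assume z: "z \<noteq> 0"
  have p: "rr \<epsilon> z > 0" using rr_pos z by blast
  have "norm (gker k \<epsilon> z) = 1 / (4 * pi * rr \<epsilon> z)"
    unfolding gker_def norm_divide norm_exp_i_real using p by (simp add: norm_mult)
  also have "\<dots> \<le> 1 / norm z"
  proof (intro divide_left_mono)
    have "norm z \<le> 1 * rr \<epsilon> z" using norm_le_rr by simp
    also have "\<dots> \<le> 4 * pi * rr \<epsilon> z" using pi_gt3 p by (intro mult_right_mono) auto
    finally show "norm z \<le> 4 * pi * rr \<epsilon> z" .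
  qed (use z p in auto)
  finally show ?thesis .
qed

lemma norm_dgker_le:
  assumes "z \<noteq> 0" "norm z \<le> R"
  shows "norm (dgker k i \<epsilon> z) \<le> (\<bar>k\<bar> * R + 1) / (norm z)\<^sup>2"
proof -
  have p: "rr \<epsilon> z > 0" using rr_pos assms by blast
  have n: "norm z > 0" using assms by simp
  note le = norm_le_rr[of z \<epsilon>]
  have "norm (\<i> * of_real k / of_real (rr \<epsilon> z) - 1 / of_real ((rr \<epsilon> z)\<^sup>2) :: complex)
    \<le> \<bar>k\<bar> / rr \<epsilon> z + 1 / (rr \<epsilon> z)\<^sup>2"
    using norm_triangle_ineq4[of "\<i> * of_real k / of_real (rr \<epsilon> z) :: complex" "1 / of_real ((rr \<epsilon> z)\<^sup>2)"] p
    by (simp add: norm_divide norm_mult norm_power)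
  also have "\<dots> \<le> \<bar>k\<bar> / norm z + 1 / (norm z)\<^sup>2"
    using le n p by (intro add_mono divide_left_mono power_mono) auto
  also have "\<dots> \<le> (\<bar>k\<bar> * R + 1) / (norm z)\<^sup>2"
    using n assms(2) by (simp add: divide_simps power2_eq_square mult_left_mono)
  finally have 1: "norm (\<i> * of_real k / of_real (rr \<epsilon> z) - 1 / of_real ((rr \<epsilon> z)\<^sup>2) :: complex)
    \<le> (\<bar>k\<bar> * R + 1) / (norm z)\<^sup>2" .
  have 2: "norm (of_real (z $ i / rr \<epsilon> z) :: complex) \<le> 1"
    using component_le_norm_cart[of z i] le p by (simp add: norm_divide divide_simps)
  have 3: "norm (of_real (4 * pi) :: complex) \<ge> 1"
    using pi_gt3 by (simp add: norm_mult)
  have "norm (dgker k i \<epsilon> z) = norm (\<i> * of_real k / of_real (rr \<epsilon> z) - 1 / of_real ((rr \<epsilon> z)\<^sup>2) :: complex)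
     / norm (of_real (4 * pi) :: complex) * norm (of_real (z $ i / rr \<epsilon> z) :: complex)"
    unfolding dgker_def norm_mult norm_divide norm_exp_i_real by simp
  also have "\<dots> \<le> norm (\<i> * of_real k / of_real (rr \<epsilon> z) - 1 / of_real ((rr \<epsilon> z)\<^sup>2) :: complex) / 1 * 1"
    using 2 3 by (intro mult_mono divide_left_mono) auto
  finally show ?thesis using 1 by simp
qed

lemma rr_tendsto: "(\<lambda>n. rr (eps n) z) \<longlonglongrightarrow> rr 0 z"
proof -
  have "(\<lambda>n. eps n) \<longlonglongrightarrow> 0" by real_asymp
  then show ?thesis unfolding rr_def by (intro tendsto_intros)
qed

lemma gker_tendsto:
  assumes "z \<noteq> 0"
  shows "(\<lambda>n. gker k (eps n) z) \<longlonglongrightarrow> gker k 0 z"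
    and "(\<lambda>n. dgker k i (eps n) z) \<longlonglongrightarrow> dgker k i 0 z"
  unfolding gker_def dgker_def using assms
  by (intro tendsto_intros rr_tendsto; simp add: rr_0)+

lemma indicator_cball_measurable [measurable]: "indicat_real (cball (0::real^3) R) \<in> borel_measurable borel"
  by (rule borel_measurable_indicator) simp

lemma cball_pred_measurable [measurable]: "Measurable.pred borel (\<lambda>x::real^3. x \<in> cball 0 R)"
  by (simp add: pred_def)

text \<open>Dyadic shells: on \<open>R / 2\<^sup>n\<^sup>+\<^sup>1 < \<bar>z\<bar> \<le> R / 2\<^sup>n\<close> the integrand is at most \<open>4\<^sup>n\<^sup>+\<^sup>1 / R\<^sup>2\<close>, and the
  volume is of order \<open>R\<^sup>3 / 8\<^sup>n\<close>, so the contributions decay like \<open>1 / 2\<^sup>n\<close>.\<close>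

lemma integrable_inverse_square_norm:
  assumes "R > 0"
  shows "integrable lborel (\<lambda>z::real^3. indicator (cball 0 R) z * (1 / (norm z)\<^sup>2))"
proof (rule integrableI_bounded)
  have "(\<lambda>z::real^3. indicator (cball 0 R) z * (1 / (norm z)\<^sup>2) :: real) \<in> borel_measurable borel" by measurable
  then show "(\<lambda>z::real^3. indicator (cball 0 R) z * (1 / (norm z)\<^sup>2) :: real) \<in> borel_measurable lborel" by simp
  let ?a = "\<lambda>n. 4 ^ Suc n / R\<^sup>2 :: real"
  have one: "h n = (\<Sum>j\<in>{n}. h j)" for h :: "nat \<Rightarrow> ennreal" and n by simp
  have le: "ennreal (norm (indicator (cball 0 R) z * (1 / (norm z)\<^sup>2)))
    \<le> (\<Sum>n. ennreal (?a n) * indicator (cball 0 (R / 2 ^ n)) z)" for z :: "real^3"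
  proof (cases "z \<in> cball 0 R \<and> z \<noteq> 0")
    case True
    then have z: "norm z > 0" "norm z \<le> R" by auto
    have "\<exists>n. \<not> norm z \<le> R / 2 ^ n"
    proof -
      obtain n where "R / norm z < 2 ^ n" using real_arch_pow[of 2 "R / norm z"] by auto
      then have "\<not> norm z \<le> R / 2 ^ n" using z by (simp add: field_simps)
      then show ?thesis by blast
    qed
    then obtain m where m: "\<not> norm z \<le> R / 2 ^ m" "\<And>n. n < m \<Longrightarrow> norm z \<le> R / 2 ^ n"
      using exists_least_iff[of "\<lambda>n. \<not> norm z \<le> R / 2 ^ n"] by auto
    then obtain n where n: "m = Suc n" using z by (cases m) auto
    have "R / 2 ^ Suc n < norm z" using m(1) n by simp
    then have "(R / 2 ^ Suc n)\<^sup>2 < (norm z)\<^sup>2" using assms by (intro power_strict_mono) auto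
    moreover have "(R / 2 ^ Suc n)\<^sup>2 = R\<^sup>2 / 4 ^ Suc n"
    proof -
      have "((2::real) ^ Suc n)\<^sup>2 = 4 ^ Suc n"
        by (subst power_mult[symmetric], subst mult.commute, subst power_mult) simp
      then show ?thesis by (simp only: power_divide)
    qed
    ultimately have "R\<^sup>2 / 4 ^ Suc n \<le> (norm z)\<^sup>2" by simp
    moreover have "R\<^sup>2 / 4 ^ Suc n > 0" using assms by simp
    ultimately have "inverse ((norm z)\<^sup>2) \<le> inverse (R\<^sup>2 / 4 ^ Suc n)" by (rule le_imp_inverse_le)
    then have "1 / (norm z)\<^sup>2 \<le> ?a n" by (simp only: inverse_eq_divide divide_divide_eq_right mult_1)
    then have "ennreal (norm (indicator (cball 0 R) z * (1 / (norm z)\<^sup>2))) \<le> ennreal (?a n) * indicator (cball 0 (R / 2 ^ n)) z"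
      using True m(2)[of n] n by (simp add: ennreal_leI)
    also have "\<dots> = (\<Sum>j\<in>{n}. ennreal (?a j) * indicator (cball 0 (R / 2 ^ j)) z)"
      by (rule one)
    also have "\<dots> \<le> (\<Sum>n. ennreal (?a n) * indicator (cball 0 (R / 2 ^ n)) z)"
      by (rule sum_le_suminf) auto
    finally show ?thesis .
  qed auto
  let ?V = "unit_ball_vol (real DIM(real^3))"
  have V: "?V \<ge> 0" by simp
  have "(\<integral>\<^sup>+z. ennreal (norm (indicator (cball 0 R) z * (1 / (norm z)\<^sup>2))) \<partial>(lborel :: (real^3) measure))
    \<le> (\<integral>\<^sup>+z. (\<Sum>n. ennreal (?a n) * indicator (cball 0 (R / 2 ^ n)) z) \<partial>(lborel :: (real^3) measure))"
    by (intro nn_integral_mono le)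
  also have "\<dots> = (\<Sum>n. \<integral>\<^sup>+z. ennreal (?a n) * indicator (cball 0 (R / 2 ^ n)) z \<partial>(lborel :: (real^3) measure))"
    by (rule nn_integral_suminf) measurable
  also have "\<dots> = (\<Sum>n. ennreal (4 * R * ?V * (1 / 2) ^ n))"
  proof (intro suminf_cong)
    fix n
    have "(\<integral>\<^sup>+z. ennreal (?a n) * indicator (cball 0 (R / 2 ^ n)) z \<partial>(lborel :: (real^3) measure))
      = ennreal (?a n) * emeasure lborel (cball (0::real^3) (R / 2 ^ n))"
      by (rule nn_integral_cmult_indicator) auto
    also have "\<dots> = ennreal (?a n) * ennreal (?V * (R / 2 ^ n) ^ DIM(real^3))"
      using assms by (subst emeasure_cball) auto
    also have "\<dots> = ennreal (?a n * (?V * (R / 2 ^ n) ^ DIM(real^3)))"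
      by (rule ennreal_mult'[symmetric]) (use assms in simp)
    also have "?a n * (?V * (R / 2 ^ n) ^ DIM(real^3)) = 4 * R * ?V * (1 / 2) ^ n"
    proof -
      have "(4::real) ^ n * (1 / 2 ^ n) ^ 3 = (1 / 2) ^ n"
      proof -
        have e: "(8::real) ^ n = 4 ^ n * 2 ^ n" using power_mult_distrib[of "4::real" 2 n] by simp
        show ?thesis by (simp add: power_divide power3_eq_cube flip: power_mult_distrib) (simp add: e)
      qed
      then have "4 ^ Suc n / R\<^sup>2 * (R / 2 ^ n) ^ 3 = 4 * R * (1 / 2) ^ n"
        using assms by (simp add: power_divide power2_eq_square power3_eq_cube field_simps)
      from arg_cong[OF this, of "\<lambda>t. t * ?V"]
      have "4 ^ Suc n / R\<^sup>2 * (?V * (R / 2 ^ n) ^ 3) = 4 * R * ?V * (1 / 2) ^ n"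
        by (simp only: mult.assoc mult.commute mult.left_commute)
      moreover have "DIM(real^3) = 3" by simp
      ultimately show ?thesis by simp
    qed
    finally show "(\<integral>\<^sup>+z. ennreal (?a n) * indicator (cball 0 (R / 2 ^ n)) z \<partial>(lborel :: (real^3) measure))
      = ennreal (4 * R * ?V * (1 / 2) ^ n)" .
  qed
  also have "\<dots> = ennreal (\<Sum>n. 4 * R * ?V * (1 / 2) ^ n)"
    using V assms by (intro suminf_ennreal2 mult_nonneg_nonneg summable_mult summable_geometric) auto
  also have "\<dots> < \<infinity>" by simp
  finally show "(\<integral>\<^sup>+z. ennreal (norm (indicator (cball 0 R) z * (1 / (norm z)\<^sup>2))) \<partial>(lborel :: (real^3) measure)) < \<infinity>" .
qed

definition gker_err :: "real \<Rightarrow> real \<Rightarrow> nat \<Rightarrow> real" where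
  "gker_err k R n = (\<integral>z. indicator (cball 0 R) z * (norm (gker k (eps n) z - gker k 0 z))\<^sup>2 \<partial>lborel)"

definition dgker_err :: "real \<Rightarrow> 3 \<Rightarrow> real \<Rightarrow> nat \<Rightarrow> real" where
  "dgker_err k i R n = (\<integral>z. indicator (cball 0 R) z * norm (dgker k i (eps n) z - dgker k i 0 z) \<partial>lborel)"

lemma AE_nonzero: "AE z in lborel. z \<noteq> (0::real^3)"
  using AE_lborel_singleton[of "0::real^3"] by simp

text \<open>The first claim is the one of interest; the other two exhibit the dominating function.\<close>

lemma kernel_integrable:
  fixes h :: "real^3 \<Rightarrow> real"
  assumes "R > 0" and [measurable]: "h \<in> borel_measurable borel"
    and bound: "\<And>z. z \<noteq> 0 \<Longrightarrow> norm z \<le> R \<Longrightarrow> \<bar>h z\<bar> \<le> C / (norm z)\<^sup>2"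
  shows "integrable lborel (\<lambda>z. indicator (cball 0 R) z * h z)"
    and "integrable lborel (\<lambda>z::real^3. C * (indicator (cball 0 R) z * (1 / (norm z)\<^sup>2)) :: real)"
    and "AE z in lborel. norm (indicator (cball 0 R) z * h z) \<le> C * (indicator (cball 0 R) z * (1 / (norm z)\<^sup>2))"
proof -
  let ?w = "\<lambda>z::real^3. C * (indicator (cball 0 R) z * (1 / (norm z)\<^sup>2)) :: real"
  show iw: "integrable lborel ?w"
    by (rule integrable_mult_right) (rule integrable_inverse_square_norm[OF assms(1)])
  show bd: "AE z in lborel. norm (indicator (cball 0 R) z * h z) \<le> ?w z"
    using AE_nonzero by eventually_elim (use bound in \<open>auto simp: indicator_def\<close>)
  have m: "(\<lambda>z. indicator (cball 0 R) z * h z) \<in> borel_measurable borel" by measurable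
  show "integrable lborel (\<lambda>z. indicator (cball 0 R) z * h z)"
  proof (rule Bochner_Integration.integrable_bound[OF iw])
    show "AE z in lborel. norm (indicator (cball 0 R) z * h z) \<le> norm (?w z)"
      using bd by (rule eventually_mono) (simp only: real_norm_def order_trans[OF _ abs_ge_self])
  qed (use m in simp)
qed

lemma kernel_integral_tendsto_0:
  fixes h :: "nat \<Rightarrow> real^3 \<Rightarrow> real"
  assumes R: "R > 0" and m[measurable]: "\<And>n. h n \<in> borel_measurable borel"
    and bound: "\<And>n z. z \<noteq> 0 \<Longrightarrow> norm z \<le> R \<Longrightarrow> \<bar>h n z\<bar> \<le> C / (norm z)\<^sup>2"
    and lim: "\<And>z. z \<noteq> 0 \<Longrightarrow> (\<lambda>n. h n z) \<longlonglongrightarrow> 0"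
  shows "(\<lambda>n. \<integral>z. indicator (cball 0 R) z * h n z \<partial>lborel) \<longlonglongrightarrow> 0"
proof -
  note k = kernel_integrable[OF R m bound]
  have "(\<lambda>n. \<integral>z. indicator (cball 0 R) z * h n z \<partial>lborel) \<longlonglongrightarrow> (\<integral>z. 0 \<partial>(lborel :: (real^3) measure))"
  proof (rule integral_dominated_convergence[OF _ _ k(2)])
    show "AE z in lborel. (\<lambda>n. indicator (cball 0 R) z * h n z) \<longlonglongrightarrow> 0"
      using AE_nonzero
    proof eventually_elim
      case (elim z)
      show ?case using tendsto_mult_left[OF lim[OF elim], of "indicator (cball 0 R) z"] by simp
    qed
  qed (use k(1,3) in simp_all)
  then show ?thesis by simp
qed

lemma integrable_gker_square:
  assumes "R > 0"
  shows "integrable lborel (\<lambda>z. indicator (cball 0 R) z * (norm (gker k \<epsilon> z))\<^sup>2)"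
proof (rule kernel_integrable(1)[OF assms, where C = 1])
  show "\<bar>(norm (gker k \<epsilon> z))\<^sup>2\<bar> \<le> 1 / (norm z)\<^sup>2" if "z \<noteq> 0" for z
    using power_mono[OF norm_gker_le[OF that] norm_ge_zero, where n = 2] by (simp add: power_divide)
qed measurable

lemma gker_error:
  assumes "R > 0"
  shows "integrable lborel (\<lambda>z. indicator (cball 0 R) z * (norm (gker k (eps n) z - gker k 0 z))\<^sup>2)"
    and "gker_err k R \<longlonglongrightarrow> 0"
proof -
  have bd: "\<bar>(norm (gker k (eps n) z - gker k 0 z))\<^sup>2\<bar> \<le> 4 / (norm z)\<^sup>2" if "z \<noteq> 0" for n z
  proof -
    have "norm (gker k (eps n) z - gker k 0 z) \<le> 1 / norm z + 1 / norm z"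
      by (intro order_trans[OF norm_triangle_ineq4] add_mono norm_gker_le that)
    then have "(norm (gker k (eps n) z - gker k 0 z))\<^sup>2 \<le> (2 / norm z)\<^sup>2"
      by (intro power_mono) auto
    then show ?thesis by (simp add: power_divide)
  qed
  have m: "(\<lambda>z. (norm (gker k (eps n) z - gker k 0 z))\<^sup>2) \<in> borel_measurable borel" for n
    by measurable
  have lim: "(\<lambda>n. (norm (gker k (eps n) z - gker k 0 z))\<^sup>2) \<longlonglongrightarrow> 0" if "z \<noteq> 0" for z
    using tendsto_power[OF tendsto_norm_zero[OF LIM_zero[OF gker_tendsto(1)[OF that, of k]]], where n = 2] by simp
  show "integrable lborel (\<lambda>z. indicator (cball 0 R) z * (norm (gker k (eps n) z - gker k 0 z))\<^sup>2)"
    by (rule kernel_integrable(1)[OF assms m bd])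
  show "gker_err k R \<longlonglongrightarrow> 0"
    unfolding gker_err_def[abs_def] by (rule kernel_integral_tendsto_0[OF assms m bd lim])
qed

lemma dgker_error:
  assumes "R > 0"
  shows "integrable lborel (\<lambda>z. indicator (cball 0 R) z * norm (dgker k i (eps n) z - dgker k i 0 z))"
    and "dgker_err k i R \<longlonglongrightarrow> 0"
proof -
  have bd: "\<bar>norm (dgker k i (eps n) z - dgker k i 0 z)\<bar> \<le> (2 * (\<bar>k\<bar> * R + 1)) / (norm z)\<^sup>2"
    if "z \<noteq> 0" "norm z \<le> R" for n z
  proof -
    have "norm (dgker k i (eps n) z - dgker k i 0 z) \<le> (\<bar>k\<bar> * R + 1) / (norm z)\<^sup>2 + (\<bar>k\<bar> * R + 1) / (norm z)\<^sup>2"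
      by (intro order_trans[OF norm_triangle_ineq4] add_mono norm_dgker_le that)
    then show ?thesis by (simp only: abs_norm_cancel mult_2 add_divide_distrib)
  qed
  have m: "(\<lambda>z. norm (dgker k i (eps n) z - dgker k i 0 z)) \<in> borel_measurable borel" for n
    by measurable
  have lim: "(\<lambda>n. norm (dgker k i (eps n) z - dgker k i 0 z)) \<longlonglongrightarrow> 0" if "z \<noteq> 0" for z
    by (rule tendsto_norm_zero[OF LIM_zero[OF gker_tendsto(2)[OF that]]])
  show "integrable lborel (\<lambda>z. indicator (cball 0 R) z * norm (dgker k i (eps n) z - dgker k i 0 z))"
    by (rule kernel_integrable(1)[OF assms m bd])
  show "dgker_err k i R \<longlonglongrightarrow> 0"
    unfolding dgker_err_def[abs_def] by (rule kernel_integral_tendsto_0[OF assms m bd lim])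
qed

section \<open>Bounds for convolutions in terms of the kernel\<close>

context bounded_open
begin

lemma integral_M_borel:
  fixes f :: "real^3 \<Rightarrow> real"
  assumes "f \<in> borel_measurable borel"
  shows "integrable M f \<longleftrightarrow> integrable lborel (\<lambda>y. indicator D y * f y)"
    and "(\<integral>y. f y \<partial>M) = (\<integral>y. indicator D y * f y \<partial>lborel)"
proof -
  have [measurable]: "D \<in> sets borel" "f \<in> borel_measurable borel" using sets_D assms by auto
  have m: "(\<lambda>y. indicator D y *\<^sub>R f y) \<in> borel_measurable lborel" by measurable
  have "D \<inter> space lebesgue \<in> sets lebesgue" using sets_D by simp
  note r = integrable_restrict_space[OF this, of f] integral_restrict_space[OF this, of f]
  show "integrable M f \<longleftrightarrow> integrable lborel (\<lambda>y. indicator D y * f y)"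
    using r(1) integrable_completion[OF m] by simp
  show "(\<integral>y. f y \<partial>M) = (\<integral>y. indicator D y * f y \<partial>lborel)"
    using r(2) integral_completion[OF m] by simp
qed

text \<open>Differences of points of \<open>D\<close> have norm at most \<open>2 * rad\<close>, so only the kernel on that ball matters.\<close>

lemma integral_M_kernel:
  fixes h :: "real^3 \<Rightarrow> real"
  assumes [measurable]: "h \<in> borel_measurable borel" and nn: "\<And>z. h z \<ge> 0"
    and int: "integrable lborel (\<lambda>z. indicator (cball 0 (2 * rad)) z * h z)" and x: "norm x \<le> rad"
  shows "integrable M (\<lambda>y. h (x - y))"
    and "(\<integral>y. h (x - y) \<partial>M) \<le> (\<integral>z. indicator (cball 0 (2 * rad)) z * h z \<partial>lborel)"
proof -
  have [measurable]: "D \<in> sets borel" using sets_D by simp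
  let ?H = "\<lambda>z. indicator (cball 0 (2 * rad)) z * h z"
  have le: "indicator D y * h (x - y) \<le> ?H (x - y)" for y
  proof (cases "y \<in> D")
    case True
    then have "norm (x - y) \<le> 2 * rad"
      using norm_triangle_ineq4[of x y] norm_less_rad[OF True] x by linarith
    then have "x - y \<in> cball 0 (2 * rad)" by simp
    then show ?thesis using True by (simp only: indicator_simps)
  qed (simp add: nn)
  have "integrable (distr lborel borel (\<lambda>y. x - y)) ?H"
    using int by (simp add: lborel_distr_reflect)
  then have i: "integrable lborel (\<lambda>y. ?H (x - y))"
    by (subst (asm) integrable_distr_eq) auto
  have i': "integrable lborel (\<lambda>y. indicator D y * h (x - y))"
    by (rule Bochner_Integration.integrable_bound[OF i]) (use le nn in \<open>auto simp: abs_mult\<close>)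
  then show "integrable M (\<lambda>y. h (x - y))"
    by (subst integral_M_borel) auto
  have "(\<integral>y. h (x - y) \<partial>M) = (\<integral>y. indicator D y * h (x - y) \<partial>lborel)"
    by (rule integral_M_borel) measurable
  also have "\<dots> \<le> (\<integral>y. ?H (x - y) \<partial>lborel)"
    by (rule integral_mono[OF i' i le])
  also have "\<dots> = (\<integral>z. ?H z \<partial>lborel)"
    by (rule lborel_integral_reflect) measurable
  finally show "(\<integral>y. h (x - y) \<partial>M) \<le> (\<integral>z. ?H z \<partial>lborel)" .
qed

lemma integral_M_kernel':
  fixes h :: "real^3 \<Rightarrow> real"
  assumes [measurable]: "h \<in> borel_measurable borel" and nn: "\<And>z. h z \<ge> 0"
    and int: "integrable lborel (\<lambda>z. indicator (cball 0 (2 * rad)) z * h z)" and y: "norm y \<le> rad"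
  shows "integrable M (\<lambda>x. h (x - y))"
    and "(\<integral>x. h (x - y) \<partial>M) \<le> (\<integral>z. indicator (cball 0 (2 * rad)) z * h z \<partial>lborel)"
proof -
  let ?h = "\<lambda>z. h (0 - z)"
  let ?H = "\<lambda>z. indicator (cball 0 (2 * rad)) z * h z"
  have eq: "indicator (cball 0 (2 * rad)) z * ?h z = ?H (0 - z)" for z
    by (simp add: indicator_def)
  have "integrable (distr lborel borel (\<lambda>y. 0 - y)) ?H"
    using int by (simp only: lborel_distr_reflect)
  then have "integrable lborel (\<lambda>z. ?H (0 - z))"
    by (subst (asm) integrable_distr_eq) auto
  then have i: "integrable lborel (\<lambda>z. indicator (cball 0 (2 * rad)) z * ?h z)"
    by (simp only: eq)
  have [measurable]: "?h \<in> borel_measurable borel" by measurable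
  note k = integral_M_kernel[of ?h y, OF _ nn i y]
  show "integrable M (\<lambda>x. h (x - y))" using k(1) by simp
  have "(\<integral>z. ?H (0 - z) \<partial>lborel) = (\<integral>z. ?H z \<partial>lborel)"
    by (rule lborel_integral_reflect) measurable
  then show "(\<integral>x. h (x - y) \<partial>M) \<le> (\<integral>z. ?H z \<partial>lborel)"
    using k(2) unfolding eq by simp
qed

lemma conv_L2_kernel:
  assumes [measurable]: "\<kappa> \<in> borel_measurable borel"
    and int: "integrable lborel (\<lambda>z. indicator (cball 0 (2 * rad)) z * (norm (\<kappa> z))\<^sup>2)"
    and x: "norm x \<le> rad" and f: "f \<in> L2 D"
  shows "integrable M (\<lambda>y. \<kappa> (x - y) * f y)"
    and "norm (conv D \<kappa> f x) \<le> sqrt (\<integral>z. indicator (cball 0 (2 * rad)) z * (norm (\<kappa> z))\<^sup>2 \<partial>lborel) * n2 f"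
proof -
  have [measurable]: "(\<lambda>y. \<kappa> (x - y)) \<in> borel_measurable M"
    by (rule borel_measurable_M) measurable
  note k = integral_M_kernel[of "\<lambda>z. (norm (\<kappa> z))\<^sup>2", OF _ _ int x]
  have L: "(\<lambda>y. \<kappa> (x - y)) \<in> L2 D"
    using k(1) by (simp add: L2_def)
  show "integrable M (\<lambda>y. \<kappa> (x - y) * f y)"
    by (rule L2_mult_integrable[OF L f])
  have "norm (conv D \<kappa> f x) \<le> n2 (\<lambda>y. \<kappa> (x - y)) * n2 f"
    unfolding conv_def by (rule Cauchy_Schwarz_n2(2)[OF L f])
  also have "\<dots> \<le> sqrt (\<integral>z. indicator (cball 0 (2 * rad)) z * (norm (\<kappa> z))\<^sup>2 \<partial>lborel) * n2 f"
    using k(2) by (intro mult_right_mono n2_nonneg) (simp add: n2_def)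
  finally show "norm (conv D \<kappa> f x) \<le> sqrt (\<integral>z. indicator (cball 0 (2 * rad)) z * (norm (\<kappa> z))\<^sup>2 \<partial>lborel) * n2 f" .
qed

text \<open>Young's inequality, by Schur's argument: distribute the kernel over both factors of the
  Cauchy-Schwarz inequality and interchange the order of integration.\<close>

lemma conv_L1_kernel:
  assumes c: "continuous_on UNIV \<kappa>" and f: "f \<in> L2 D"
  shows "n2 (conv D \<kappa> f) \<le> (\<integral>z. indicator (cball 0 (2 * rad)) z * norm (\<kappa> z) \<partial>lborel) * n2 f"
proof -
  let ?K = "\<integral>z. indicator (cball 0 (2 * rad)) z * norm (\<kappa> z) \<partial>lborel"
  have [measurable]: "\<kappa> \<in> borel_measurable borel" by (rule borel_measurable_continuous_onI[OF c])
  have [measurable]: "f \<in> borel_measurable M" using f by (simp add: L2_def)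
  have cn: "continuous_on UNIV (\<lambda>z. norm (\<kappa> z))" by (intro continuous_intros c)
  have int: "integrable lborel (\<lambda>z. indicator (cball 0 (2 * rad)) z * norm (\<kappa> z))"
    using borel_integrable_compact[of "cball 0 (2 * rad)" "\<lambda>z. norm (\<kappa> z)"] continuous_on_subset[OF cn] by simp
  have K0: "?K \<ge> 0" by (intro integral_nonneg_AE AE_I2) simp
  \<comment> \<open>The second factor of the Cauchy-Schwarz inequality at the point \<open>x\<close>.\<close>
  define J where "J x = (\<integral>y. norm (\<kappa> (x - y)) * (norm (f y))\<^sup>2 \<partial>M)" for x
  have if2: "integrable M (\<lambda>y. (norm (f y))\<^sup>2)" using f by (simp add: L2_def)
  have Jconv: "of_real (J x) = conv D (\<lambda>z. of_real (norm (\<kappa> z))) (\<lambda>y. of_real ((norm (f y))\<^sup>2)) x" for x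
    unfolding J_def conv_def by (simp flip: of_real_mult of_real_power)
  have cc: "continuous_on UNIV (\<lambda>z. of_real (norm (\<kappa> z)) :: complex)" by (intro continuous_intros c)
  have if2': "integrable M (\<lambda>y. of_real ((norm (f y))\<^sup>2) :: complex)"
    by (rule integrable_of_real[OF if2])
  have "continuous_on UNIV (\<lambda>x. Re (of_real (J x)))"
    unfolding Jconv by (intro continuous_intros continuous_conv cc if2')
  then have Jc: "continuous_on UNIV J" by simp
  have iJ: "integrable M J"
    using integrable_continuous_M[of "\<lambda>x. of_real (J x)"] Jc integrable_Re[of M "\<lambda>x. of_real (J x)"]
    by (simp add: continuous_intros)
  have iprod: "integrable M (\<lambda>y. norm (\<kappa> (x - y)) * (norm (f y))\<^sup>2)" for x
    using integrable_Re[OF integrable_conv[OF cc if2', of x]] by (simp flip: of_real_mult of_real_power)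
  have Jnn: "J x \<ge> 0" for x unfolding J_def by simp
  have point: "(norm (conv D \<kappa> f x))\<^sup>2 \<le> ?K * J x" if x: "x \<in> D" for x
  proof -
    have [measurable]: "(\<lambda>y. \<kappa> (x - y)) \<in> borel_measurable M"
      by (rule borel_measurable_M) measurable
    note k = integral_M_kernel[of "\<lambda>z. norm (\<kappa> z)", OF _ _ int less_imp_le[OF norm_less_rad[OF x]]]
    have "norm (conv D \<kappa> f x) \<le> (\<integral>y. norm (\<kappa> (x - y) * f y) \<partial>M)"
      unfolding conv_def by (rule integral_norm_bound)
    also have "\<dots> = (\<integral>y. norm (sqrt (norm (\<kappa> (x - y)))) * norm (sqrt (norm (\<kappa> (x - y))) * norm (f y)) \<partial>M)"
      by (simp add: norm_mult abs_mult mult.assoc[symmetric])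
    finally have "(norm (conv D \<kappa> f x))\<^sup>2 \<le> \<dots>\<^sup>2" by (rule power_mono) simp
    also have "\<dots> \<le> (\<integral>y. (norm (sqrt (norm (\<kappa> (x - y)))))\<^sup>2 \<partial>M) * (\<integral>y. (norm (sqrt (norm (\<kappa> (x - y))) * norm (f y)))\<^sup>2 \<partial>M)"
      by (rule Cauchy_Schwarz_integral) (use k(1) iprod in \<open>auto simp: power_mult_distrib\<close>)
    also have "\<dots> = (\<integral>y. norm (\<kappa> (x - y)) \<partial>M) * J x"
      by (simp add: J_def power_mult_distrib)
    also have "\<dots> \<le> ?K * J x"
      using k(2) Jnn by (intro mult_right_mono) auto
    finally show ?thesis .
  qed
  have "(\<integral>x. J x \<partial>M) \<le> ?K * (n2 f)\<^sup>2"
  proof -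
    interpret P: pair_sigma_finite M M ..
    have idm: "(\<lambda>x. x) \<in> borel_measurable M"
      by (rule borel_measurable_M) simp
    have [measurable]: "fst \<in> borel_measurable (M \<Otimes>\<^sub>M M)" "snd \<in> borel_measurable (M \<Otimes>\<^sub>M M)"
      using measurable_compose[OF measurable_fst idm] measurable_compose[OF measurable_snd idm] by auto
    have [measurable]: "(\<lambda>p. f (snd p)) \<in> borel_measurable (M \<Otimes>\<^sub>M M)"
      by (rule measurable_compose[OF measurable_snd]) simp
    have [measurable]: "(\<lambda>p. \<kappa> (fst p - snd p)) \<in> borel_measurable (M \<Otimes>\<^sub>M M)"
      by (rule measurable_compose[where N = borel]) measurable
    have m: "(\<lambda>(x, y). ennreal (norm (\<kappa> (x - y)) * (norm (f y))\<^sup>2)) \<in> borel_measurable (M \<Otimes>\<^sub>M M)"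
      unfolding split_beta by measurable
    have "ennreal (\<integral>x. J x \<partial>M) = (\<integral>\<^sup>+x. ennreal (J x) \<partial>M)"
      using iJ Jnn by (intro nn_integral_eq_integral[symmetric]) auto
    also have "\<dots> = (\<integral>\<^sup>+x. (\<integral>\<^sup>+y. ennreal (norm (\<kappa> (x - y)) * (norm (f y))\<^sup>2) \<partial>M) \<partial>M)"
      unfolding J_def using iprod by (intro nn_integral_cong nn_integral_eq_integral[symmetric]) auto
    also have "\<dots> = (\<integral>\<^sup>+y. (\<integral>\<^sup>+x. ennreal (norm (\<kappa> (x - y)) * (norm (f y))\<^sup>2) \<partial>M) \<partial>M)"
      using P.Fubini'[OF m] by simp
    also have "\<dots> \<le> (\<integral>\<^sup>+y. ennreal (?K * (norm (f y))\<^sup>2) \<partial>M)"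
    proof (rule nn_integral_mono)
      fix y assume "y \<in> space M"
      then have y: "norm y \<le> rad" using norm_less_rad by (simp add: less_imp_le)
      note k = integral_M_kernel'[of "\<lambda>z. norm (\<kappa> z)", OF _ _ int y]
      have "(\<integral>\<^sup>+x. ennreal (norm (\<kappa> (x - y)) * (norm (f y))\<^sup>2) \<partial>M) = ennreal (\<integral>x. norm (\<kappa> (x - y)) * (norm (f y))\<^sup>2 \<partial>M)"
        using k(1) by (intro nn_integral_eq_integral) auto
      also have "\<dots> \<le> ennreal (?K * (norm (f y))\<^sup>2)"
        using k(2) by (intro ennreal_leI) (simp add: mult_right_mono)
      finally show "(\<integral>\<^sup>+x. ennreal (norm (\<kappa> (x - y)) * (norm (f y))\<^sup>2) \<partial>M) \<le> ennreal (?K * (norm (f y))\<^sup>2)" .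
    qed
    also have "\<dots> = ennreal (\<integral>y. ?K * (norm (f y))\<^sup>2 \<partial>M)"
      using if2 K0 by (intro nn_integral_eq_integral) auto
    also have "\<dots> = ennreal (?K * (n2 f)\<^sup>2)"
      by (simp add: n2_square)
    finally show ?thesis using K0 by (subst (asm) ennreal_le_iff) auto
  qed
  note Jle = this
  have "(n2 (conv D \<kappa> f))\<^sup>2 \<le> (\<integral>x. ?K * J x \<partial>M)"
    unfolding n2_square
  proof (rule integral_mono)
    show "integrable M (\<lambda>x. (norm (conv D \<kappa> f x))\<^sup>2)"
      using continuous_L2[OF continuous_conv[OF c L2_integrable[OF f]]] by (simp add: L2_def)
  qed (use iJ point in auto)
  also have "\<dots> \<le> ?K * (?K * (n2 f)\<^sup>2)"
    using Jle K0 by (simp add: mult_left_mono)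
  also have "\<dots> = (?K * n2 f)\<^sup>2" by (simp add: power2_eq_square)
  finally show ?thesis by (rule power2_le_imp_le) (simp add: K0 n2_nonneg)
qed

end

section \<open>The volume potential and its gradient\<close>

context bounded_open
begin

lemma conv_kernel_diff:
  assumes "integrable M (\<lambda>y. \<kappa> (x - y) * f y)" "integrable M (\<lambda>y. \<kappa>' (x - y) * f y)"
  shows "conv D (\<lambda>z. \<kappa> z - \<kappa>' z) f x = conv D \<kappa> f x - conv D \<kappa>' f x"
  using assms by (simp add: conv_def left_diff_distrib)

lemma conv_linear:
  assumes "integrable M (\<lambda>y. \<kappa> (x - y) * f y)" "integrable M (\<lambda>y. \<kappa> (x - y) * f' y)"
  shows "conv D \<kappa> (\<lambda>y. c * f y + f' y) x = c * conv D \<kappa> f x + conv D \<kappa> f' x"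
proof -
  have "conv D \<kappa> (\<lambda>y. c * f y + f' y) x = (\<integral>y. c * (\<kappa> (x - y) * f y) + \<kappa> (x - y) * f' y \<partial>M)"
    unfolding conv_def by (rule arg_cong[where f = "integral\<^sup>L M"]) (simp add: fun_eq_iff algebra_simps)
  also have "\<dots> = c * conv D \<kappa> f x + conv D \<kappa> f' x"
    using assms by (simp add: conv_def)
  finally show ?thesis .
qed

abbreviation S :: "real \<Rightarrow> (real^3 \<Rightarrow> complex) \<Rightarrow> real^3 \<Rightarrow> complex" where
  "S k \<equiv> conv D (gker k 0)"

abbreviation Sreg :: "real \<Rightarrow> nat \<Rightarrow> (real^3 \<Rightarrow> complex) \<Rightarrow> real^3 \<Rightarrow> complex" where
  "Sreg k n \<equiv> conv D (gker k (eps n))"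

abbreviation dSreg :: "real \<Rightarrow> 3 \<Rightarrow> nat \<Rightarrow> (real^3 \<Rightarrow> complex) \<Rightarrow> real^3 \<Rightarrow> complex" where
  "dSreg k i n \<equiv> conv D (dgker k i (eps n))"

lemma rad2: "2 * rad > 0"
  using rad by simp

lemma integrable_gker:
  assumes "f \<in> L2 D" "norm x \<le> rad"
  shows "integrable M (\<lambda>y. gker k \<epsilon> (x - y) * f y)"
  by (rule conv_L2_kernel(1)[OF _ integrable_gker_square[OF rad2] assms(2,1)]) measurable

text \<open>The regularised potentials converge uniformly because the kernel is locally square integrable.\<close>

lemma Sreg_uniform:
  assumes "f \<in> L2 D" "norm x \<le> rad"
  shows "norm (Sreg k n f x - S k f x) \<le> sqrt (gker_err k (2 * rad) n) * n2 f"
proof -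
  have "Sreg k n f x - S k f x = conv D (\<lambda>z. gker k (eps n) z - gker k 0 z) f x"
    using conv_kernel_diff[OF integrable_gker[OF assms] integrable_gker[OF assms]] by simp
  then show ?thesis
    unfolding gker_err_def
    using conv_L2_kernel(2)[OF _ gker_error(1)[OF rad2] assms(2,1), of k n]
    by simp
qed

lemma gker_err_tendsto: "(\<lambda>n. sqrt (gker_err k (2 * rad) n) * c) \<longlonglongrightarrow> 0"
proof -
  have "(\<lambda>n. sqrt (gker_err k (2 * rad) n) * c) \<longlonglongrightarrow> sqrt 0 * c"
    by (intro tendsto_intros gker_error rad2)
  then show ?thesis by simp
qed

lemma dgker_err_tendsto: "(\<lambda>n. dgker_err k i (2 * rad) n * c) \<longlonglongrightarrow> 0"
proof -
  have "(\<lambda>n. dgker_err k i (2 * rad) n * c) \<longlonglongrightarrow> 0 * c"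
    by (intro tendsto_intros dgker_error rad2)
  then show ?thesis by simp
qed

lemma eps_pos: "eps n > 0"
  by simp

lemma Sreg_Ck_1:
  assumes "f \<in> L2 D"
  shows "Ck 1 (Sreg k n f)" "pd i (Sreg k n f) = dSreg k i n f"
  using Ck_conv[OF gker_Ck_1(1)[OF eps_pos] L2_integrable[OF assms]]
    pd_conv[OF gker_Ck_1(1)[OF eps_pos] L2_integrable[OF assms]] gker_Ck_1(2)[OF eps_pos] by metis+

lemma Sreg_L2:
  assumes "f \<in> L2 D"
  shows "Sreg k n f \<in> L2 D" "dSreg k i n f \<in> L2 D"
  by (intro continuous_L2 continuous_conv gker_continuous eps_pos L2_integrable assms)+

lemma S_L2:
  assumes "f \<in> L2 D"
  shows "S k f \<in> L2 D" "n2 (\<lambda>x. Sreg k n f x - S k f x) \<le> sqrt (gker_err k (2 * rad) n) * n2 f * n2 (\<lambda>_. 1)"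
proof -
  have mS[measurable]: "Sreg k n f \<in> borel_measurable M" for n
    using Sreg_L2[OF assms] by (simp add: L2_def)
  have m[measurable]: "S k f \<in> borel_measurable M"
  proof (rule borel_measurable_LIMSEQ_metric)
    fix x assume "x \<in> space M"
    then have x: "norm x \<le> rad" using norm_less_rad by (simp add: less_imp_le)
    have "(\<lambda>n. Sreg k n f x - S k f x) \<longlonglongrightarrow> 0"
      by (rule Lim_null_comparison[OF always_eventually[OF allI] gker_err_tendsto]) (rule Sreg_uniform[OF assms x])
    then show "(\<lambda>n. Sreg k n f x) \<longlonglongrightarrow> S k f x" by (simp only: LIM_zero_iff)
  qed (rule mS)
  have b: "norm (Sreg k n f x - S k f x) \<le> sqrt (gker_err k (2 * rad) n) * n2 f" if "x \<in> D" for n x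
    using Sreg_uniform[OF assms] norm_less_rad[OF that] by simp
  have "gker_err k (2 * rad) n \<ge> 0" for n
    unfolding gker_err_def by (intro integral_nonneg_AE AE_I2) simp
  then show "n2 (\<lambda>x. Sreg k n f x - S k f x) \<le> sqrt (gker_err k (2 * rad) n) * n2 f * n2 (\<lambda>_. 1)"
    by (intro n2_sup b mult_nonneg_nonneg n2_nonneg borel_measurable_diff mS m) auto
  have "(\<lambda>x. Sreg k 0 f x - S k f x) \<in> L2 D"
    by (rule bounded_L2[OF _ b]) measurable
  from L2_diff[OF Sreg_L2(1)[OF assms, of k 0] this] show "S k f \<in> L2 D" by simp
qed

lemma dSreg_Cauchy:
  assumes "f \<in> L2 D"
  shows "n2 (\<lambda>x. dSreg k i m f x - dSreg k i n f x)
    \<le> (dgker_err k i (2 * rad) m + dgker_err k i (2 * rad) n) * n2 f"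
proof -
  let ?g = "\<lambda>n. dgker k i (eps n)"
  let ?I = "indicat_real (cball 0 (2 * rad)) :: real^3 \<Rightarrow> real"
  have c: "continuous_on UNIV (?g n)" for n by (rule gker_continuous(2)[OF eps_pos])
  have "(\<lambda>x. conv D (?g m) f x - conv D (?g n) f x) = conv D (\<lambda>z. ?g m z - ?g n z) f"
    using conv_kernel_diff[OF integrable_conv[OF c L2_integrable[OF assms]] integrable_conv[OF c L2_integrable[OF assms]]]
    by (simp add: fun_eq_iff)
  then have "n2 (\<lambda>x. conv D (?g m) f x - conv D (?g n) f x) \<le> (\<integral>z. ?I z * norm (?g m z - ?g n z) \<partial>lborel) * n2 f"
    using conv_L1_kernel[OF continuous_on_diff[OF c c] assms, of m n] by simp
  also have "\<dots> \<le> (dgker_err k i (2 * rad) m + dgker_err k i (2 * rad) n) * n2 f"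
  proof (rule mult_right_mono[OF _ n2_nonneg])
    note i = dgker_error(1)[OF rad2, of k i]
    have cn: "continuous_on UNIV (\<lambda>z. norm (?g m z - ?g n z))"
      by (intro continuous_intros c)
    have "(\<integral>z. ?I z * norm (?g m z - ?g n z) \<partial>lborel)
      \<le> (\<integral>z. ?I z * norm (?g m z - dgker k i 0 z) + ?I z * norm (?g n z - dgker k i 0 z) \<partial>lborel)"
    proof (rule integral_mono)
      show "integrable lborel (\<lambda>z. ?I z * norm (?g m z - ?g n z))"
        using borel_integrable_compact[of "cball 0 (2 * rad)" "\<lambda>z. norm (?g m z - ?g n z)"] continuous_on_subset[OF cn] by simp
      show "integrable lborel (\<lambda>z. ?I z * norm (?g m z - dgker k i 0 z) + ?I z * norm (?g n z - dgker k i 0 z))"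
        by (intro Bochner_Integration.integrable_add i)
      fix z
      have "norm (?g m z - ?g n z) \<le> norm (?g m z - dgker k i 0 z) + norm (?g n z - dgker k i 0 z)"
        using norm_triangle_ineq4[of "?g m z - dgker k i 0 z" "?g n z - dgker k i 0 z"] by simp
      then show "?I z * norm (?g m z - ?g n z) \<le> ?I z * norm (?g m z - dgker k i 0 z) + ?I z * norm (?g n z - dgker k i 0 z)"
        by (simp add: distrib_left[symmetric] mult_left_mono del: distrib_left)
    qed
    also have "\<dots> = dgker_err k i (2 * rad) m + dgker_err k i (2 * rad) n"
      unfolding dgker_err_def by (rule Bochner_Integration.integral_add[OF i i])
    finally show "(\<integral>z. ?I z * norm (?g m z - ?g n z) \<partial>lborel) \<le> dgker_err k i (2 * rad) m + dgker_err k i (2 * rad) n" .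
  qed
  finally show ?thesis .
qed

text \<open>The gradient of the potential is obtained as a limit in \<open>L2 D\<close> of the gradients of the regularised
  potentials. Its kernel is locally integrable but not locally square integrable, so the error is
  estimated by Young's inequality, in \<open>L2 D\<close> instead of uniformly.\<close>

lemma ex_dS:
  assumes "f \<in> L2 D"
  shows "\<exists>V\<in>L2 D. \<forall>n. n2 (\<lambda>x. dSreg k i n f x - V x) \<le> dgker_err k i (2 * rad) n * n2 f"
proof -
  let ?u = "\<lambda>n. dSreg k i n f"
  let ?b = "\<lambda>n. dgker_err k i (2 * rad) n * n2 f"
  have u: "?u n \<in> L2 D" for n by (rule Sreg_L2(2)[OF assms])
  have C: "n2 (\<lambda>x. ?u m x - ?u n x) \<le> ?b m + ?b n" for m n
    using dSreg_Cauchy[OF assms, of k i m n] by (simp only: distrib_right)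
  have "\<exists>V\<in>L2 D. (\<lambda>n. n2 (\<lambda>x. ?u n x - V x)) \<longlonglongrightarrow> 0"
  proof (rule L2_complete[OF u])
    fix e :: real assume "e > 0"
    then have "e / 2 > 0" by simp
    from LIMSEQ_D[OF dgker_err_tendsto[of k i "n2 f"] this]
    obtain N where N: "\<And>n. n \<ge> N \<Longrightarrow> norm (?b n - 0) < e / 2" by blast
    have "n2 (\<lambda>x. ?u m x - ?u n x) \<le> e" if "m \<ge> N" "n \<ge> N" for m n
      using C[of m n] N[OF that(1)] N[OF that(2)] by simp
    then show "\<exists>N. \<forall>m\<ge>N. \<forall>n\<ge>N. n2 (\<lambda>x. ?u m x - ?u n x) \<le> e" by blast
  qed
  then obtain V where V: "V \<in> L2 D" "(\<lambda>n. n2 (\<lambda>x. ?u n x - V x)) \<longlonglongrightarrow> 0" by blast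
  have "n2 (\<lambda>x. ?u n x - V x) \<le> ?b n" for n
  proof (rule LIMSEQ_le_const)
    show "(\<lambda>m. ?b n + ?b m + n2 (\<lambda>x. ?u m x - V x)) \<longlonglongrightarrow> ?b n"
      using tendsto_add[OF tendsto_add[OF tendsto_const[of "?b n"] dgker_err_tendsto[of k i "n2 f"]] V(2)] by simp
    have "n2 (\<lambda>x. ?u n x - V x) \<le> ?b n + ?b m + n2 (\<lambda>x. ?u m x - V x)" for m
      using n2_triangle_diff[OF u[of n] u[of m] V(1)] C[of n m] by linarith
    then show "\<exists>N. \<forall>m\<ge>N. n2 (\<lambda>x. ?u n x - V x) \<le> ?b n + ?b m + n2 (\<lambda>x. ?u m x - V x)" by blast
  qed
  with V(1) show ?thesis by blast
qed

definition dS :: "real \<Rightarrow> 3 \<Rightarrow> (real^3 \<Rightarrow> complex) \<Rightarrow> real^3 \<Rightarrow> complex" where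
  "dS k i f = (SOME V. V \<in> L2 D \<and>
     (\<forall>n. n2 (\<lambda>x. dSreg k i n f x - V x) \<le> dgker_err k i (2 * rad) n * n2 f))"

lemma dS:
  assumes "f \<in> L2 D"
  shows "dS k i f \<in> L2 D"
    and "n2 (\<lambda>x. dSreg k i n f x - dS k i f x) \<le> dgker_err k i (2 * rad) n * n2 f"
proof -
  have "\<exists>V. V \<in> L2 D \<and>
     (\<forall>n. n2 (\<lambda>x. dSreg k i n f x - V x) \<le> dgker_err k i (2 * rad) n * n2 f)"
    using ex_dS[OF assms] by blast
  from someI_ex[OF this] have "dS k i f \<in> L2 D \<and>
     (\<forall>n. n2 (\<lambda>x. dSreg k i n f x - dS k i f x) \<le> dgker_err k i (2 * rad) n * n2 f)"
    unfolding dS_def .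
  then show "dS k i f \<in> L2 D"
    and "n2 (\<lambda>x. dSreg k i n f x - dS k i f x) \<le> dgker_err k i (2 * rad) n * n2 f"
    by blast+
qed

lemma is_weak_pd_S:
  assumes "f \<in> L2 D"
  shows "is_weak_pd D i (S k f) (dS k i f)"
proof (rule is_weak_pd_closed[OF Sreg_L2[OF assms] _ S_L2(1)[OF assms] dS(1)[OF assms]])
  show "is_weak_pd D i (Sreg k n f) (dSreg k i n f)" for n
    using classical_is_weak_pd[OF Sreg_Ck_1(1)[OF assms]] Sreg_Ck_1(2)[OF assms] by metis
  show "(\<lambda>n. n2 (\<lambda>x. Sreg k n f x - S k f x)) \<longlonglongrightarrow> 0"
  proof (rule Lim_null_comparison[OF always_eventually[OF allI]])
    show "norm (n2 (\<lambda>x. Sreg k n f x - S k f x)) \<le> sqrt (gker_err k (2 * rad) n) * (n2 f * n2 (\<lambda>_. 1))" for n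
      using S_L2(2)[OF assms] n2_nonneg by (simp add: mult.assoc)
  qed (rule gker_err_tendsto)
  show "(\<lambda>n. n2 (\<lambda>x. dSreg k i n f x - dS k i f x)) \<longlonglongrightarrow> 0"
  proof (rule Lim_null_comparison[OF always_eventually[OF allI]])
    show "norm (n2 (\<lambda>x. dSreg k i n f x - dS k i f x)) \<le> dgker_err k i (2 * rad) n * n2 f" for n
      using dS(2)[OF assms] n2_nonneg by simp
  qed (rule dgker_err_tendsto)
qed

section \<open>Compactness of the volume potential from \<open>L2\<close> to \<open>H1\<close>\<close>

text \<open>The Arzela-Ascoli theorem on a closed ball that contains \<open>D\<close>: the bound and the modulus of continuity come from
  the kernel, as the densities are bounded in \<open>L1\<close>.\<close>

lemma conv_bounded_sequence_subseq:
  assumes c: "continuous_on UNIV \<kappa>" and f: "\<And>n. f n \<in> L2 D" "\<And>n. n2 (f n) \<le> C"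
  shows "\<exists>r. strict_mono (r :: nat \<Rightarrow> nat) \<and>
    (\<forall>e>0. \<exists>N. \<forall>m\<ge>N. \<forall>l\<ge>N. \<forall>x\<in>D. norm (conv D \<kappa> (f (r m)) x - conv D \<kappa> (f (r l)) x) \<le> e)"
proof -
  define I where "I = n2 (\<lambda>_. 1) * C"
  have L1: "(\<integral>y. norm (f n y) \<partial>M) \<le> I" for n
    unfolding I_def using L1_le_n2[OF f(1)[of n]] mult_left_mono[OF f(2)[of n] n2_nonneg] by (rule order_trans)
  have I: "I \<ge> 0" using order_trans[OF _ L1[of 0]] by simp
  note i = L2_integrable[OF f(1)]
  obtain B where B: "B > 0" "\<And>z. norm z \<le> 2 * rad \<Longrightarrow> norm (\<kappa> z) \<le> B"
    using continuous_bounded_cball[OF c] by metis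
  have bound: "norm (conv D \<kappa> (f n) x) \<le> B * I" if "x \<in> cball 0 rad" for n x
  proof -
    have "norm (conv D \<kappa> (f n) x) \<le> B * (\<integral>y. norm (f n y) \<partial>M)"
      unfolding conv_def
    proof (rule norm_integral_le_mult[OF i integrable_conv[OF c i]])
      fix y assume y: "y \<in> D"
      have "norm (x - y) \<le> 2 * rad"
        using norm_triangle_ineq4[of x y] norm_less_rad[OF y] that by simp
      then show "norm (\<kappa> (x - y) * f n y) \<le> B * norm (f n y)"
        by (simp add: norm_mult mult_right_mono B)
    qed
    also have "\<dots> \<le> B * I" using L1 B by (intro mult_left_mono) auto
    finally show ?thesis .
  qed
  have equi: "\<exists>d. 0 < d \<and> (\<forall>n y. y \<in> cball 0 rad \<and> norm (x - y) < d \<longrightarrow> norm (conv D \<kappa> (f n) x - conv D \<kappa> (f n) y) < e)"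
    if x: "x \<in> cball 0 rad" and e: "0 < e" for x :: "real^3" and e :: real
  proof -
    have "e / (I + 1) > 0" using e I by simp
    from continuous_kernel_modulus[OF c this, of rad] obtain d where d: "d > 0"
      "\<And>x x' y. norm x \<le> rad \<Longrightarrow> norm x' \<le> rad \<Longrightarrow> y \<in> D \<Longrightarrow> norm (x - x') < d \<Longrightarrow>
        norm (\<kappa> (x - y) - \<kappa> (x' - y)) \<le> e / (I + 1)" by metis
    have "norm (conv D \<kappa> (f n) x - conv D \<kappa> (f n) x') < e" if "x' \<in> cball 0 rad" "norm (x - x') < d" for n x'
    proof -
      have "norm (conv D \<kappa> (f n) x - conv D \<kappa> (f n) x') \<le> e / (I + 1) * (\<integral>y. norm (f n y) \<partial>M)"
        by (rule conv_modulus[OF c i]) (use d(2) that x in auto)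
      also have "\<dots> \<le> e / (I + 1) * I" using L1 e I by (intro mult_left_mono) auto
      also have "\<dots> < e" using e I by (simp add: field_simps)
      finally show ?thesis .
    qed
    with d(1) show ?thesis by blast
  qed
  from Arzela_Ascoli[OF compact_cball bound equi]
  obtain g r where r: "strict_mono (r :: nat \<Rightarrow> nat)"
    and lim: "\<And>e. 0 < e \<Longrightarrow> \<exists>N. \<forall>n x. n \<ge> N \<and> x \<in> cball 0 rad \<longrightarrow> norm (conv D \<kappa> (f (r n)) x - g x) < e"
    by metis
  have "\<exists>N. \<forall>m\<ge>N. \<forall>l\<ge>N. \<forall>x\<in>D. norm (conv D \<kappa> (f (r m)) x - conv D \<kappa> (f (r l)) x) \<le> e" if e: "e > 0" for e
  proof -
    obtain N where N: "\<And>n x. n \<ge> N \<Longrightarrow> x \<in> cball 0 rad \<Longrightarrow> norm (conv D \<kappa> (f (r n)) x - g x) < e / 2"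
      using lim[of "e / 2"] e by auto
    have "norm (conv D \<kappa> (f (r m)) x - conv D \<kappa> (f (r l)) x) \<le> e" if "m \<ge> N" "l \<ge> N" "x \<in> D" for m l x
    proof -
      have "x \<in> cball 0 rad" using norm_less_rad[OF that(3)] by simp
      from N[OF that(1) this] N[OF that(2) this]
        norm_triangle_ineq4[of "conv D \<kappa> (f (r m)) x - g x" "conv D \<kappa> (f (r l)) x - g x"]
      show ?thesis by simp
    qed
    then show ?thesis by blast
  qed
  with r show ?thesis by blast
qed

definition uniformly_Cauchy_D :: "(nat \<Rightarrow> real^3 \<Rightarrow> complex) \<Rightarrow> bool" where
  "uniformly_Cauchy_D u \<longleftrightarrow> (\<forall>e>0. \<exists>N. \<forall>m\<ge>N. \<forall>l\<ge>N. \<forall>x\<in>D. norm (u m x - u l x) \<le> e)"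

lemma uniformly_Cauchy_D_subseq:
  assumes "uniformly_Cauchy_D u" "strict_mono (r :: nat \<Rightarrow> nat)"
  shows "uniformly_Cauchy_D (\<lambda>n. u (r n))"
  unfolding uniformly_Cauchy_D_def
proof (intro allI impI)
  fix e :: real assume "e > 0"
  then obtain N where N: "\<forall>m\<ge>N. \<forall>l\<ge>N. \<forall>x\<in>D. norm (u m x - u l x) \<le> e"
    using assms(1) unfolding uniformly_Cauchy_D_def by blast
  have "n \<le> r n" for n by (rule seq_suble[OF assms(2)])
  then have "N \<le> r n" if "N \<le> n" for n using that order_trans by blast
  with N show "\<exists>N. \<forall>m\<ge>N. \<forall>l\<ge>N. \<forall>x\<in>D. norm (u (r m) x - u (r l) x) \<le> e" by blast
qed

lemma uniformly_Cauchy_D_shift: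
  assumes "uniformly_Cauchy_D (\<lambda>n. u (K + n))"
  shows "uniformly_Cauchy_D u"
  unfolding uniformly_Cauchy_D_def
proof (intro allI impI)
  fix e :: real assume "e > 0"
  then obtain N where N: "\<And>m l x. m \<ge> N \<Longrightarrow> l \<ge> N \<Longrightarrow> x \<in> D \<Longrightarrow> norm (u (K + m) x - u (K + l) x) \<le> e"
    using assms unfolding uniformly_Cauchy_D_def by blast
  have "norm (u m x - u l x) \<le> e" if "m \<ge> K + N" "l \<ge> K + N" "x \<in> D" for m l x
    using N[of "m - K" "l - K" x] that by simp
  then show "\<exists>N. \<forall>m\<ge>N. \<forall>l\<ge>N. \<forall>x\<in>D. norm (u m x - u l x) \<le> e" by blast
qed

text \<open>Countably many kernels and sequences are enumerated together, for a diagonal argument.\<close>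

lemma conv_family_subseq:
  fixes \<kappa> :: "'c::countable \<Rightarrow> real^3 \<Rightarrow> complex"
  assumes c: "\<And>a. continuous_on UNIV (\<kappa> a)"
    and f: "\<And>j n. f j n \<in> L2 D" "\<And>j n. n2 (f j n) \<le> C"
  shows "\<exists>r. strict_mono (r :: nat \<Rightarrow> nat) \<and> (\<forall>a (j::'j::countable). uniformly_Cauchy_D (\<lambda>n. conv D (\<kappa> a) (f j (r n))))"
proof -
  define P where "P n s = (case from_nat n of (a :: 'c, j :: 'j) \<Rightarrow> uniformly_Cauchy_D (\<lambda>l. conv D (\<kappa> a) (f j (s l))))"
    for n :: nat and s :: "nat \<Rightarrow> nat"
  interpret subseqs P
  proof
    fix n and s :: "nat \<Rightarrow> nat"
    obtain a j where aj: "(from_nat n :: 'c \<times> 'j) = (a, j)" by fastforce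
    show "\<exists>r'. strict_mono r' \<and> P n (s \<circ> r')"
      using conv_bounded_sequence_subseq[OF c[of a], of "\<lambda>l. f j (s l)" C, OF f]
      by (simp add: P_def aj uniformly_Cauchy_D_def)
  qed
  have stable: "P n (s \<circ> r)" if "strict_mono r" "P n s" for r s n
    using that uniformly_Cauchy_D_subseq[OF _ that(1)] by (auto simp: P_def split: prod.splits)
  have "uniformly_Cauchy_D (\<lambda>n. conv D (\<kappa> a) (f j (diagseq n)))" for a j
  proof -
    have "P (to_nat (a, j)) (diagseq \<circ> ((+) (Suc (to_nat (a, j)))))"
      by (rule diagseq_holds[OF stable])
    then have "uniformly_Cauchy_D (\<lambda>n. conv D (\<kappa> a) (f j (diagseq (Suc (to_nat (a, j)) + n))))"
      by (simp add: P_def)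
    then show ?thesis by (rule uniformly_Cauchy_D_shift)
  qed
  with subseq_diagseq show ?thesis by blast
qed

text \<open>An \<open>\<epsilon>/3\<close> argument: \<open>w\<close> is approximated by \<open>u m\<close> with an error that does not depend on the index of
  the sequence.\<close>

lemma n2_Cauchy_approx:
  assumes w: "\<And>n. w n \<in> L2 D" and u: "\<And>m n. u m n \<in> L2 D"
    and close: "\<And>m n. n2 (\<lambda>x. u m n x - w n x) \<le> b m" and b: "b \<longlonglongrightarrow> 0"
    and C: "\<And>m. uniformly_Cauchy_D (u m)" and e: "e > 0"
  shows "\<exists>N. \<forall>p\<ge>N. \<forall>l\<ge>N. n2 (\<lambda>x. w p x - w l x) \<le> e"
proof -
  define c where "c = n2 (\<lambda>_. 1)"
  have c: "c \<ge> 0" by (simp add: c_def n2_nonneg)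
  obtain m where m: "norm (b m - 0) < e / 3"
    using LIMSEQ_D[OF b, of "e / 3"] e by auto
  have "e / (3 * (c + 1)) > 0" using e c by simp
  then obtain N where N: "\<And>p l x. p \<ge> N \<Longrightarrow> l \<ge> N \<Longrightarrow> x \<in> D \<Longrightarrow> norm (u m p x - u m l x) \<le> e / (3 * (c + 1))"
    using C[of m] unfolding uniformly_Cauchy_D_def by blast
  have "n2 (\<lambda>x. w p x - w l x) \<le> e" if "p \<ge> N" "l \<ge> N" for p l
  proof -
    have "n2 (\<lambda>x. u m p x - u m l x) \<le> e / (3 * (c + 1)) * c"
      unfolding c_def
      by (rule n2_sup) (use N[unfolded c_def] that e c L2_measurable[OF L2_diff[OF u u]] in \<open>auto simp: c_def[symmetric]\<close>)
    also have "\<dots> \<le> e / 3" using e c by (simp add: field_simps)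
    finally have 1: "n2 (\<lambda>x. u m p x - u m l x) \<le> e / 3" .
    have "n2 (\<lambda>x. w p x - w l x) \<le> n2 (\<lambda>x. w p x - u m p x) + n2 (\<lambda>x. u m p x - w l x)"
      by (rule n2_triangle_diff[OF w u w])
    moreover have "n2 (\<lambda>x. u m p x - w l x) \<le> n2 (\<lambda>x. u m p x - u m l x) + n2 (\<lambda>x. u m l x - w l x)"
      by (rule n2_triangle_diff[OF u u w])
    moreover have "n2 (\<lambda>x. w p x - u m p x) \<le> b m"
      using close[of m p] by (simp add: n2_minus_commute)
    ultimately show ?thesis using 1 close[of m l] m by simp
  qed
  then show ?thesis by blast
qed

text \<open>Along one subsequence all regularised potentials and their gradients converge uniformly, by the
  Arzela-Ascoli theorem and a diagonal argument; the regularisation error is uniform over bounded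
  sets of densities.\<close>

lemma S_compact:
  assumes f: "\<And>j n. f j n \<in> L2 D" "\<And>j n. n2 (f j n) \<le> C"
  shows "\<exists>r. strict_mono (r :: nat \<Rightarrow> nat) \<and> (\<forall>(j::'j::countable) i e. e > 0 \<longrightarrow>
    (\<exists>N. \<forall>p\<ge>N. \<forall>l\<ge>N. n2 (\<lambda>x. S k (f j (r p)) x - S k (f j (r l)) x) \<le> e) \<and>
    (\<exists>N. \<forall>p\<ge>N. \<forall>l\<ge>N. n2 (\<lambda>x. dS k i (f j (r p)) x - dS k i (f j (r l)) x) \<le> e))"
proof -
  \<comment> \<open>\<open>None\<close> stands for the kernel itself, \<open>Some i\<close> for its \<open>i\<close>-th partial derivative.\<close>
  define \<kappa> where "\<kappa> a = (case a of (m, None) \<Rightarrow> gker k (eps m) | (m, Some i) \<Rightarrow> dgker k i (eps m))"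
    for a :: "nat \<times> 3 option"
  have c: "continuous_on UNIV (\<kappa> a)" for a
    unfolding \<kappa>_def using gker_continuous[OF eps_pos] by (auto split: prod.split option.split)
  obtain r where r: "strict_mono (r :: nat \<Rightarrow> nat)"
    and UC: "\<And>a (j::'j). uniformly_Cauchy_D (\<lambda>n. conv D (\<kappa> a) (f j (r n)))"
    using conv_family_subseq[of \<kappa> f C, OF c f] by blast
  have C0: "C \<ge> 0" using order_trans[OF n2_nonneg f(2)] .
  have 1: "\<exists>N. \<forall>p\<ge>N. \<forall>l\<ge>N. n2 (\<lambda>x. S k (f j (r p)) x - S k (f j (r l)) x) \<le> e" if "e > 0" for j and e :: real
  proof (rule n2_Cauchy_approx[where u = "\<lambda>m n. Sreg k m (f j (r n))"
        and b = "\<lambda>m. sqrt (gker_err k (2 * rad) m) * (C * n2 (\<lambda>_. 1))", OF S_L2(1)[OF f(1)] Sreg_L2(1)[OF f(1)] _ gker_err_tendsto _ that])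
    fix m n
    have "gker_err k (2 * rad) m \<ge> 0"
      unfolding gker_err_def by (intro integral_nonneg_AE AE_I2) simp
    then have "sqrt (gker_err k (2 * rad) m) * n2 (f j (r n)) * n2 (\<lambda>_. 1) \<le> sqrt (gker_err k (2 * rad) m) * C * n2 (\<lambda>_. 1)"
      by (intro mult_right_mono mult_left_mono f n2_nonneg) simp
    with S_L2(2)[OF f(1), of k m j "r n"]
    show "n2 (\<lambda>x. Sreg k m (f j (r n)) x - S k (f j (r n)) x) \<le> sqrt (gker_err k (2 * rad) m) * (C * n2 (\<lambda>_. 1))"
      by (simp add: mult.assoc)
    show "uniformly_Cauchy_D (\<lambda>n. Sreg k m (f j (r n)))"
      using UC[of "(m, None)" j] by (simp add: \<kappa>_def)
  qed
  have 2: "\<exists>N. \<forall>p\<ge>N. \<forall>l\<ge>N. n2 (\<lambda>x. dS k i (f j (r p)) x - dS k i (f j (r l)) x) \<le> e" if "e > 0" for j i and e :: real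
  proof (rule n2_Cauchy_approx[where u = "\<lambda>m n. dSreg k i m (f j (r n))"
        and b = "\<lambda>m. dgker_err k i (2 * rad) m * C", OF dS(1)[OF f(1)] Sreg_L2(2)[OF f(1)] _ dgker_err_tendsto _ that])
    fix m n
    have "dgker_err k i (2 * rad) m \<ge> 0"
      unfolding dgker_err_def by (intro integral_nonneg_AE AE_I2) simp
    then have "dgker_err k i (2 * rad) m * n2 (f j (r n)) \<le> dgker_err k i (2 * rad) m * C"
      by (intro mult_left_mono f) simp
    with dS(2)[OF f(1), of k i m j "r n"]
    show "n2 (\<lambda>x. dSreg k i m (f j (r n)) x - dS k i (f j (r n)) x) \<le> dgker_err k i (2 * rad) m * C"
      by simp
    show "uniformly_Cauchy_D (\<lambda>n. dSreg k i m (f j (r n)))"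
      using UC[of "(m, Some i)" j] by (simp add: \<kappa>_def)
  qed
  from r 1 2 show ?thesis by blast
qed

end

section \<open>Multiplication by a coefficient that vanishes outside the domain\<close>

definition posq :: "real \<Rightarrow> real" where
  "posq s = (max 0 s)\<^sup>2"

lemma DERIV_posq: "(posq has_real_derivative 2 * max 0 s) (at s)"
proof -
  consider "s > 0" | "s < 0" | "s = 0" by linarith
  then show ?thesis
  proof cases
    case 1
    have "((\<lambda>s. s\<^sup>2) has_real_derivative 2 * max 0 s) (at s)"
      using 1 by (auto intro!: derivative_eq_intros)
    then show ?thesis
      by (rule has_field_derivative_transform_within_open[of _ _ _ "{0<..}"])
        (use 1 in \<open>auto simp: posq_def\<close>)
  next
    case 2
    have "((\<lambda>s. 0) has_real_derivative 2 * max 0 s) (at s)"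
      using 2 by simp
    then show ?thesis
      by (rule has_field_derivative_transform_within_open[of _ _ _ "{..<0}"])
        (use 2 in \<open>auto simp: posq_def\<close>)
  next
    case 3
    have "((\<lambda>h. posq h / h) \<longlongrightarrow> 0) (at 0)"
    proof (rule Lim_null_comparison)
      show "\<forall>\<^sub>F h in at 0. norm (posq h / h) \<le> \<bar>h\<bar>"
        by (rule always_eventually) (auto simp: posq_def power2_eq_square max_def)
      have "((\<lambda>h::real. \<bar>h\<bar>) \<longlongrightarrow> \<bar>0\<bar>) (at 0)" by (intro tendsto_intros)
      then show "((\<lambda>h::real. \<bar>h\<bar>) \<longlongrightarrow> 0) (at 0)" by simp
    qed
    then show ?thesis using 3 by (simp add: DERIV_def posq_def)
  qed
qed

text \<open>A continuously differentiable approximation of the identity that vanishes near 0 and has bounded slope. For \<open>t > \<epsilon>\<close> it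
  is \<open>sqrt (\<epsilon>\<^sup>2 + (t - \<epsilon>)\<^sup>2) - \<epsilon>\<close>, and it is extended to an odd function.\<close>

definition trunc :: "real \<Rightarrow> real \<Rightarrow> real" where
  "trunc \<epsilon> t = sqrt (\<epsilon>\<^sup>2 + posq (t - \<epsilon>)) - sqrt (\<epsilon>\<^sup>2 + posq (- t - \<epsilon>))"

definition trunc' :: "real \<Rightarrow> real \<Rightarrow> real" where
  "trunc' \<epsilon> t = max 0 (t - \<epsilon>) / sqrt (\<epsilon>\<^sup>2 + posq (t - \<epsilon>)) + max 0 (- t - \<epsilon>) / sqrt (\<epsilon>\<^sup>2 + posq (- t - \<epsilon>))"

lemma posq_nonneg: "posq s \<ge> 0"
  by (simp add: posq_def)

lemma DERIV_sqrt_posq: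
  assumes "\<epsilon> > 0"
  shows "((\<lambda>s. sqrt (\<epsilon>\<^sup>2 + posq s)) has_real_derivative max 0 s / sqrt (\<epsilon>\<^sup>2 + posq s)) (at s)"
proof -
  have "\<epsilon>\<^sup>2 + posq s > 0" using assms posq_nonneg by (simp add: add_pos_nonneg)
  then show ?thesis
    by (auto intro!: derivative_eq_intros DERIV_posq simp: field_simps)
qed

lemma DERIV_trunc:
  assumes "\<epsilon> > 0"
  shows "(trunc \<epsilon> has_real_derivative trunc' \<epsilon> t) (at t)"
proof -
  have 1: "((\<lambda>t. t - \<epsilon>) has_real_derivative 1) (at t)" "((\<lambda>t. - t - \<epsilon>) has_real_derivative - 1) (at t)"
    by (auto intro!: derivative_eq_intros)
  from DERIV_diff[OF DERIV_chain2[OF DERIV_sqrt_posq[OF assms] 1(1)] DERIV_chain2[OF DERIV_sqrt_posq[OF assms] 1(2)]]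
  show ?thesis unfolding trunc_def[abs_def] trunc'_def by simp
qed

lemma trunc_zero: "\<bar>t\<bar> \<le> \<epsilon> \<Longrightarrow> trunc \<epsilon> t = 0"
  by (simp add: trunc_def posq_def)

lemma sqrt_posq_bound:
  assumes "\<epsilon> > 0"
  shows "\<bar>sqrt (\<epsilon>\<^sup>2 + posq s) - \<epsilon>\<bar> \<le> max 0 s"
proof -
  have "sqrt (\<epsilon>\<^sup>2 + posq s) \<le> sqrt (\<epsilon>\<^sup>2) + sqrt (posq s)"
    using posq_nonneg by (intro sqrt_add_le_add_sqrt) auto
  then have "sqrt (\<epsilon>\<^sup>2 + posq s) \<le> \<epsilon> + max 0 s" using assms by (simp add: posq_def)
  moreover have "\<epsilon> \<le> sqrt (\<epsilon>\<^sup>2 + posq s)"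
    using posq_nonneg by (intro real_le_rsqrt) simp
  ultimately show ?thesis by simp
qed

lemma trunc_bound:
  assumes "\<epsilon> > 0"
  shows "\<bar>trunc \<epsilon> t\<bar> \<le> \<bar>t\<bar>"
  using sqrt_posq_bound[OF assms, of "t - \<epsilon>"] sqrt_posq_bound[OF assms, of "- t - \<epsilon>"] assms
  unfolding trunc_def by (auto simp: max_def abs_if split: if_splits)

lemma trunc'_bound:
  assumes "\<epsilon> > 0"
  shows "\<bar>trunc' \<epsilon> t\<bar> \<le> 2"
proof -
  have "max 0 s / sqrt (\<epsilon>\<^sup>2 + posq s) \<le> 1 \<and> 0 \<le> max 0 s / sqrt (\<epsilon>\<^sup>2 + posq s)" for s
  proof -
    have "max 0 s \<le> sqrt (\<epsilon>\<^sup>2 + posq s)" by (intro real_le_rsqrt) (simp add: posq_def)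
    moreover have "sqrt (\<epsilon>\<^sup>2 + posq s) > 0" using assms posq_nonneg by (simp add: add_pos_nonneg)
    ultimately show ?thesis by (simp add: divide_le_eq_1_pos)
  qed
  from this[of "t - \<epsilon>"] this[of "- t - \<epsilon>"] show ?thesis unfolding trunc'_def by linarith
qed

lemma continuous_trunc':
  assumes "\<epsilon> > 0"
  shows "continuous_on UNIV (trunc' \<epsilon>)"
proof -
  have "\<epsilon>\<^sup>2 + (max 0 s)\<^sup>2 \<noteq> 0" for s
    using assms by (metis add_pos_nonneg less_irrefl zero_le_power2 zero_less_power)
  then show ?thesis
    unfolding trunc'_def[abs_def] posq_def by (intro continuous_intros) auto
qed

lemma trunc_tendsto:
  shows "(\<lambda>n. trunc (eps n) t) \<longlonglongrightarrow> t"
    and "(\<lambda>n. trunc' (eps n) t) \<longlonglongrightarrow> (if t = 0 then 0 else 1)"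
proof -
  have e: "(\<lambda>n. eps n) \<longlonglongrightarrow> 0" by real_asymp
  have p: "(\<lambda>n. (eps n)\<^sup>2 + posq (s - eps n)) \<longlonglongrightarrow> 0\<^sup>2 + (max 0 (s - 0))\<^sup>2" for s
    unfolding posq_def by (intro tendsto_intros e)
  have "(\<lambda>n. trunc (eps n) t) \<longlonglongrightarrow> sqrt (0\<^sup>2 + (max 0 (t - 0))\<^sup>2) - sqrt (0\<^sup>2 + (max 0 (- t - 0))\<^sup>2)"
    unfolding trunc_def by (intro tendsto_diff tendsto_real_sqrt p)
  also have "sqrt (0\<^sup>2 + (max 0 (t - 0))\<^sup>2) - sqrt (0\<^sup>2 + (max 0 (- t - 0))\<^sup>2) = t"
    by (simp add: max_def)
  finally show "(\<lambda>n. trunc (eps n) t) \<longlonglongrightarrow> t" .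
  have q: "(\<lambda>n. max 0 (s - eps n) / sqrt ((eps n)\<^sup>2 + posq (s - eps n)))
     \<longlonglongrightarrow> (if s > 0 then 1 else 0)" for s
  proof (cases "s > 0")
    case True
    have "(\<lambda>n. max 0 (s - eps n) / sqrt ((eps n)\<^sup>2 + posq (s - eps n)))
      \<longlonglongrightarrow> max 0 (s - 0) / sqrt (0\<^sup>2 + (max 0 (s - 0))\<^sup>2)"
      by (rule tendsto_divide[OF tendsto_max[OF tendsto_const tendsto_diff[OF tendsto_const e]] tendsto_real_sqrt[OF p]])
        (use True in simp)
    then show ?thesis using True by simp
  next
    case False
    have z: "max 0 (s - eps n) = 0" for n
    proof -
      have "eps n > 0" by simp
      with False have "s - eps n \<le> 0" by linarith
      then show ?thesis by (rule max_absorb1)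
    qed
    show ?thesis unfolding z using False by simp
  qed
  have "(\<lambda>n. trunc' (eps n) t) \<longlonglongrightarrow> (if t > 0 then 1 else 0) + (if - t > 0 then 1 else 0)"
    unfolding trunc'_def by (intro tendsto_add q)
  also have "(if t > 0 then 1 else 0) + (if - t > 0 then 1 else 0) = (if t = 0 then 0 else 1 :: real)" by auto
  finally show "(\<lambda>n. trunc' (eps n) t) \<longlonglongrightarrow> (if t = 0 then 0 else 1)" .
qed

context bounded_open
begin

text \<open>Testing with functions that need not vanish near the boundary expresses that the extension of \<open>w\<close> by zero is weakly
  differentiable on the whole space, with the extension of \<open>v\<close> by zero as its derivative.\<close>

definition ext_pd :: "3 \<Rightarrow> (real^3 \<Rightarrow> complex) \<Rightarrow> (real^3 \<Rightarrow> complex) \<Rightarrow> bool" where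
  "ext_pd i w v \<longleftrightarrow> (\<forall>\<phi>. Ck 1 \<phi> \<longrightarrow> (\<integral>x. w x * pd i \<phi> x \<partial>M) = - (\<integral>x. v x * \<phi> x \<partial>M))"

lemma ext_pd_is_weak_pd: "ext_pd i w v \<Longrightarrow> is_weak_pd D i w v"
  by (simp add: ext_pd_def is_weak_pd_def test_function_iff del: One_nat_def)

lemma ext_pd_linear:
  assumes "w \<in> L2 D" "w' \<in> L2 D" "v \<in> L2 D" "v' \<in> L2 D" "ext_pd i w v" "ext_pd i w' v'"
  shows "ext_pd i (\<lambda>x. c * w x + w' x) (\<lambda>x. c * v x + v' x)"
  unfolding ext_pd_def
proof (intro allI impI)
  fix \<phi> assume C: "Ck 1 \<phi>"
  note ct = Ck_imp_continuous[OF C] Ck_1_pd_continuous[OF C, of i]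
  note i = integrable_mult_continuous[OF L2_integrable]
  have "(\<integral>x. (c * w x + w' x) * pd i \<phi> x \<partial>M) = c * (\<integral>x. w x * pd i \<phi> x \<partial>M) + (\<integral>x. w' x * pd i \<phi> x \<partial>M)"
    using i[OF assms(1) ct(2)] i[OF assms(2) ct(2)] by (simp add: distrib_right mult.assoc)
  moreover have "(\<integral>x. (c * v x + v' x) * \<phi> x \<partial>M) = c * (\<integral>x. v x * \<phi> x \<partial>M) + (\<integral>x. v' x * \<phi> x \<partial>M)"
    using i[OF assms(3) ct(1)] i[OF assms(4) ct(1)] by (simp add: distrib_right mult.assoc)
  moreover have "(\<integral>x. w x * pd i \<phi> x \<partial>M) = - (\<integral>x. v x * \<phi> x \<partial>M)" "(\<integral>x. w' x * pd i \<phi> x \<partial>M) = - (\<integral>x. v' x * \<phi> x \<partial>M)"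
    using assms(5,6) C unfolding ext_pd_def by blast+
  ultimately show "(\<integral>x. (c * w x + w' x) * pd i \<phi> x \<partial>M) = - (\<integral>x. (c * v x + v' x) * \<phi> x \<partial>M)" by simp
qed

lemma ext_pd_zero: "ext_pd i (\<lambda>x. 0) (\<lambda>x. 0)"
  by (simp add: ext_pd_def)

lemma ext_pd_sum:
  assumes "finite A" "\<And>j. j \<in> A \<Longrightarrow> w j \<in> L2 D" "\<And>j. j \<in> A \<Longrightarrow> v j \<in> L2 D" "\<And>j. j \<in> A \<Longrightarrow> ext_pd i (w j) (v j)"
  shows "ext_pd i (\<lambda>x. \<Sum>j\<in>A. w j x) (\<lambda>x. \<Sum>j\<in>A. v j x)"
  using assms
proof (induction A rule: finite_induct)
  case (insert j A)
  have "ext_pd i (\<lambda>x. 1 * w j x + (\<Sum>j\<in>A. w j x)) (\<lambda>x. 1 * v j x + (\<Sum>j\<in>A. v j x))"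
    by (rule ext_pd_linear) (use insert in \<open>auto intro: L2_sum\<close>)
  then show ?case using insert.hyps by simp
qed (simp add: ext_pd_zero)

text \<open>The pointwise limit of the derivatives of the truncations of \<open>a\<close>: these vanish where \<open>a\<close> does.\<close>

definition supp_pd :: "3 \<Rightarrow> (real^3 \<Rightarrow> real) \<Rightarrow> real^3 \<Rightarrow> complex" where
  "supp_pd i a x = (if a x = 0 then 0 else pd i (\<lambda>x. of_real (a x)) x)"

lemma compose_Ck_1:
  assumes F: "\<And>t. (F has_real_derivative F' t) (at t)" and F': "continuous_on UNIV F'"
    and a: "Ck 1 (\<lambda>x. of_real (a x))"
  shows "Ck 1 (\<lambda>x. of_real (F (a x)))" "pd i (\<lambda>x. of_real (F (a x))) = (\<lambda>x. of_real (F' (a x)) * pd i (\<lambda>x. of_real (a x)) x)"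
proof -
  let ?a = "\<lambda>x. of_real (a x) :: complex"
  have ca: "continuous_on UNIV a"
    using continuous_on_Re[OF Ck_imp_continuous[OF a]] by simp
  have d: "((\<lambda>x. of_real (F (a x)) :: complex) has_derivative (\<lambda>h. of_real (F' (a x)) * frechet_derivative ?a (at x) h)) (at x)" for x
  proof -
    let ?D = "frechet_derivative ?a (at x)"
    have D: "(?a has_derivative ?D) (at x)"
      using a frechet_derivative_works by auto
    then have "((\<lambda>x. Re (?a x)) has_derivative (\<lambda>h. Re (?D h))) (at x)"
      by (rule bounded_linear.has_derivative[OF bounded_linear_Re])
    then have Da: "(a has_derivative (\<lambda>h. Re (?D h))) (at x)" by simp
    have "((\<lambda>x. Im (?a x)) has_derivative (\<lambda>h. Im (?D h))) (at x)"
      using D by (rule bounded_linear.has_derivative[OF bounded_linear_Im])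
    then have "(\<lambda>h. Im (?D h)) = (\<lambda>h. 0)"
      using has_derivative_unique[of "\<lambda>x. Im (?a x)" "\<lambda>h. Im (?D h)" x "\<lambda>h. 0"] by simp
    then have re: "?D h = of_real (Re (?D h))" for h
      by (simp add: complex_eq_iff fun_eq_iff)
    have "((\<lambda>x. F (a x)) has_derivative (\<lambda>h. F' (a x) * Re (?D h))) (at x)"
      using has_derivative_compose[OF Da F[unfolded has_field_derivative_def]] .
    from has_derivative_of_real[OF this, where 'a = complex] show ?thesis
      by (subst re) simp
  qed
  show pd: "pd i (\<lambda>x. of_real (F (a x))) = (\<lambda>x. of_real (F' (a x)) * pd i ?a x)" for i
    by (intro ext, subst pd_eqI[OF d]) (simp add: pd_def)
  have "(\<lambda>x. of_real (F (a x)) :: complex) differentiable (at x)" for x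
    unfolding differentiable_def by (rule exI) (rule d)
  moreover have "continuous_on UNIV (\<lambda>x. of_real (F' (a x)) * pd i ?a x)" for i
    by (intro continuous_intros continuous_on_compose2[OF F' ca] Ck_1_pd_continuous[OF a]) auto
  ultimately show "Ck 1 (\<lambda>x. of_real (F (a x)))" using pd by simp
qed

text \<open>The truncated coefficient times any test function is supported in a compact subset of \<open>D\<close>. The slopes of
  the truncations are bounded, so dominated convergence removes the truncation, and no boundary term appears.\<close>

lemma ext_pd_product_real:
  assumes a: "Ck 1 (\<lambda>x. of_real (a x))" and zero: "\<And>x. x \<notin> D \<Longrightarrow> a x = 0"
    and u: "u \<in> L2 D" "v \<in> L2 D" "is_weak_pd D i u v"
  shows "ext_pd i (\<lambda>x. of_real (a x) * u x) (\<lambda>x. supp_pd i a x * u x + of_real (a x) * v x)"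
  unfolding ext_pd_def
proof (intro allI impI)
  fix \<phi> assume \<phi>: "Ck 1 \<phi>"
  let ?a = "\<lambda>x. of_real (a x) :: complex"
  let ?e = "\<lambda>n. eps n"
  let ?A = "\<lambda>n x. of_real (trunc (?e n) (a x)) :: complex"
  let ?A' = "\<lambda>n x. of_real (trunc' (?e n) (a x)) * pd i ?a x"
  have e: "?e n > 0" for n by simp
  note A = compose_Ck_1[OF DERIV_trunc[OF e] continuous_trunc'[OF e] a]
  have c: "continuous_on UNIV \<phi>" "continuous_on UNIV (pd i \<phi>)" "continuous_on UNIV ?a" "continuous_on UNIV (pd i ?a)"
    using Ck_imp_continuous[OF \<phi>] Ck_1_pd_continuous[OF \<phi>] Ck_imp_continuous[OF a] Ck_1_pd_continuous[OF a] by auto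
  have cA: "continuous_on UNIV (?A n)" "continuous_on UNIV (?A' n)" for n
    using Ck_imp_continuous[OF A(1)] Ck_1_pd_continuous[OF A(1), of i] A(2)[of i] by metis+
  have ca: "continuous_on UNIV a"
    using continuous_on_Re[OF c(3)] by simp
  have supp: "csupp (\<lambda>x. ?A n x * \<phi> x)" for n
  proof (rule csuppI)
    show "closed {x. ?e n \<le> \<bar>a x\<bar>}"
      by (intro closed_Collect_le continuous_intros ca)
    show "{x. ?e n \<le> \<bar>a x\<bar>} \<subseteq> D"
    proof
      fix x assume "x \<in> {x. ?e n \<le> \<bar>a x\<bar>}"
      then have "a x \<noteq> 0" using e[of n] by auto
      then show "x \<in> D" using zero by blast
    qed
    show "?A n x * \<phi> x = 0" if "x \<notin> {x. ?e n \<le> \<bar>a x\<bar>}" for x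
      using that trunc_zero[of "a x" "?e n"] by simp
  qed
  note iu = integrable_mult_continuous[OF L2_integrable[OF u(1)]]
  note iv = integrable_mult_continuous[OF L2_integrable[OF u(2)]]
  have id: "(\<integral>x. u x * (?A n x * pd i \<phi> x) \<partial>M) = - ((\<integral>x. u x * (?A' n x * \<phi> x) \<partial>M) + (\<integral>x. v x * (?A n x * \<phi> x) \<partial>M))" for n
  proof -
    have "(\<integral>x. u x * pd i (\<lambda>x. ?A n x * \<phi> x) x \<partial>M) = - (\<integral>x. v x * (?A n x * \<phi> x) \<partial>M)"
      by (rule is_weak_pd_C1[OF u Ck_mult[OF A(1) \<phi>] supp])
    also have "pd i (\<lambda>x. ?A n x * \<phi> x) x = ?A n x * pd i \<phi> x + ?A' n x * \<phi> x" for x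
    proof -
      have "pd i (\<lambda>x. ?A n x * \<phi> x) x = ?A n x * pd i \<phi> x + pd i (?A n) x * \<phi> x"
        by (rule pd_mult) (use A(1)[of n] \<phi> in auto)
      then show ?thesis by (simp only: A(2))
    qed
    moreover have "(\<integral>x. u x * (?A n x * pd i \<phi> x + ?A' n x * \<phi> x) \<partial>M) =
      (\<integral>x. u x * (?A n x * pd i \<phi> x) \<partial>M) + (\<integral>x. u x * (?A' n x * \<phi> x) \<partial>M)"
      unfolding distrib_left
      by (rule Bochner_Integration.integral_add; rule iu; intro continuous_on_mult cA c)
    ultimately show ?thesis by (simp add: algebra_simps)
  qed
  have bA: "norm (?A n x) \<le> norm (?a x)" for n x
    using trunc_bound[OF e] by simp
  have bA': "norm (?A' n x) \<le> norm (2 * pd i ?a x)" for n x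
    unfolding norm_mult using trunc'_bound[OF e[of n], of "a x"] by (intro mult_right_mono) auto
  have limA: "(\<lambda>n. \<integral>x. u x * (?A n x * \<psi> x) \<partial>M) \<longlonglongrightarrow> (\<integral>x. u x * (?a x * \<psi> x) \<partial>M)"
    if u: "u \<in> L2 D" and \<psi>: "continuous_on UNIV \<psi>" for u \<psi>
  proof (rule integral_dominated_convergence[where w = "\<lambda>x. norm (u x * (?a x * \<psi> x))"])
    note i = integrable_mult_continuous[OF L2_integrable[OF u]]
    have ia: "integrable M (\<lambda>x. u x * (?a x * \<psi> x))" by (intro i continuous_on_mult c \<psi>)
    show "(\<lambda>x. u x * (?a x * \<psi> x)) \<in> borel_measurable M" by (rule borel_measurable_integrable[OF ia])
    show "integrable M (\<lambda>x. norm (u x * (?a x * \<psi> x)))" by (rule integrable_norm[OF ia])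
    show "(\<lambda>x. u x * (?A n x * \<psi> x)) \<in> borel_measurable M" for n
      by (intro borel_measurable_integrable i continuous_on_mult cA \<psi>)
    show "AE x in M. (\<lambda>n. u x * (?A n x * \<psi> x)) \<longlonglongrightarrow> u x * (?a x * \<psi> x)"
      by (intro AE_I2 tendsto_intros trunc_tendsto)
    show "AE x in M. norm (u x * (?A n x * \<psi> x)) \<le> norm (u x * (?a x * \<psi> x))" for n
      unfolding norm_mult by (intro AE_I2 mult_left_mono mult_right_mono bA) auto
  qed
  note lim1 = limA[OF u(1) c(2)] and lim2 = limA[OF u(2) c(1)]
  have t': "(\<lambda>n. ?A' n x) \<longlonglongrightarrow> supp_pd i a x" for x
  proof -
    have "(\<lambda>n. ?A' n x) \<longlonglongrightarrow> of_real (if a x = 0 then 0 else 1) * pd i ?a x"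
      by (intro tendsto_intros trunc_tendsto)
    then show ?thesis by (simp add: supp_pd_def split: if_splits)
  qed
  have lim3: "(\<lambda>n. \<integral>x. u x * (?A' n x * \<phi> x) \<partial>M) \<longlonglongrightarrow> (\<integral>x. u x * (supp_pd i a x * \<phi> x) \<partial>M)"
    and int3: "integrable M (\<lambda>x. u x * (supp_pd i a x * \<phi> x))"
  proof -
    let ?w = "\<lambda>x. norm (u x * ((2 * pd i ?a x) * \<phi> x))"
    have m: "(\<lambda>x. u x * (?A' n x * \<phi> x)) \<in> borel_measurable M" for n
      by (intro borel_measurable_integrable iu continuous_on_mult c cA)
    have t: "AE x in M. (\<lambda>n. u x * (?A' n x * \<phi> x)) \<longlonglongrightarrow> u x * (supp_pd i a x * \<phi> x)"
      by (intro AE_I2 tendsto_mult tendsto_const t')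
    have m': "(\<lambda>x. u x * (supp_pd i a x * \<phi> x)) \<in> borel_measurable M"
      by (rule borel_measurable_LIMSEQ_metric[where f = "\<lambda>n x. u x * (?A' n x * \<phi> x)", OF m])
        (intro tendsto_mult tendsto_const t')
    have w: "integrable M ?w"
      by (intro integrable_norm iu continuous_on_mult c continuous_on_const)
    have b: "AE x in M. norm (u x * (?A' n x * \<phi> x)) \<le> ?w x" for n
      unfolding norm_mult[of "u _"] norm_mult[of _ "\<phi> _"]
      by (intro AE_I2 mult_left_mono mult_right_mono bA') auto
    show "(\<lambda>n. \<integral>x. u x * (?A' n x * \<phi> x) \<partial>M) \<longlonglongrightarrow> (\<integral>x. u x * (supp_pd i a x * \<phi> x) \<partial>M)"
      by (rule integral_dominated_convergence[OF m' m w t b])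
    show "integrable M (\<lambda>x. u x * (supp_pd i a x * \<phi> x))"
      by (rule integrable_dominated_convergence[OF m' m w t b])
  qed
  have "(\<integral>x. u x * (?a x * pd i \<phi> x) \<partial>M) = - ((\<integral>x. u x * (supp_pd i a x * \<phi> x) \<partial>M) + (\<integral>x. v x * (?a x * \<phi> x) \<partial>M))"
    using lim1 tendsto_minus[OF tendsto_add[OF lim3 lim2]] unfolding id by (rule LIMSEQ_unique)
  also have "(\<integral>x. u x * (supp_pd i a x * \<phi> x) \<partial>M) + (\<integral>x. v x * (?a x * \<phi> x) \<partial>M) =
    (\<integral>x. u x * (supp_pd i a x * \<phi> x) + v x * (?a x * \<phi> x) \<partial>M)"
    by (rule Bochner_Integration.integral_add[symmetric, OF int3]) (intro iv continuous_on_mult c)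
  also have "(\<lambda>x. u x * (supp_pd i a x * \<phi> x) + v x * (?a x * \<phi> x)) = (\<lambda>x. (supp_pd i a x * u x + ?a x * v x) * \<phi> x)"
    by (simp add: fun_eq_iff algebra_simps)
  also have "(\<lambda>x. u x * (?a x * pd i \<phi> x)) = (\<lambda>x. (?a x * u x) * pd i \<phi> x)"
    by (simp add: fun_eq_iff algebra_simps)
  finally show "(\<integral>x. (?a x * u x) * pd i \<phi> x \<partial>M) = - (\<integral>x. (supp_pd i a x * u x + ?a x * v x) * \<phi> x \<partial>M)" .
qed

lemma supp_pd_bounded:
  assumes a: "Ck 1 (\<lambda>x. of_real (a x))"
  shows "supp_pd i a \<in> borel_measurable M" "\<exists>B. \<forall>x\<in>D. norm (supp_pd i a x) \<le> B"
proof -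
  let ?a = "\<lambda>x. of_real (a x) :: complex"
  note c = Ck_imp_continuous[OF a] Ck_1_pd_continuous[OF a, of i]
  have "continuous_on UNIV a" using continuous_on_Re[OF c(1)] by simp
  then have [measurable]: "a \<in> borel_measurable borel" "pd i ?a \<in> borel_measurable borel"
    using c by (auto intro: borel_measurable_continuous_onI)
  have "supp_pd i a \<in> borel_measurable borel" unfolding supp_pd_def[abs_def] by measurable
  then show "supp_pd i a \<in> borel_measurable M" by (rule borel_measurable_M)
  obtain B where B: "B > 0" "\<And>z. norm z \<le> rad \<Longrightarrow> norm (pd i ?a z) \<le> B"
    using continuous_bounded_cball[OF c(2)] by metis
  then have "\<forall>x\<in>D. norm (supp_pd i a x) \<le> B"
    using norm_less_rad by (auto simp: supp_pd_def less_imp_le)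
  then show "\<exists>B. \<forall>x\<in>D. norm (supp_pd i a x) \<le> B" by blast
qed

lemma Ck_1_bounded_linear:
  fixes L :: "complex \<Rightarrow> real"
  assumes q: "Ck 1 q" and L: "bounded_linear L"
  shows "Ck 1 (\<lambda>x. of_real (L (q x)))"
proof -
  have d: "((\<lambda>x. of_real (L (q x)) :: complex) has_derivative (\<lambda>h. of_real (L (frechet_derivative q (at x) h)))) (at x)" for x
  proof -
    have "(q has_derivative frechet_derivative q (at x)) (at x)"
      using q frechet_derivative_works by auto
    from has_derivative_of_real[OF bounded_linear.has_derivative[OF L this]] show ?thesis .
  qed
  have pd: "pd i (\<lambda>x. of_real (L (q x))) = (\<lambda>x. of_real (L (pd i q x)))" for i
    by (intro ext, subst pd_eqI[OF d]) (simp add: pd_def)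
  have "(\<lambda>x. of_real (L (q x)) :: complex) differentiable (at x)" for x
    unfolding differentiable_def by (rule exI) (rule d)
  moreover have "continuous_on UNIV (\<lambda>x. of_real (L (pd i q x)) :: complex)" for i
    by (intro continuous_on_of_real bounded_linear.continuous_on[OF L] Ck_1_pd_continuous[OF q])
  ultimately show ?thesis using pd by simp
qed

text \<open>The real and imaginary parts of the coefficient are truncated separately.\<close>

lemma ext_pd_product:
  assumes q: "Ck 1 q" and zero: "\<And>x. x \<notin> D \<Longrightarrow> q x = 0"
  shows "\<exists>d B. d \<in> borel_measurable M \<and> (\<forall>x\<in>D. norm (d x) \<le> B) \<and>
    (\<forall>u\<in>L2 D. \<forall>v\<in>L2 D. is_weak_pd D i u v \<longrightarrow> ext_pd i (\<lambda>x. q x * u x) (\<lambda>x. d x * u x + q x * v x))"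
proof -
  let ?a = "\<lambda>x. Re (q x)" and ?b = "\<lambda>x. Im (q x)"
  note a = Ck_1_bounded_linear[OF q bounded_linear_Re]
  note b = Ck_1_bounded_linear[OF q bounded_linear_Im]
  define d where "d x = \<i> * supp_pd i ?b x + supp_pd i ?a x" for x
  have [measurable]: "supp_pd i ?a \<in> borel_measurable M" "supp_pd i ?b \<in> borel_measurable M"
    using supp_pd_bounded(1) a b by auto
  have m: "d \<in> borel_measurable M" unfolding d_def[abs_def] by measurable
  obtain Ba Bb where B: "\<And>x. x \<in> D \<Longrightarrow> norm (supp_pd i ?a x) \<le> Ba" "\<And>x. x \<in> D \<Longrightarrow> norm (supp_pd i ?b x) \<le> Bb"
    using supp_pd_bounded(2)[OF a, of i] supp_pd_bounded(2)[OF b, of i] by blast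
  have "norm (d x) \<le> Bb + Ba" if "x \<in> D" for x
    unfolding d_def using B[OF that] by (intro norm_triangle_mono) (auto simp: norm_mult)
  then have bd: "\<forall>x\<in>D. norm (d x) \<le> Bb + Ba" by blast
  have "ext_pd i (\<lambda>x. q x * u x) (\<lambda>x. d x * u x + q x * v x)"
    if u: "u \<in> L2 D" "v \<in> L2 D" "is_weak_pd D i u v" for u v
  proof -
    note L = L2_continuous_mult[OF Ck_imp_continuous[OF a]] L2_continuous_mult[OF Ck_imp_continuous[OF b]]
    have "ext_pd i (\<lambda>x. \<i> * (of_real (?b x) * u x) + of_real (?a x) * u x)
      (\<lambda>x. \<i> * (supp_pd i ?b x * u x + of_real (?b x) * v x) + (supp_pd i ?a x * u x + of_real (?a x) * v x))"
    proof (rule ext_pd_linear)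
      show "(\<lambda>x. supp_pd i ?b x * u x + of_real (?b x) * v x) \<in> L2 D"
        by (intro L2_add L u L2_bounded_mult[OF supp_pd_bounded(1)[OF b] B(2)])
      show "(\<lambda>x. supp_pd i ?a x * u x + of_real (?a x) * v x) \<in> L2 D"
        by (intro L2_add L u L2_bounded_mult[OF supp_pd_bounded(1)[OF a] B(1)])
      show "ext_pd i (\<lambda>x. of_real (?b x) * u x) (\<lambda>x. supp_pd i ?b x * u x + of_real (?b x) * v x)"
        by (rule ext_pd_product_real[OF b _ u]) (simp add: zero)
      show "ext_pd i (\<lambda>x. of_real (?a x) * u x) (\<lambda>x. supp_pd i ?a x * u x + of_real (?a x) * v x)"
        by (rule ext_pd_product_real[OF a _ u]) (simp add: zero)
    qed (intro L u)+
    moreover have "\<i> * (of_real (?b x) * u x) + of_real (?a x) * u x = q x * u x" for x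
      by (subst complex_eq[of "q x"]) (simp add: algebra_simps)
    moreover have "\<i> * (supp_pd i ?b x * u x + of_real (?b x) * v x) + (supp_pd i ?a x * u x + of_real (?a x) * v x)
      = d x * u x + q x * v x" for x
    proof -
      have "\<i> * (supp_pd i ?b x * u x + of_real (?b x) * v x) + (supp_pd i ?a x * u x + of_real (?a x) * v x)
        = d x * u x + (of_real (?a x) + \<i> * of_real (?b x)) * v x"
        unfolding d_def by (simp add: algebra_simps)
      then show ?thesis by (simp only: complex_eq[symmetric])
    qed
    ultimately show ?thesis by simp
  qed
  with m bd show ?thesis by blast
qed

section \<open>Classical differentiability of the potential\<close>

text \<open>For the regularised kernels the derivative is moved to the density by definition of \<open>ext_pd\<close>. Both the potentials
  and the derivatives so obtained are convolutions with the locally square integrable kernel, hence converge uniformly.\<close>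

lemma S_has_gradient:
  assumes w: "w \<in> L2 D" and v: "\<And>i. v i \<in> L2 D" and e: "\<And>i. ext_pd i w (v i)" and x: "x \<in> D"
  shows "S k w differentiable (at x)" "pd i (S k w) x = S k (v i) x"
proof -
  let ?B = "ball (0::real^3) rad"
  have pd_reg: "pd i (Sreg k n w) x = Sreg k n (v i) x" for i n x
  proof -
    let ?g = "gker k (eps n)"
    have C: "Ck 1 ?g" by (rule gker_Ck_1(1)[OF eps_pos])
    have "pd i (Sreg k n w) x = (\<integral>y. pd i ?g (x - y) * w y \<partial>M)"
      by (simp only: pd_conv[OF C L2_integrable[OF w]] conv_def)
    also have "\<dots> = - (\<integral>y. w y * pd i (\<lambda>y. ?g (x - y)) y \<partial>M)"
    proof -
      have "pd i (\<lambda>y. ?g (x - y)) y = - pd i ?g (x - y)" for y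
        using C by (intro pd_reflect) simp
      then show ?thesis by (simp add: mult.commute)
    qed
    also have "\<dots> = (\<integral>y. v i y * ?g (x - y) \<partial>M)"
      using e[of i] Ck_reflect[OF C, of x] unfolding ext_pd_def by simp
    finally show ?thesis by (simp add: conv_def mult.commute)
  qed
  let ?f' = "\<lambda>n x h. \<Sum>i\<in>UNIV. of_real (h $ i) * Sreg k n (v i) x"
  let ?g' = "\<lambda>x h. \<Sum>i\<in>UNIV. of_real (h $ i) * S k (v i) x"
  have lim: "(\<lambda>n. Sreg k n w y) \<longlonglongrightarrow> S k w y" if "y \<in> ?B" for y
  proof -
    have "(\<lambda>n. Sreg k n w y - S k w y) \<longlonglongrightarrow> 0"
    proof (rule Lim_null_comparison[OF always_eventually[OF allI] gker_err_tendsto])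
      show "norm (Sreg k n w y - S k w y) \<le> sqrt (gker_err k (2 * rad) n) * n2 w" for n
        using that by (intro Sreg_uniform w) auto
    qed
    then show ?thesis by (simp only: LIM_zero_iff)
  qed
  have "\<exists>g. \<forall>y\<in>?B. (\<lambda>n. Sreg k n w y) \<longlonglongrightarrow> g y \<and> (g has_derivative ?g' y) (at y within ?B)"
  proof (rule has_derivative_sequence)
    show "convex ?B" by simp
    show "0 \<in> ?B" using rad by simp
    then show "(\<lambda>n. Sreg k n w 0) \<longlonglongrightarrow> S k w 0" by (rule lim)
    show "(Sreg k n w has_derivative ?f' n y) (at y within ?B)" for n y
    proof -
      have "Sreg k n w differentiable (at y)" using Sreg_Ck_1(1)[OF w, of k n] by simp
      from has_derivative_pd[OF this] show ?thesis
        unfolding pd_reg by (rule has_derivative_at_withinI)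
    qed
    fix \<epsilon> :: real assume "\<epsilon> > 0"
    define N where "N = (\<Sum>i\<in>(UNIV::3 set). n2 (v i))"
    from order_tendstoD(2)[OF gker_err_tendsto[of k N] \<open>\<epsilon> > 0\<close>]
    show "\<forall>\<^sub>F n in sequentially. \<forall>y\<in>?B. \<forall>h. norm (?f' n y h - ?g' y h) \<le> \<epsilon> * norm h"
    proof (rule eventually_mono, intro ballI allI)
      fix n y and h :: "real^3" assume small: "sqrt (gker_err k (2 * rad) n) * N < \<epsilon>" and y: "y \<in> ?B"
      have "norm (?f' n y h - ?g' y h) = norm (\<Sum>i\<in>UNIV. of_real (h $ i) * (Sreg k n (v i) y - S k (v i) y))"
        by (simp add: sum_subtractf right_diff_distrib)
      also have "\<dots> \<le> (\<Sum>i\<in>UNIV. norm h * (sqrt (gker_err k (2 * rad) n) * n2 (v i)))"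
      proof (intro order_trans[OF norm_sum] sum_mono)
        fix i
        show "norm (of_real (h $ i) * (Sreg k n (v i) y - S k (v i) y)) \<le> norm h * (sqrt (gker_err k (2 * rad) n) * n2 (v i))"
          unfolding norm_mult
          by (rule mult_mono) (use component_le_norm_cart[of h i] Sreg_uniform[OF v] y in auto)
      qed
      also have "\<dots> = (sqrt (gker_err k (2 * rad) n) * N) * norm h"
        by (simp add: N_def sum_distrib_left sum_distrib_right mult.commute mult.left_commute)
      also have "\<dots> \<le> \<epsilon> * norm h" using small by (intro mult_right_mono) auto
      finally show "norm (?f' n y h - ?g' y h) \<le> \<epsilon> * norm h" .
    qed
  qed
  then obtain g where g: "\<And>y. y \<in> ?B \<Longrightarrow> (\<lambda>n. Sreg k n w y) \<longlonglongrightarrow> g y"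
    "\<And>y. y \<in> ?B \<Longrightarrow> (g has_derivative ?g' y) (at y within ?B)" by blast
  have eq: "g y = S k w y" if "y \<in> ?B" for y
    using LIMSEQ_unique[OF g(1)[OF that] lim[OF that]] .
  have xB: "x \<in> ?B" using norm_less_rad[OF x] by simp
  have "(g has_derivative ?g' x) (at x)"
    using g(2)[OF xB] at_within_open[OF xB open_ball] by simp
  then have d: "(S k w has_derivative ?g' x) (at x)"
    by (rule has_derivative_transform_within_open[OF _ open_ball xB]) (rule eq)
  show "S k w differentiable (at x)"
    unfolding differentiable_def by (rule exI) (rule d)
  have "pd i (S k w) x = (\<Sum>j\<in>UNIV. of_real (axis i 1 $ j) * S k (v j) x)"
    by (rule pd_eqI[OF d])
  also have "\<dots> = (\<Sum>j\<in>UNIV. if j = i then S k (v i) x else 0)"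
    by (rule sum.cong) (auto simp: axis_def)
  finally show "pd i (S k w) x = S k (v i) x" by simp
qed

end

section \<open>The integral operator of the scattering problem\<close>

lemma bounded_linear_axis: "bounded_linear (axis i :: complex \<Rightarrow> complex^3)"
  by (rule linear_conv_bounded_linear[THEN iffD1]) (auto simp: linear_iff vec_eq_iff axis_def)

lemma vec_eq_sum_axis: "F = (\<Sum>i\<in>UNIV. axis i (F $ i :: complex) :: complex^3)"
proof -
  have "(\<Sum>i\<in>UNIV. axis i (F $ i) $ j) = (\<Sum>i\<in>UNIV. if i = j then F $ j else 0)" for j :: 3
    by (rule sum.cong) (auto simp: axis_def)
  then show ?thesis by (simp add: vec_eq_iff)
qed

lemma integrable_vec:
  fixes F :: "'a \<Rightarrow> complex^3"
  assumes "\<And>i. integrable N (\<lambda>y. F y $ i)"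
  shows "integrable N F"
proof -
  have "integrable N (\<lambda>y. \<Sum>i\<in>UNIV. axis i (F y $ i))"
    by (intro Bochner_Integration.integrable_sum integrable_bounded_linear[OF bounded_linear_axis] assms)
  then show ?thesis by (simp only: vec_eq_sum_axis[symmetric])
qed

lemma integral_vec_nth:
  fixes F :: "'a \<Rightarrow> complex^3"
  assumes "\<And>i. integrable N (\<lambda>y. F y $ i)"
  shows "(\<integral>y. F y \<partial>N) $ i = (\<integral>y. F y $ i \<partial>N)"
  by (rule integral_bounded_linear[OF bounded_linear_vec_nth integrable_vec[OF assms], symmetric])

context bounded_open
begin

lemma L2_cong:
  assumes "u \<in> L2 D" "\<And>x. x \<in> D \<Longrightarrow> u x = v x"
  shows "v \<in> L2 D"
proof -
  have "v \<in> borel_measurable M \<longleftrightarrow> u \<in> borel_measurable M"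
    by (rule measurable_cong) (simp add: assms)
  moreover have "integrable M (\<lambda>x. (norm (v x))\<^sup>2) \<longleftrightarrow> integrable M (\<lambda>x. (norm (u x))\<^sup>2)"
    by (rule Bochner_Integration.integrable_cong) (auto simp: assms)
  ultimately show ?thesis using assms(1) by (simp add: L2_def)
qed

lemma is_weak_pd_cong:
  assumes "is_weak_pd D i u w" "\<And>x. x \<in> D \<Longrightarrow> u x = v x"
  shows "is_weak_pd D i v w"
  unfolding is_weak_pd_def
proof (intro allI impI)
  fix \<phi> assume t: "test_function D \<phi>"
  have "(\<integral>x. v x * pd i \<phi> x \<partial>M) = (\<integral>x. u x * pd i \<phi> x \<partial>M)"
    by (rule Bochner_Integration.integral_cong) (auto simp: assms)
  then show "(\<integral>x. v x * pd i \<phi> x \<partial>M) = - (\<integral>x. w x * \<phi> x \<partial>M)"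
    using is_weak_pdD[OF assms(1) t] by simp
qed

lemma n2_cong_D: "(\<And>x. x \<in> D \<Longrightarrow> u x = v x) \<Longrightarrow> n2 u = n2 v"
  unfolding n2_def by (intro arg_cong[where f = sqrt] Bochner_Integration.integral_cong) auto

lemma H1_vec_norm_eq:
  "H1_vec_norm D E = sqrt (\<Sum>j\<in>UNIV. (n2 (\<lambda>x. E x $ j))\<^sup>2 + (\<Sum>i\<in>UNIV. (n2 (weak_pd D i (\<lambda>y. E y $ j)))\<^sup>2))"
  by (simp only: H1_vec_norm_def n2_square)

lemma n2_le_H1_vec_norm:
  "n2 (\<lambda>x. E x $ j) \<le> H1_vec_norm D E" "n2 (weak_pd D i (\<lambda>y. E y $ j)) \<le> H1_vec_norm D E"
proof -
  let ?s = "\<lambda>j. (n2 (\<lambda>x. E x $ j))\<^sup>2 + (\<Sum>i\<in>UNIV. (n2 (weak_pd D i (\<lambda>y. E y $ j)))\<^sup>2)"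
  have s: "?s j \<le> (\<Sum>j\<in>UNIV. ?s j)"
    by (rule member_le_sum) (auto intro!: add_nonneg_nonneg sum_nonneg)
  have i: "(n2 (weak_pd D i (\<lambda>y. E y $ j)))\<^sup>2 \<le> (\<Sum>i\<in>UNIV. (n2 (weak_pd D i (\<lambda>y. E y $ j)))\<^sup>2)"
    by (rule member_le_sum) auto
  have nn: "0 \<le> (\<Sum>i\<in>UNIV. (n2 (weak_pd D i (\<lambda>y. E y $ j)))\<^sup>2)" by (simp add: sum_nonneg)
  have "(n2 (\<lambda>x. E x $ j))\<^sup>2 \<le> (\<Sum>j\<in>UNIV. ?s j)" using s nn by linarith
  then show "n2 (\<lambda>x. E x $ j) \<le> H1_vec_norm D E"
    unfolding H1_vec_norm_eq by (rule real_le_rsqrt)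
  have "(n2 (weak_pd D i (\<lambda>y. E y $ j)))\<^sup>2 \<le> (\<Sum>j\<in>UNIV. ?s j)"
    using s i zero_le_power2[of "n2 (\<lambda>x. E x $ j)"] by linarith
  then show "n2 (weak_pd D i (\<lambda>y. E y $ j)) \<le> H1_vec_norm D E"
    unfolding H1_vec_norm_eq by (rule real_le_rsqrt)
qed

lemma H1_vec_norm_tendsto_0:
  assumes "\<And>j. (\<lambda>n. n2 (\<lambda>x. E n x $ j)) \<longlonglongrightarrow> 0"
    "\<And>i j. (\<lambda>n. n2 (weak_pd D i (\<lambda>y. E n y $ j))) \<longlonglongrightarrow> 0"
  shows "(\<lambda>n. H1_vec_norm D (E n)) \<longlonglongrightarrow> 0"
proof -
  have "(\<lambda>n. H1_vec_norm D (E n)) \<longlonglongrightarrow> sqrt (\<Sum>j\<in>(UNIV::3 set). 0\<^sup>2 + (\<Sum>i\<in>(UNIV::3 set). 0\<^sup>2))"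
    unfolding H1_vec_norm_eq by (intro tendsto_intros assms)
  then show ?thesis by simp
qed

lemma conv_cong_AE:
  assumes "AE y in M. f y = f' y" "integrable M (\<lambda>y. \<kappa> (x - y) * f y)" "integrable M (\<lambda>y. \<kappa> (x - y) * f' y)"
  shows "conv D \<kappa> f x = conv D \<kappa> f' x"
  unfolding conv_def
  by (rule integral_cong_AE) (use assms in \<open>auto elim!: eventually_mono\<close>)

end

text \<open>The function \<open>d i j\<close> stands for the \<open>i\<close>-th partial derivative of the \<open>j\<close>-th component of \<open>q\<close>, with the real and
  imaginary parts of that component treated as in \<open>supp_pd\<close>; \<open>B\<close> bounds all coefficients at once.\<close>

locale scattering = bounded_open +
  fixes k :: real and K2 :: "real^3 \<Rightarrow> complex" and d :: "3 \<Rightarrow> 3 \<Rightarrow> real^3 \<Rightarrow> complex" and B :: real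
  assumes p_continuous: "continuous_on UNIV (p_coeff k K2)"
    and q_continuous: "\<And>j. continuous_on UNIV (\<lambda>x. q_coeff K2 x $ j)"
    and p_bound: "\<And>x. x \<in> D \<Longrightarrow> norm (p_coeff k K2 x) \<le> B"
    and q_bound: "\<And>x j. x \<in> D \<Longrightarrow> norm (q_coeff K2 x $ j) \<le> B"
    and d_measurable: "\<And>i j. d i j \<in> borel_measurable M"
    and d_bound: "\<And>x i j. x \<in> D \<Longrightarrow> norm (d i j x) \<le> B"
    and B_nonneg: "B \<ge> 0"
    and ext_pd_q: "\<And>i j u v. u \<in> L2 D \<Longrightarrow> v \<in> L2 D \<Longrightarrow> is_weak_pd D i u v \<Longrightarrow>
      ext_pd i (\<lambda>x. q_coeff K2 x $ j * u x) (\<lambda>x. d i j x * u x + q_coeff K2 x $ j * v x)"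
begin

definition qE :: "(real^3 \<Rightarrow> complex^3) \<Rightarrow> real^3 \<Rightarrow> complex" where
  "qE E y = cdot (q_coeff K2 y) (E y)"

lemma cdot_q_eq: "(\<lambda>y. cdot (q_coeff K2 y) (E y)) = qE E"
  by (simp add: fun_eq_iff qE_def)

definition grad_qE :: "3 \<Rightarrow> (real^3 \<Rightarrow> complex^3) \<Rightarrow> real^3 \<Rightarrow> complex" where
  "grad_qE i E y = (\<Sum>j\<in>UNIV. d i j y * E y $ j + q_coeff K2 y $ j * weak_pd D i (\<lambda>z. E z $ j) y)"

text \<open>The \<open>i\<close>-th component of \<open>p E + \<nabla> (q \<cdot> E)\<close>, with the weak gradient given by the product rule.\<close>

definition T_density :: "(real^3 \<Rightarrow> complex^3) \<Rightarrow> 3 \<Rightarrow> real^3 \<Rightarrow> complex" where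
  "T_density E i y = p_coeff k K2 y * E y $ i + grad_qE i E y"

lemma H1_vec_component:
  assumes "E \<in> H1_vec D"
  shows "(\<lambda>y. E y $ j) \<in> L2 D" "weak_pd D i (\<lambda>y. E y $ j) \<in> L2 D" "is_weak_pd D i (\<lambda>y. E y $ j) (weak_pd D i (\<lambda>y. E y $ j))"
  using assms H1_weak_pd[of "\<lambda>y. E y $ j"] by (auto simp: H1_vec_def)

lemma summands_L2:
  assumes "E \<in> H1_vec D"
  shows "(\<lambda>y. p_coeff k K2 y * E y $ j) \<in> L2 D" "(\<lambda>y. q_coeff K2 y $ j * E y $ j) \<in> L2 D"
    "(\<lambda>y. d i j y * E y $ j) \<in> L2 D" "(\<lambda>y. q_coeff K2 y $ j * weak_pd D i (\<lambda>z. E z $ j) y) \<in> L2 D"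
proof -
  show "(\<lambda>y. p_coeff k K2 y * E y $ j) \<in> L2 D"
    by (rule L2_continuous_mult[OF p_continuous H1_vec_component(1)[OF assms]])
  show "(\<lambda>y. q_coeff K2 y $ j * E y $ j) \<in> L2 D"
    by (rule L2_continuous_mult[OF q_continuous H1_vec_component(1)[OF assms]])
  show "(\<lambda>y. d i j y * E y $ j) \<in> L2 D"
    by (rule L2_bounded_mult[OF d_measurable d_bound H1_vec_component(1)[OF assms]])
  show "(\<lambda>y. q_coeff K2 y $ j * weak_pd D i (\<lambda>z. E z $ j) y) \<in> L2 D"
    by (rule L2_continuous_mult[OF q_continuous H1_vec_component(2)[OF assms]])
qed

lemma qE_L2:
  assumes "E \<in> H1_vec D"
  shows "qE E \<in> L2 D" "grad_qE i E \<in> L2 D" "T_density E i \<in> L2 D"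
proof -
  show "qE E \<in> L2 D"
    unfolding qE_def[abs_def] cdot_def by (intro L2_sum summands_L2 assms) simp
  show g: "grad_qE i E \<in> L2 D"
    unfolding grad_qE_def[abs_def] by (intro L2_sum L2_add summands_L2 assms) simp
  show "T_density E i \<in> L2 D"
    unfolding T_density_def[abs_def] by (intro L2_add g summands_L2 assms)
qed

lemma ext_pd_qE:
  assumes "E \<in> H1_vec D"
  shows "ext_pd i (qE E) (grad_qE i E)"
  unfolding qE_def[abs_def] cdot_def grad_qE_def[abs_def]
  by (rule ext_pd_sum[OF finite summands_L2(2)[OF assms] L2_add[OF summands_L2(3,4)[OF assms]]
        ext_pd_q[OF H1_vec_component[OF assms]]])

text \<open>One term comes from \<open>p\<close>, and two from each of the three components of \<open>q\<close>.\<close>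

lemma n2_T_density:
  assumes "E \<in> H1_vec D"
  shows "n2 (T_density E i) \<le> 7 * B * H1_vec_norm D E"
proof -
  let ?H = "H1_vec_norm D E"
  note le = n2_le_H1_vec_norm[where E = E]
  note m = continuous_measurable_M[OF p_continuous] continuous_measurable_M[OF q_continuous] d_measurable
  have 1: "n2 (\<lambda>y. p_coeff k K2 y * E y $ i) \<le> B * ?H"
    by (rule order_trans[OF n2_bound[OF m(1) p_bound B_nonneg H1_vec_component(1)[OF assms]] mult_left_mono[OF le(1) B_nonneg]])
  have 2: "n2 (\<lambda>y. d i j y * E y $ j) \<le> B * ?H" for j
    by (rule order_trans[OF n2_bound[OF m(3) d_bound B_nonneg H1_vec_component(1)[OF assms]] mult_left_mono[OF le(1) B_nonneg]])
  have 3: "n2 (\<lambda>y. q_coeff K2 y $ j * weak_pd D i (\<lambda>z. E z $ j) y) \<le> B * ?H" for j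
    by (rule order_trans[OF n2_bound[OF m(2) q_bound B_nonneg H1_vec_component(2)[OF assms]] mult_left_mono[OF le(2) B_nonneg]])
  have 4: "n2 (\<lambda>y. d i j y * E y $ j + q_coeff K2 y $ j * weak_pd D i (\<lambda>z. E z $ j) y) \<le> 2 * (B * ?H)" for j
    using n2_triangle[OF summands_L2(3)[OF assms, of i j] summands_L2(4)[OF assms, of j i]] 2[of j] 3[of j] by linarith
  have "n2 (grad_qE i E) \<le> (\<Sum>j\<in>UNIV. n2 (\<lambda>y. d i j y * E y $ j + q_coeff K2 y $ j * weak_pd D i (\<lambda>z. E z $ j) y))"
    unfolding grad_qE_def[abs_def] by (rule n2_triangle_sum[OF finite L2_add[OF summands_L2(3,4)[OF assms]]])
  also have "\<dots> \<le> (\<Sum>j\<in>(UNIV::3 set). 2 * (B * ?H))" by (rule sum_mono) (rule 4)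
  finally have "n2 (grad_qE i E) \<le> 6 * (B * ?H)" by simp
  then show ?thesis
    using n2_triangle[OF summands_L2(1)[OF assms, of i] qE_L2(2)[OF assms, of i]] 1
    unfolding T_density_def[abs_def] by simp
qed

lemma vector_potential_nth:
  assumes F: "\<And>j. (\<lambda>y. F y $ j) \<in> L2 D" and x: "x \<in> D"
  shows "integrable M (\<lambda>y. green k x y *s F y)" "vector_potential k D F x $ i = S k (\<lambda>y. F y $ i) x"
proof -
  have i: "integrable M (\<lambda>y. (green k x y *s F y) $ j)" for j
    using integrable_gker[OF F less_imp_le[OF norm_less_rad[OF x]]] by (simp add: green_eq_gker)
  show "integrable M (\<lambda>y. green k x y *s F y)" by (rule integrable_vec[OF i])
  show "vector_potential k D F x $ i = S k (\<lambda>y. F y $ i) x"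
    unfolding vector_potential_def integral_vec_nth[OF i] by (simp add: conv_def green_eq_gker)
qed

lemma integrable_S:
  "f \<in> L2 D \<Longrightarrow> x \<in> D \<Longrightarrow> integrable M (\<lambda>y. gker k 0 (x - y) * f y)"
  by (rule integrable_gker) (auto dest: norm_less_rad)

lemma S_linear:
  assumes "f \<in> L2 D" "f' \<in> L2 D" "x \<in> D"
  shows "S k (\<lambda>y. c * f y + f' y) x = c * S k f x + S k f' x"
  by (rule conv_linear) (intro integrable_S assms)+

text \<open>As \<open>q \<cdot> E\<close> is weakly differentiable across the boundary, the gradient in front of the second integral passes
  to the density.\<close>

lemma T_op_nth:
  assumes "E \<in> H1_vec D" "x \<in> D"
  shows "T_op k K2 D E x $ i = S k (T_density E i) x"
proof -
  have "vector_potential k D (\<lambda>y. p_coeff k K2 y *s E y) x $ i = S k (\<lambda>y. p_coeff k K2 y * E y $ i) x"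
    by (subst vector_potential_nth(2)) (use assms summands_L2(1)[OF assms(1)] in auto)
  moreover have "grad (scalar_potential k D (qE E)) x $ i = S k (grad_qE i E) x"
    unfolding grad_def scalar_potential_eq_conv
    using S_has_gradient(2)[OF qE_L2(1)[OF assms(1)] qE_L2(2)[OF assms(1)] ext_pd_qE[OF assms(1)] assms(2)] by simp
  moreover have "S k (T_density E i) x = S k (\<lambda>y. p_coeff k K2 y * E y $ i) x + S k (grad_qE i E) x"
    using S_linear[OF summands_L2(1)[OF assms(1)] qE_L2(2)[OF assms(1)] assms(2), of 1 i i] by (simp add: T_density_def[abs_def])
  ultimately show ?thesis by (simp add: T_op_def qE_def[abs_def])
qed

lemma T_op_H1_vec:
  assumes "E \<in> H1_vec D"
  shows "T_op k K2 D E \<in> H1_vec D"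
proof -
  note de = qE_L2(3)[OF assms]
  have w: "is_weak_pd D i (\<lambda>x. T_op k K2 D E x $ j) (dS k i (T_density E j))" for i j
    by (rule is_weak_pd_cong[OF is_weak_pd_S[OF de]]) (simp add: T_op_nth[OF assms])
  have L: "(\<lambda>x. T_op k K2 D E x $ j) \<in> L2 D" for j
    by (rule L2_cong[OF S_L2(1)[OF de]]) (simp add: T_op_nth[OF assms])
  show "T_op k K2 D E \<in> H1_vec D"
    unfolding H1_vec_def by (intro CollectI allI H1I[OF L dS(1)[OF de] w])
qed

text \<open>The chosen weak derivatives are additive only up to null sets. Linearity at every point of \<open>D\<close> is obtained by using the
  sum of the chosen derivatives as a weak derivative for the sum of the fields.\<close>

lemma T_op_linear:
  assumes E: "E \<in> H1_vec D" and F: "F \<in> H1_vec D" and x: "x \<in> D"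
  shows "T_op k K2 D (\<lambda>y. c *s E y + F y) x = c *s T_op k K2 D E x + T_op k K2 D F x"
proof -
  let ?G = "\<lambda>y. c *s E y + F y"
  have "vector_potential k D (\<lambda>y. p_coeff k K2 y *s ?G y) x $ i =
    c * S k (\<lambda>y. p_coeff k K2 y * E y $ i) x + S k (\<lambda>y. p_coeff k K2 y * F y $ i) x" for i
  proof -
    have eq: "(p_coeff k K2 y *s ?G y) $ j = c * (p_coeff k K2 y * E y $ j) + p_coeff k K2 y * F y $ j" for y j
      by (simp add: algebra_simps)
    have "(\<lambda>y. (p_coeff k K2 y *s ?G y) $ j) \<in> L2 D" for j
      unfolding eq by (intro L2_add L2_cmult summands_L2 E F)
    from vector_potential_nth(2)[OF this x]
    have "vector_potential k D (\<lambda>y. p_coeff k K2 y *s ?G y) x $ i = S k (\<lambda>y. c * (p_coeff k K2 y * E y $ i) + p_coeff k K2 y * F y $ i) x"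
      unfolding eq .
    then show ?thesis using S_linear[OF summands_L2(1)[OF E] summands_L2(1)[OF F] x] by simp
  qed
  moreover have "pd i (S k (qE ?G)) x = c * S k (grad_qE i E) x + S k (grad_qE i F) x" for i
  proof -
    have eq: "qE ?G = (\<lambda>y. c * qE E y + qE F y)"
      by (simp add: fun_eq_iff qE_def cdot_def sum_distrib_left sum.distrib[symmetric] algebra_simps)
    have "pd i (S k (qE ?G)) x = S k (\<lambda>y. c * grad_qE i E y + grad_qE i F y) x"
      unfolding eq
      by (rule S_has_gradient(2)[where v = "\<lambda>i y. c * grad_qE i E y + grad_qE i F y"])
        (intro L2_add L2_cmult qE_L2 E F ext_pd_linear ext_pd_qE x)+
    then show ?thesis using S_linear[OF qE_L2(2)[OF E] qE_L2(2)[OF F] x] by simp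
  qed
  moreover have "S k (T_density E' i) x = S k (\<lambda>y. p_coeff k K2 y * E' y $ i) x + S k (grad_qE i E') x" if "E' \<in> H1_vec D" for E' i
    using S_linear[OF summands_L2(1)[OF that] qE_L2(2)[OF that] x, of 1 i i] by (simp add: T_density_def[abs_def])
  moreover have "T_op k K2 D ?G x $ i = vector_potential k D (\<lambda>y. p_coeff k K2 y *s ?G y) x $ i + pd i (S k (qE ?G)) x" for i
    by (simp only: T_op_def grad_def scalar_potential_eq_conv qE_def[abs_def] vector_add_component vec_lambda_beta)
  ultimately have "T_op k K2 D ?G x $ i = c * T_op k K2 D E x $ i + T_op k K2 D F x $ i" for i
    using T_op_nth[OF E x] T_op_nth[OF F x] E F by (simp only:) (simp add: distrib_left)
  then show ?thesis by (simp add: vec_eq_iff)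
qed

text \<open>The densities form a bounded sequence in \<open>L2 D\<close>, to which the compactness of \<open>S\<close> applies. The limits of the
  potentials and of their gradients are compatible because weak differentiation is closed.\<close>

lemma T_op_compact:
  assumes E: "\<And>n. E n \<in> H1_vec D" and bd: "\<And>n. H1_vec_norm D (E n) \<le> C"
  shows "\<exists>r :: nat \<Rightarrow> nat. \<exists>F\<in>H1_vec D. strict_mono r \<and>
    (\<lambda>n. H1_vec_norm D (\<lambda>x. T_op k K2 D (E (r n)) x - F x)) \<longlonglongrightarrow> 0"
proof -
  let ?f = "\<lambda>j n. T_density (E n) j"
  note de = qE_L2(3)[OF E]
  have "n2 (?f j n) \<le> 7 * B * C" for j n
    by (rule order_trans[OF n2_T_density[OF E] mult_left_mono[OF bd]]) (simp add: B_nonneg)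
  from S_compact[of ?f, OF de this, of k] obtain r where r: "strict_mono (r :: nat \<Rightarrow> nat)"
    and C1: "\<And>j e. e > 0 \<Longrightarrow> \<exists>N. \<forall>p\<ge>N. \<forall>l\<ge>N. n2 (\<lambda>x. S k (?f j (r p)) x - S k (?f j (r l)) x) \<le> e"
    and C2: "\<And>j i e. e > 0 \<Longrightarrow> \<exists>N. \<forall>p\<ge>N. \<forall>l\<ge>N. n2 (\<lambda>x. dS k i (?f j (r p)) x - dS k i (?f j (r l)) x) \<le> e"
    by blast
  have "\<forall>j. \<exists>A. A \<in> L2 D \<and> (\<lambda>n. n2 (\<lambda>x. S k (?f j (r n)) x - A x)) \<longlonglongrightarrow> 0"
    by (rule allI) (rule L2_complete[OF S_L2(1)[OF de] C1, unfolded Bex_def])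
  from choice[OF this] obtain A
    where A': "\<forall>j. A j \<in> L2 D \<and> (\<lambda>n. n2 (\<lambda>x. S k (?f j (r n)) x - A j x)) \<longlonglongrightarrow> 0" ..
  have A: "A j \<in> L2 D" "(\<lambda>n. n2 (\<lambda>x. S k (?f j (r n)) x - A j x)) \<longlonglongrightarrow> 0" for j
    using A'[THEN spec, of j] by simp_all
  have "\<forall>a. \<exists>V. V \<in> L2 D \<and> (\<lambda>n. n2 (\<lambda>x. dS k (fst a) (?f (snd a) (r n)) x - V x)) \<longlonglongrightarrow> 0"
    by (rule allI) (rule L2_complete[OF dS(1)[OF de] C2, unfolded Bex_def])
  from choice[OF this] obtain V0
    where V': "\<forall>a. V0 a \<in> L2 D \<and> (\<lambda>n. n2 (\<lambda>x. dS k (fst a) (?f (snd a) (r n)) x - V0 a x)) \<longlonglongrightarrow> 0" ..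
  define V where "V i j = V0 (i, j)" for i j
  have V: "V i j \<in> L2 D" "(\<lambda>n. n2 (\<lambda>x. dS k i (?f j (r n)) x - V i j x)) \<longlonglongrightarrow> 0" for i j
    using V'[THEN spec, of "(i, j)"] by (simp_all add: V_def)
  have AV: "is_weak_pd D i (A j) (V i j)" for i j
    by (rule is_weak_pd_closed[OF S_L2(1)[OF de] dS(1)[OF de] is_weak_pd_S[OF de] A(1) V(1) A(2) V(2)])
  define F where "F x = (\<chi> j. A j x)" for x
  have F: "F \<in> H1_vec D"
    unfolding H1_vec_def F_def using H1I[OF A(1) V(1) AV] by simp
  let ?U = "\<lambda>n x. T_op k K2 D (E (r n)) x - F x"
  have comp: "?U n x $ j = S k (?f j (r n)) x - A j x" if "x \<in> D" for n x j
    using T_op_nth[OF E that] by (simp add: F_def)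
  have "(\<lambda>n. H1_vec_norm D (?U n)) \<longlonglongrightarrow> 0"
  proof (rule H1_vec_norm_tendsto_0)
    show "(\<lambda>n. n2 (\<lambda>x. ?U n x $ j)) \<longlonglongrightarrow> 0" for j
      using A(2)[of j] n2_cong_D[of "\<lambda>x. ?U _ x $ j", OF comp] by simp
    show "(\<lambda>n. n2 (weak_pd D i (\<lambda>y. ?U n y $ j))) \<longlonglongrightarrow> 0" for i j
    proof -
      have "is_weak_pd D i (\<lambda>x. (- 1) * A j x + S k (?f j (r n)) x) (\<lambda>x. (- 1) * V i j x + dS k i (?f j (r n)) x)" for n
        by (rule is_weak_pd_linear[OF A(1) S_L2(1)[OF de] V(1) dS(1)[OF de] AV is_weak_pd_S[OF de]])
      then have "is_weak_pd D i (\<lambda>x. ?U n x $ j) (\<lambda>x. (- 1) * V i j x + dS k i (?f j (r n)) x)" for n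
        by (rule is_weak_pd_cong) (subst comp; simp)
      moreover have "(\<lambda>x. (- 1) * V i j x + dS k i (?f j (r n)) x) \<in> L2 D" for n
        by (intro L2_add L2_cmult V(1) dS(1) de)
      ultimately have "n2 (weak_pd D i (\<lambda>y. ?U n y $ j)) = n2 (\<lambda>x. (- 1) * V i j x + dS k i (?f j (r n)) x)" for n
        by (rule n2_weak_pd[rotated])
      then show ?thesis using V(2)[of i j] by simp
    qed
  qed
  with r F show ?thesis by blast
qed

lemma compact_operator_T_op: "compact_operator_H1 D (T_op k K2 D)"
  unfolding compact_operator_H1_def
proof (intro conjI ballI allI impI)
  show "T_op k K2 D E \<in> H1_vec D" if "E \<in> H1_vec D" for E
    by (rule T_op_H1_vec[OF that])
  show "AE x in M. T_op k K2 D (\<lambda>y. c *s E y + F y) x = c *s T_op k K2 D E x + T_op k K2 D F x"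
    if "E \<in> H1_vec D" "F \<in> H1_vec D" for E F c
    by (rule AE_I2) (simp add: T_op_linear[OF that])
  fix E :: "nat \<Rightarrow> real^3 \<Rightarrow> complex^3"
  assume "(\<forall>n. E n \<in> H1_vec D) \<and> (\<exists>B. \<forall>n. H1_vec_norm D (E n) \<le> B)"
  then show "\<exists>r :: nat \<Rightarrow> nat. \<exists>F\<in>H1_vec D. strict_mono r \<and>
    (\<lambda>n. H1_vec_norm D (\<lambda>x. T_op k K2 D (E (r n)) x - F x)) \<longlonglongrightarrow> 0"
    using T_op_compact by blast
qed

text \<open>Uniqueness of weak derivatives identifies the density in the equation with the one given by the product rule.\<close>

lemma source_density_AE:
  assumes "E \<in> H1_vec D"
  shows "AE y in M. source_density k K2 D E y $ i = T_density E i y"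
    and "(\<lambda>y. source_density k K2 D E y $ i) \<in> L2 D"
proof -
  note w = weak_pd_witness[OF qE_L2(2)[OF assms] ext_pd_is_weak_pd[OF ext_pd_qE[OF assms]], of i]
  have eq: "source_density k K2 D E y $ i = p_coeff k K2 y * E y $ i + weak_pd D i (qE E) y" for y
    by (simp add: source_density_def weak_grad_def qE_def[abs_def])
  show "AE y in M. source_density k K2 D E y $ i = T_density E i y"
    using w(3) by eventually_elim (simp add: eq T_density_def)
  show "(\<lambda>y. source_density k K2 D E y $ i) \<in> L2 D"
    unfolding eq by (intro L2_add summands_L2 w assms)
qed

lemma operators_well_defined:
  assumes "E \<in> H1_vec D"
  shows "operators_well_defined k K2 D E"
  unfolding operators_well_defined_def cdot_q_eq
proof (intro conjI ballI)
  show "qE E \<in> H1 D"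
    by (rule H1I[OF qE_L2(1,2)[OF assms] ext_pd_is_weak_pd[OF ext_pd_qE[OF assms]]])
  fix x assume x: "x \<in> D"
  show "integrable M (\<lambda>y. green k x y *s (p_coeff k K2 y *s E y))"
    using summands_L2(1)[OF assms] by (intro vector_potential_nth(1) x) simp
  show "integrable M (\<lambda>y. green k x y * cdot (q_coeff K2 y) (E y))"
    using integrable_S[OF qE_L2(1)[OF assms] x] by (simp add: green_eq_gker qE_def)
  show "scalar_potential k D (qE E) differentiable (at x)"
    unfolding scalar_potential_eq_conv
    by (rule S_has_gradient(1)[OF qE_L2(1,2)[OF assms] ext_pd_qE[OF assms] x])
  show "integrable M (\<lambda>y. green k x y *s source_density k K2 D E y)"
    by (rule vector_potential_nth(1)[OF source_density_AE(2)[OF assms] x])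
qed

lemma scattering_rhs_eq:
  assumes "E \<in> H1_vec D" "x \<in> D"
  shows "scattering_rhs k K2 D E0 E x = E0 x + T_op k K2 D E x"
proof -
  have "vector_potential k D (source_density k K2 D E) x $ i = T_op k K2 D E x $ i" for i
  proof -
    have "vector_potential k D (source_density k K2 D E) x $ i = S k (\<lambda>y. source_density k K2 D E y $ i) x"
      by (rule vector_potential_nth(2)[OF source_density_AE(2)[OF assms(1)] assms(2)])
    also have "\<dots> = S k (T_density E i) x"
      by (rule conv_cong_AE[OF source_density_AE(1)[OF assms(1)]])
        (intro integrable_S source_density_AE qE_L2 assms)+
    finally show ?thesis using T_op_nth[OF assms] by simp
  qed
  then show ?thesis by (simp add: scattering_rhs_def vec_eq_iff)
qed

end

lemma Ck_1_plane_wave: "Ck 1 (\<lambda>x. plane_wave k \<alpha> \<E> x $ j)"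
proof -
  let ?u = "\<lambda>x. plane_wave k \<alpha> \<E> x $ j"
  have d: "(?u has_derivative (\<lambda>h. exp (\<i> * of_real (k * (\<alpha> \<bullet> x))) * (\<i> * of_real (k * (\<alpha> \<bullet> h))) * \<E> $ j)) (at x)" for x
  proof -
    have "((\<lambda>x. k * (\<alpha> \<bullet> x)) has_derivative (\<lambda>h. k * (\<alpha> \<bullet> h))) (at x)"
      by (auto intro!: derivative_eq_intros)
    from has_derivative_mult_right[OF has_derivative_of_real[OF this], of \<i>]
    have "((\<lambda>x. \<i> * of_real (k * (\<alpha> \<bullet> x))) has_derivative (\<lambda>h. \<i> * of_real (k * (\<alpha> \<bullet> h)) :: complex)) (at x)" .
    from has_derivative_mult_left[OF has_derivative_compose[OF this DERIV_exp[unfolded has_field_derivative_def]], of "\<E> $ j"]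
    show ?thesis by (simp add: plane_wave_def)
  qed
  have pd: "pd i ?u = (\<lambda>x. exp (\<i> * of_real (k * (\<alpha> \<bullet> x))) * (\<i> * of_real (k * (\<alpha> \<bullet> axis i 1))) * \<E> $ j)" for i
    by (intro ext) (rule pd_eqI[OF d])
  have "?u differentiable (at x)" for x
    unfolding differentiable_def by (rule exI) (rule d)
  moreover have "continuous_on UNIV (pd i ?u)" for i
    unfolding pd by (intro continuous_intros)
  ultimately show ?thesis by simp
qed

lemma (in bounded_open) plane_wave_H1_vec: "plane_wave k \<alpha> \<E> \<in> H1_vec D"
proof -
  note C = Ck_1_plane_wave[of k \<alpha> \<E>]
  have "(\<lambda>x. plane_wave k \<alpha> \<E> x $ j) \<in> H1 D" for j
    by (rule H1I[OF continuous_L2[OF Ck_imp_continuous[OF C]]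
          continuous_L2[OF Ck_1_pd_continuous[OF C]] classical_is_weak_pd[OF C]])
  then show ?thesis by (simp add: H1_vec_def)
qed

lemma (in bounded_open) scattering_exists:
  assumes K2: "Ck 2 K2" and nz: "\<And>x. K2 x \<noteq> 0" and q0: "\<And>x. x \<notin> D \<Longrightarrow> q_coeff K2 x = 0"
  shows "\<exists>d B. scattering D k K2 d B"
proof -
  have K2': "Ck (Suc (Suc 0)) K2" using K2 by (simp add: numeral_2_eq_2)
  have K1: "Ck 1 K2" using Ck_Suc_imp[OF K2'] by simp
  have pK: "Ck 1 (pd j K2)" for j using K2' by simp
  have qeq: "q_coeff K2 x $ j = (1 / K2 x) * pd j K2 x" for x j
    by (simp add: q_coeff_def grad_def)
  have q: "Ck 1 (\<lambda>x. q_coeff K2 x $ j)" for j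
    unfolding qeq by (rule Ck_mult[OF Ck_1_inverse[OF K1 nz] pK])
  have p: "continuous_on UNIV (p_coeff k K2)"
    unfolding p_coeff_def[abs_def] by (intro continuous_intros Ck_imp_continuous[OF K1])
  define Q where "Q i j d B \<longleftrightarrow> d \<in> borel_measurable M \<and> (\<forall>x\<in>D. norm (d x) \<le> B) \<and>
    (\<forall>u\<in>L2 D. \<forall>v\<in>L2 D. is_weak_pd D i u v \<longrightarrow>
      ext_pd i (\<lambda>x. q_coeff K2 x $ j * u x) (\<lambda>x. d x * u x + q_coeff K2 x $ j * v x))"
    for i j and d :: "real^3 \<Rightarrow> complex" and B :: real
  have "\<exists>d B. Q i j d B" for i j
    unfolding Q_def by (rule ext_pd_product[OF q]) (simp add: q0)
  then have "\<forall>a. \<exists>b. Q (fst a) (snd a) (fst b) (snd b)" by simp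
  from choice[OF this] obtain g where g: "\<forall>a. Q (fst a) (snd a) (fst (g a)) (snd (g a))" ..
  define d where "d i j = fst (g (i, j))" for i j
  define Bd where "Bd i j = snd (g (i, j))" for i j
  have "Q i j (d i j) (Bd i j)" for i j
    using g[THEN spec, of "(i, j)"] by (simp add: d_def Bd_def)
  then have d: "\<And>i j. d i j \<in> borel_measurable M" "\<And>i j x. x \<in> D \<Longrightarrow> norm (d i j x) \<le> Bd i j"
    "\<And>i j u v. u \<in> L2 D \<Longrightarrow> v \<in> L2 D \<Longrightarrow> is_weak_pd D i u v \<Longrightarrow>
      ext_pd i (\<lambda>x. q_coeff K2 x $ j * u x) (\<lambda>x. d i j x * u x + q_coeff K2 x $ j * v x)"
    unfolding Q_def by simp_all
  obtain Bp where Bp: "\<And>z. norm z \<le> rad \<Longrightarrow> norm (p_coeff k K2 z) \<le> Bp"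
    using continuous_bounded_cball[OF p] by metis
  have "\<exists>B. \<forall>z. norm z \<le> rad \<longrightarrow> norm (q_coeff K2 z $ j) \<le> B" for j
    using continuous_bounded_cball[OF Ck_imp_continuous[OF q[of j]], of rad] by metis
  then obtain Bq where Bq: "\<And>j z. norm z \<le> rad \<Longrightarrow> norm (q_coeff K2 z $ j) \<le> Bq j" by metis
  define B where "B = \<bar>Bp\<bar> + (\<Sum>j\<in>UNIV. \<bar>Bq j\<bar>) + (\<Sum>i\<in>UNIV. \<Sum>j\<in>UNIV. \<bar>Bd i j\<bar>)"
  have s1: "\<bar>Bq j\<bar> \<le> (\<Sum>j\<in>UNIV. \<bar>Bq j\<bar>)" for j by (rule member_le_sum) auto
  have s2: "\<bar>Bd i j\<bar> \<le> (\<Sum>j\<in>UNIV. \<bar>Bd i j\<bar>)" for i j by (rule member_le_sum) auto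
  have s3: "(\<Sum>j\<in>UNIV. \<bar>Bd i j\<bar>) \<le> (\<Sum>i\<in>UNIV. \<Sum>j\<in>UNIV. \<bar>Bd i j\<bar>)" for i
    by (rule member_le_sum) (auto intro: sum_nonneg)
  have nn: "0 \<le> (\<Sum>j\<in>UNIV. \<bar>Bq j\<bar>)" "0 \<le> (\<Sum>i\<in>UNIV. \<Sum>j\<in>UNIV. \<bar>Bd i j\<bar>)"
    by (auto intro!: sum_nonneg)
  have le: "Bp \<le> B" "Bq j \<le> B" "Bd i j \<le> B" "0 \<le> B" for i j
    using s1[of j] s2[of i j] s3[of i] nn unfolding B_def by linarith+
  have "scattering D k K2 d B"
  proof
    show "norm (p_coeff k K2 x) \<le> B" if "x \<in> D" for x
      using Bp[OF less_imp_le[OF norm_less_rad[OF that]]] le(1) by linarith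
    show "norm (q_coeff K2 x $ j) \<le> B" if "x \<in> D" for x j
      using Bq[OF less_imp_le[OF norm_less_rad[OF that]], of j] le(2)[of j] by linarith
    show "norm (d i j x) \<le> B" if "x \<in> D" for x i j
      using d(2)[OF that, of i j] le(3)[of i j] by linarith
  qed (use p Ck_imp_continuous[OF q] d(1,3) le(4) in auto)
  then show ?thesis by blast
qed

theorem lemma2p1:
  fixes D :: "(real^3) set" and k :: real and K2 :: "real^3 \<Rightarrow> complex"
    and \<alpha> :: "real^3" and \<E> :: "complex^3"
  assumes "open D" "connected D" "D \<noteq> {}" "bounded D"
    and "k > 0"
    and "Ck 2 K2"
    and "\<forall>x. K2 x \<noteq> 0"
    and "\<forall>x. x \<notin> D \<longrightarrow> K2 x = of_real (k\<^sup>2)"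
    and "\<forall>x. x \<notin> D \<longrightarrow> q_coeff K2 x = 0"
    and "\<alpha> \<in> sphere 0 1"
    and "cdot \<E> (\<chi> j. of_real (\<alpha> $ j)) = 0"
  shows "(\<forall>E\<in>H1_vec D. operators_well_defined k K2 D E) \<and>
         compact_operator_H1 D (T_op k K2 D) \<and>
         fredholm_second_kind_H1 D (scattering_rhs k K2 D (plane_wave k \<alpha> \<E>))
           (plane_wave k \<alpha> \<E>) (T_op k K2 D)"
proof -
  interpret bounded_open D by unfold_locales (rule assms)+
  obtain d B where "scattering D k K2 d B"
    using scattering_exists[of K2 k] assms by blast
  then interpret scattering D k K2 d B .
  have "AE x in M. scattering_rhs k K2 D (plane_wave k \<alpha> \<E>) E x = plane_wave k \<alpha> \<E> x + T_op k K2 D E x"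
    if "E \<in> H1_vec D" for E
    by (rule AE_I2) (simp add: scattering_rhs_eq[OF that])
  then show ?thesis
    unfolding fredholm_second_kind_H1_def
    using operators_well_defined compact_operator_T_op plane_wave_H1_vec by blast
qed

end
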